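(* Let $p\ge 1$ be an integer, let $\alpha,\beta\in\mathbb{R}$, and let $\bm\nu=(\nu_1,\nu_2)\in\mathbb{Q}^2$ have positive components. For $n\in\mathbb{N}$ with $n\bm\nu\in\mathbb{N}^2$, put $\bm n=(n_1,n_2)=(n\nu_1,n\nu_2)$ and consider the matrix $\mathcal{A}^{p,\alpha,\beta}_{\bm n}$ of size $2(n_1+p-2)(n_2+p-2)$ defined in the context. Then, as $n\to\infty$, $$\{\mathcal{A}^{p,\alpha,\beta}_{\bm n}\}_{\bm n}\sim_\lambda (f^{p,\alpha,\beta},[-\pi,\pi]^2),$$ where $f^{p,\alpha,\beta}:[-\pi,\pi]^2\to\mathbb{C}^{2\times 2}$ is the matrix-valued function $f^{p,\alpha,\beta}=[f^{p,\alpha,\beta}_{i,j}]_{i,j=1}^2$ with entries $$f^{p,\alpha,\beta}_{1,1}(\theta_1,\theta_2)=\alpha\frac{\nu_2}{\nu_1}\mathfrak{m}_p(\theta_1)\mathfrak{s}_p(\theta_2)+\beta\frac{\nu_1}{\nu_2}\mathfrak{s}_p(\theta_1)\mathfrak{m}_p(\theta_2),$$ $$f^{p,\alpha,\beta}_{1,2}(\theta_1,\theta_2)=f^{p,\alpha,\beta}_{2,1}(\theta_1,\theta_2)=-(\alpha-\beta)\,\mathfrak{a}_p(\theta_1)\mathfrak{a}_p(\theta_2),$$ $$f^{p,\alpha,\beta}_{2,2}(\theta_1,\theta_2)=\alpha\frac{\nu_1}{\nu_2}\mathfrak{s}_p(\theta_1)\mathfrak{m}_p(\theta_2)+\beta\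frac{\nu_2}{\nu_1}\mathfrak{m}_p(\theta_1)\mathfrak{s}_p(\theta_2).$$
   Context: **B-splines.** For integers $p\ge 0$, $n\ge 1$, consider the knots $\xi_1=\cdots=\xi_{p+1}=0<\xi_{p+2}<\cdots<\xi_{p+n}<1=\xi_{p+n+1}=\cdots=\xi_{2p+n+1}$ with $\xi_{i+p+1}=i/n$ for $i=0,\ldots,n$. For $1\le i\le n+2p$ let $N_i^0(x)=1$ if $x\in[\xi_i,\xi_{i+1})$ and $0$ otherwise. For $1\le k\le p$, $1\le i\le n+2p-k$, $$N_i^k(x)=\frac{x-\xi_i}{\xi_{i+k}-\xi_i}N_i^{k-1}(x)+\frac{\xi_{i+k+1}-x}{\xi_{i+k+1}-\xi_{i+1}}N_{i+1}^{k-1}(x),$$ where a fraction with zero denominator is taken to be zero. This gives the $n+p$ degree-$p$ B-splines $N_1^p,\ldots,N_{n+p}^p$ on $[0,1]$ (they depend on $n$). **Univariate matrices** (for $p\ge1$; all of size $n+p-2$, indices $i,j=1,\ldots,n+p-2$): $$(M^p_n)_{i,j}=\int_0^1 N^p_{i+1}N^p_{j+1}\,dx,\quad (A^p_n)_{i,j}=\int_0^1 N^p_{i+1}(N^p_{j+1})'\,dx,\quad (S^p_n)_{i,j}=\int_0^1 (N^p_{i+1})'(N^p_{j+1})'\,dx.$$ **2D curl-div matrix** ($\otimes$ is the Kronecker product): $$\mathcal{A}^{p,\alpha,\beta}_{\bm n}=\alpha\begin{bmatrix} M^p_{n_1}\otimes S^p_{n_2} & -(A^p_{n_1})^T\otimes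 A^p_{n_2}\\ -A^p_{n_1}\otimes (A^p_{n_2})^T & S^p_{n_1}\otimes M^p_{n_2}\end{bmatrix}+\beta\begin{bmatrix} S^p_{n_1}\otimes M^p_{n_2} & A^p_{n_1}\otimes (A^p_{n_2})^T\\ (A^p_{n_1})^T\otimes A^p_{n_2} & M^p_{n_1}\otimes S^p_{n_2}\end{bmatrix}.$$ **Cardinal B-splines.** $\phi_0(t)=1$ for $t\in[0,1)$ and $0$ otherwise; for $p\ge1$, $\phi_p(t)=\frac{t}{p}\phi_{p-1}(t)+\frac{p+1-t}{p}\phi_{p-1}(t-1)$. **Univariate symbols.** For $\theta\in[-\pi,\pi]$, $$\mathfrak{m}_p(\theta)=\phi_{2p+1}(p+1)+2\sum_{k=1}^p\phi_{2p+1}(p+1-k)\cos(k\theta),$$ $$\mathfrak{a}_p(\theta)=-2\sum_{k=1}^p\phi_{2p+1}'(p+1-k)\sin(k\theta),$$ $$\mathfrak{s}_p(\theta)=-\phi_{2p+1}''(p+1)-2\sum_{k=1}^p\phi_{2p+1}''(p+1-k)\cos(k\theta).$$ **Spectral distribution.** Let $f:G\to\mathbb{C}^{s\times s}$ be measurable, $G\subset\mathbb{R}^q$ measurable with Lebesgue measure $0<\mu_q(G)<\infty$, and let $\{A_{\bm n}\}_{\bm n}$ be a sequence of square matrices of sizes $d_{\bm n}\to\infty$ as $\bm n\to\infty$ (all components tend to infinity). One writes $\{A_{\bm n}\}_{\bm n}\sim_\lambda(f,G)$ if for every continuous compactly supported $F:\mathbb{C}\to\mathbb{C}$, $$\lim_{\bm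 n\to\infty}\frac1{d_{\bm n}}\sum_{j=1}^{d_{\bm n}}F(\lambda_j(A_{\bm n}))=\frac1{\mu_q(G)}\int_G\frac{1}{s}\sum_{i=1}^sF(\lambda_i(f(\bm t)))\,d\bm t,$$ where $\lambda_j(\cdot)$ denote eigenvalues counted with multiplicity. *)

theory Defs
  imports "HOL-Analysis.Analysis" "Jordan_Normal_Form.Char_Poly"
begin

definition knot :: "nat \<Rightarrow> nat \<Rightarrow> nat \<Rightarrow> real" where
  "knot p n i =
     (if i \<le> p + 1 then 0 else if i \<le> p + n + 1 then real (i - (p + 1)) / real n else 1)"

text \<open>
  \<open>bspline p n k i\<close> is $N_i^k$ for the knots determined by the final degree \<open>p\<close> and by \<open>n\<close>;
  it is meaningful for \<open>1 \<le> i \<le> n + 2 * p - k\<close> and \<open>k \<le> p\<close>. Fractions with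
  zero denominator vanish because of \<open>x / 0 = 0\<close>.
\<close>

primrec bspline :: "nat \<Rightarrow> nat \<Rightarrow> nat \<Rightarrow> nat \<Rightarrow> real \<Rightarrow> real" where
  "bspline p n 0 i x = (if knot p n i \<le> x \<and> x < knot p n (i + 1) then 1 else 0)"
| "bspline p n (Suc k) i x =
     (x - knot p n i) / (knot p n (i + Suc k) - knot p n i) * bspline p n k i x
   + (knot p n (i + Suc k + 1) - x) / (knot p n (i + Suc k + 1) - knot p n (i + 1))
       * bspline p n k (i + 1) x"

text \<open>
  Matrix entries are indexed from \<open>0\<close>, so entry \<open>(i, j)\<close> involves the B-splines with
  numbers \<open>i + 2\<close> and \<open>j + 2\<close>: the first and the last B-spline are left out. The use of
  \<^const>\<open>deriv\<close> is harmless at the finitely many knots where (for \<open>p = 1\<close>) a B-spline is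
  not differentiable, and at the end points of the interval.
\<close>

definition mass_mat :: "nat \<Rightarrow> nat \<Rightarrow> real mat" where
  "mass_mat p n = Matrix.mat (n + p - 2) (n + p - 2) (\<lambda>(i, j).
     integral {0..1} (\<lambda>x. bspline p n p (i + 2) x * bspline p n p (j + 2) x))"

definition advection_mat :: "nat \<Rightarrow> nat \<Rightarrow> real mat" where
  "advection_mat p n = Matrix.mat (n + p - 2) (n + p - 2) (\<lambda>(i, j).
     integral {0..1} (\<lambda>x. bspline p n p (i + 2) x * deriv (bspline p n p (j + 2)) x))"

definition stiffness_mat :: "nat \<Rightarrow> nat \<Rightarrow> real mat" where
  "stiffness_mat p n = Matrix.mat (n + p - 2) (n + p - 2) (\<lambda>(i, j).
     integral {0..1} (\<lambda>x. deriv (bspline p n p (i + 2)) x * deriv (bspline p n p (j + 2)) x))"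

definition kronecker_mat :: "'a::times mat \<Rightarrow> 'a mat \<Rightarrow> 'a mat" (infixl \<open>\<otimes>\<^sub>K\<close> 72) where
  "A \<otimes>\<^sub>K B = Matrix.mat (dim_row A * dim_row B) (dim_col A * dim_col B) (\<lambda>(i, j).
     A $$ (i div dim_row B, j div dim_col B) * B $$ (i mod dim_row B, j mod dim_col B))"

definition curl_div_mat :: "nat \<Rightarrow> real \<Rightarrow> real \<Rightarrow> nat \<Rightarrow> nat \<Rightarrow> real mat" where
  "curl_div_mat p \<alpha> \<beta> n\<^sub>1 n\<^sub>2 =
     (let M\<^sub>1 = mass_mat p n\<^sub>1; A\<^sub>1 = advection_mat p n\<^sub>1; S\<^sub>1 = stiffness_mat p n\<^sub>1;
          M\<^sub>2 = mass_mat p n\<^sub>2; A\<^sub>2 = advection_mat p n\<^sub>2; S\<^sub>2 = stiffness_mat p n\<^sub>2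
      in \<alpha> \<cdot>\<^sub>m four_block_mat
               (M\<^sub>1 \<otimes>\<^sub>K S\<^sub>2)                     (- (transpose_mat A\<^sub>1) \<otimes>\<^sub>K A\<^sub>2)
               (- A\<^sub>1 \<otimes>\<^sub>K transpose_mat A\<^sub>2)     (S\<^sub>1 \<otimes>\<^sub>K M\<^sub>2)
       + \<beta> \<cdot>\<^sub>m four_block_mat
               (S\<^sub>1 \<otimes>\<^sub>K M\<^sub>2)                     (A\<^sub>1 \<otimes>\<^sub>K transpose_mat A\<^sub>2)
               (transpose_mat A\<^sub>1 \<otimes>\<^sub>K A\<^sub>2)       (M\<^sub>1 \<otimes>\<^sub>K S\<^sub>2))"

primrec cardinal_bspline :: "nat \<Rightarrow> real \<Rightarrow> real" where
  "cardinal_bspline 0 t = (if 0 \<le> t \<and> t < 1 then 1 else 0)"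
| "cardinal_bspline (Suc p) t =
     t / real (Suc p) * cardinal_bspline p t
   + (real (Suc p) + 1 - t) / real (Suc p) * cardinal_bspline p (t - 1)"

definition mass_symbol :: "nat \<Rightarrow> real \<Rightarrow> real" where
  "mass_symbol p \<theta> = cardinal_bspline (2 * p + 1) (real p + 1)
     + 2 * (\<Sum>k=1..p. cardinal_bspline (2 * p + 1) (real p + 1 - real k) * cos (real k * \<theta>))"

definition advection_symbol :: "nat \<Rightarrow> real \<Rightarrow> real" where
  "advection_symbol p \<theta> =
     - 2 * (\<Sum>k=1..p. deriv (cardinal_bspline (2 * p + 1)) (real p + 1 - real k) * sin (real k * \<theta>))"

definition stiffness_symbol :: "nat \<Rightarrow> real \<Rightarrow> real" where
  "stiffness_symbol p \<theta> = - (deriv ^^ 2) (cardinal_bspline (2 * p + 1)) (real p + 1)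
     - 2 * (\<Sum>k=1..p. (deriv ^^ 2) (cardinal_bspline (2 * p + 1)) (real p + 1 - real k)
                          * cos (real k * \<theta>))"

definition curl_div_symbol ::
    "nat \<Rightarrow> real \<Rightarrow> real \<Rightarrow> real \<Rightarrow> real \<Rightarrow> real \<times> real \<Rightarrow> complex mat" where
  "curl_div_symbol p \<alpha> \<beta> \<nu>\<^sub>1 \<nu>\<^sub>2 = (\<lambda>(\<theta>\<^sub>1, \<theta>\<^sub>2).
     let f11 = \<alpha> * (\<nu>\<^sub>2 / \<nu>\<^sub>1) * mass_symbol p \<theta>\<^sub>1 * stiffness_symbol p \<theta>\<^sub>2
             + \<beta> * (\<nu>\<^sub>1 / \<nu>\<^sub>2) * stiffness_symbol p \<theta>\<^sub>1 * mass_symbol p \<theta>\<^sub>2;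
         f12 = - (\<alpha> - \<beta>) * advection_symbol p \<theta>\<^sub>1 * advection_symbol p \<theta>\<^sub>2;
         f22 = \<alpha> * (\<nu>\<^sub>1 / \<nu>\<^sub>2) * stiffness_symbol p \<theta>\<^sub>1 * mass_symbol p \<theta>\<^sub>2
             + \<beta> * (\<nu>\<^sub>2 / \<nu>\<^sub>1) * mass_symbol p \<theta>\<^sub>1 * stiffness_symbol p \<theta>\<^sub>2
     in map_mat complex_of_real (mat_of_rows_list 2 [[f11, f12], [f12, f22]]))"

definition eigenvalue_mset :: "complex mat \<Rightarrow> complex multiset" where
  "eigenvalue_mset A = proots (char_poly A)"

text \<open>
  The filter \<open>\<Phi>\<close> on the index type says along which indices, and in which sense, the
  sequence is taken to infinity.
\<close>

definition spectral_distribution ::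
    "'i filter \<Rightarrow> ('i \<Rightarrow> complex mat) \<Rightarrow> nat \<Rightarrow> ('a::euclidean_space \<Rightarrow> complex mat) \<Rightarrow> 'a set \<Rightarrow> bool"
  where
  "spectral_distribution \<Phi> A s f G \<longleftrightarrow>
     G \<in> sets lebesgue \<and> 0 < emeasure lebesgue G \<and> emeasure lebesgue G < \<infinity> \<and>
     0 < s \<and> (\<forall>t\<in>G. f t \<in> carrier_mat s s) \<and>
     (\<forall>i<s. \<forall>j<s. (\<lambda>t. f t $$ (i, j)) \<in> borel_measurable (lebesgue_on G)) \<and>
     (\<forall>\<^sub>F n in \<Phi>. square_mat (A n)) \<and> filterlim (\<lambda>n. dim_row (A n)) at_top \<Phi> \<and>
     (\<forall>F :: complex \<Rightarrow> complex. continuous_on UNIV F \<and> compact (closure {z. F z \<noteq> 0}) \<longrightarrow>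
        ((\<lambda>n. (1 / of_nat (dim_row (A n))) * (\<Sum>z\<in>#eigenvalue_mset (A n). F z)) \<longlongrightarrow>
          (1 / of_real (measure lebesgue G)) *
            (LINT t:G|lebesgue. (1 / of_nat s) * (\<Sum>z\<in>#eigenvalue_mset (f t). F z))) \<Phi>)"

end

theory Submission
  imports Defs "Jordan_Normal_Form.Schur_Decomposition"
begin

text \<open>
  The proof is by the method of moments. The matrices are real symmetric with uniformly bounded
  eigenvalues, so by the Weierstrass theorem it suffices to compare, for every \<open>k\<close>, the mean of
  \<open>\<lambda>\<^sup>k\<close> over the eigenvalues, that is, a normalised trace of the \<open>k\<close>-th power, with the
  mean of \<open>tr f\<^sup>k / 2\<close> over the torus. Away from the ends of the index ranges the blocks are banded
  Toeplitz: there the B-splines are translates of a cardinal B-spline, and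
  \<open>\<phi>\<^sub>a * \<phi>\<^sub>b = \<phi>\<^bsub>a + b + 1\<^esub>\<close> together with the symmetry of \<open>\<phi>\<^sub>p\<close> turns the Gram integrals into
  the coefficients of the symbols. Hence all diagonal entries of the \<open>k\<close>-th power except
  \<open>O(n\<^sub>1 + n\<^sub>2)\<close> of them are zeroth Fourier coefficients of \<open>f\<^sup>k\<close>, and the exceptional ones are bounded.
\<close>

section \<open>Cardinal B-splines\<close>

text \<open>Test functions live on the complex plane, and polynomials in z are dense in the
  continuous functions on a real segment but not on a disc. The eigenvalues must therefore be
  exactly real; this comes from an exact symmetry of the entries, boundary rows included. The
  matrices M, A, S scale like 1/n, 1 and n. B-splines with a repeated end knot are not translates of
  a cardinal one; of these only size and support are used, with constants independent of n. For p =
  1 derivatives do not exist at knots; this is met by stating derivative facts off the grid of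
  knots, which is finite in [0,1] and invisible to integrals. The coefficients of A are odd, so its
  symbol is purely imaginary. Two such factors meet in every off-diagonal product, which makes the
  symbol real and accounts for its minus sign.\<close>

lemma cardinal_bspline_support: "t < 0 \<or> t \<ge> real q + 1 \<Longrightarrow> cardinal_bspline q t = 0"
proof (induction q arbitrary: t)
  case (Suc q)
  then show ?case using Suc.IH[of t] Suc.IH[of "t - 1"]
    by (cases "t = real (Suc q) + 1") (auto simp: algebra_simps)
qed auto

text \<open>Reflection exchanges the two summands of the recursion. The half-open support of degree
  zero spoils the identity at 0 and 1, so degree one is checked directly; from there on it holds
  everywhere.\<close>

lemma cardinal_bspline_symmetric:
  assumes "q \<ge> 1 \<or> t \<notin> {0, 1}"
  shows "cardinal_bspline q (real q + 1 - t) = cardinal_bspline q t"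
  using assms
proof (induction q arbitrary: t)
  case (Suc q)
  show ?case
  proof (cases "q = 0")
    case True
    then show ?thesis by auto
  next
    case False
    have "cardinal_bspline q (real (Suc q) + 1 - t) = cardinal_bspline q (t - 1)"
      using Suc.IH[of "t - 1"] False by (simp add: algebra_simps)
    moreover have "cardinal_bspline q (real (Suc q) + 1 - t - 1) = cardinal_bspline q t"
      using Suc.IH[of t] False by (simp add: algebra_simps)
    ultimately show ?thesis by (simp add: algebra_simps)
  qed
qed auto

lemma continuous_on_cardinal_bspline: "q \<ge> 1 \<Longrightarrow> continuous_on UNIV (cardinal_bspline q)"
proof (induction q)
  case (Suc q)
  show ?case
  proof (cases "q = 0")
    case True
    have "cardinal_bspline (Suc q) = (\<lambda>t. max 0 (1 - \<bar>t - 1\<bar>))"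
      using True by (auto simp: fun_eq_iff max_def abs_if)
    then show ?thesis by (auto intro!: continuous_intros)
  next
    case False
    with Suc have c: "continuous_on UNIV (cardinal_bspline q)" by simp
    have "continuous_on UNIV (\<lambda>t. cardinal_bspline q (t - 1))"
      by (rule continuous_on_compose2[OF c]) (auto intro!: continuous_intros)
    with c show ?thesis by (auto intro!: continuous_intros)
  qed
qed simp

lemma cardinal_bspline_measurable [measurable]: "cardinal_bspline q \<in> borel_measurable borel"
  by (induction q) auto

section \<open>Derivatives and integrals of cardinal B-splines\<close>

lemma cardinal_bspline_0_deriv:
  assumes "t \<notin> \<int>" shows "(cardinal_bspline 0 has_real_derivative 0) (at t)"
proof -
  have "\<forall>\<^sub>F s in nhds t. cardinal_bspline 0 s = cardinal_bspline 0 t"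
  proof (cases "0 < t \<and> t < 1")
    case True
    then have "\<forall>\<^sub>F s in nhds t. s \<in> {0<..<1}" by (intro eventually_nhds_in_open) auto
    then show ?thesis by eventually_elim (use True in auto)
  next
    case False
    with assms have "t < 0 \<or> t > 1" by (cases "t = 0 \<or> t = 1") auto
    then have "\<forall>\<^sub>F s in nhds t. s \<in> {..<0} \<union> {1<..}" by (intro eventually_nhds_in_open) auto
    then show ?thesis by eventually_elim (use \<open>t < 0 \<or> t > 1\<close> in auto)
  qed
  then have "(cardinal_bspline 0 has_real_derivative 0) (at t) \<longleftrightarrow>
      ((\<lambda>s. cardinal_bspline 0 t) has_real_derivative 0) (at t)"
    by (intro DERIV_cong_ev refl)
  then show ?thesis by simp
qed

lemma cardinal_bspline_rec:
  "cardinal_bspline (Suc q) =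
    (\<lambda>u. (u * cardinal_bspline q u + (real q + 2 - u) * cardinal_bspline q (u - 1)) / (real q + 1))"
proof
  fix u
  have "real (Suc q) + 1 - u = real q + 2 - u" "real (Suc q) = real q + 1" by simp_all
  then show "cardinal_bspline (Suc q) u =
      (u * cardinal_bspline q u + (real q + 2 - u) * cardinal_bspline q (u - 1)) / (real q + 1)"
    unfolding cardinal_bspline.simps(2) by (simp only: times_divide_eq_left add_divide_distrib)
qed

declare cardinal_bspline.simps(2) [simp del]

lemma cardinal_bspline_mult:
  "(real q + 1) * cardinal_bspline (Suc q) u =
    u * cardinal_bspline q u + (real q + 2 - u) * cardinal_bspline q (u - 1)"
proof -
  have "real q + 1 \<noteq> 0" by linarith
  then show ?thesis unfolding cardinal_bspline_rec by simp
qed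

lemma has_real_derivative_shift_minus_one:
  "(f has_real_derivative D) (at (t - 1)) \<Longrightarrow> ((\<lambda>s. f (s - 1 :: real)) has_real_derivative D) (at t)"
  using DERIV_shift[of f D t "-1"] by simp

text \<open>The recursion can be differentiated termwise only away from the knots.\<close>
lemma cardinal_bspline_has_deriv_nonint:
  assumes "t \<notin> \<int>"
  shows "(cardinal_bspline (Suc q) has_real_derivative
            cardinal_bspline q t - cardinal_bspline q (t - 1)) (at t)"
  using assms
proof (induction q arbitrary: t)
  case 0
  then have n: "t - 1 \<notin> \<int>" by simp
  note d = cardinal_bspline_0_deriv[OF 0] has_real_derivative_shift_minus_one[OF cardinal_bspline_0_deriv[OF n]]
  show ?case
    unfolding cardinal_bspline_rec[of 0]
    by (rule derivative_eq_intros d | simp)+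
next
  case (Suc q)
  then have n: "t - 1 \<notin> \<int>" by simp
  let ?b = "cardinal_bspline q" and ?B = "cardinal_bspline (Suc q)"
  define b0 b1 b2 B0 B1 where defs: "b0 = ?b t" "b1 = ?b (t - 1)" "b2 = ?b (t - 2)" "B0 = ?B t" "B1 = ?B (t - 1)"
  have d0: "(?B has_real_derivative b0 - b1) (at t)"
    and d1: "((\<lambda>s. ?B (s - 1)) has_real_derivative b1 - b2) (at t)"
    using Suc.IH[OF Suc.prems] has_real_derivative_shift_minus_one[OF Suc.IH[OF n]] by (simp_all add: defs)
  \<comment> \<open>Cleared of denominators, the recursions at t and t - 1 turn the degree
    \<open>q\<close> terms of the derivative into \<open>(q + 1) * (B0 - B1)\<close>; the linear
    factors contribute one more \<open>B0 - B1\<close>.\<close>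
  have r: "(real q + 1) * B0 = t * b0 + (real q + 2 - t) * b1"
    "(real q + 1) * B1 = (t - 1) * b1 + (real q + 3 - t) * b2"
    using cardinal_bspline_mult[of q t] cardinal_bspline_mult[of q "t - 1"]
    by (simp_all add: defs algebra_simps)
  have "(cardinal_bspline (Suc (Suc q)) has_real_derivative
      (B0 + t * (b0 - b1) + (- B1 + (real q + 3 - t) * (b1 - b2))) / (real q + 2)) (at t)"
    unfolding cardinal_bspline_rec[of "Suc q"]
    by (rule derivative_eq_intros d0 d1 refl | simp)+ (simp add: defs algebra_simps)
  moreover have "B0 + t * (b0 - b1) + (- B1 + (real q + 3 - t) * (b1 - b2)) = (B0 - B1) * (real q + 2)"
    using r by (simp add: algebra_simps)
  ultimately show ?case
    by (simp add: defs add_eq_0_iff)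
qed

lemma finite_Ints_atLeastAtMost: "finite (\<int> \<inter> {a..b :: real})"
proof -
  have "\<int> \<inter> {a..b} \<subseteq> real_of_int ` {\<lfloor>a\<rfloor>..\<lceil>b\<rceil>}"
    by (auto elim!: Ints_cases simp: floor_le_iff le_ceiling_iff)
  then show ?thesis using finite_surj by blast
qed

text \<open>The sum of the translates of \<phi> of degree \<open>q + 1\<close> by 0, 1, 2, ... is an
  antiderivative of \<phi> of degree \<open>q\<close>, since the derivatives telescope. Up to t
  finitely many translates suffice. The derivative is known only off the integers, hence the version
  of the fundamental theorem with a finite exceptional set.\<close>

lemma cardinal_bspline_has_integral:
  "(cardinal_bspline q has_integral cardinal_bspline (Suc q) t) {t - 1..t}"
proof -
  obtain J :: nat where J: "real J > t" using reals_Archimedean2 by blast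
  define G where "G s = (\<Sum>j<J. cardinal_bspline (Suc q) (s - real j))" for s
  have "(cardinal_bspline q has_integral (G t - G (t - 1))) {t - 1..t}"
  proof (rule fundamental_theorem_of_calculus_strong[where S = "\<int> \<inter> {t - 1..t}"])
    fix s assume "s \<in> {t - 1..t} - \<int> \<inter> {t - 1..t}"
    then have s: "s \<notin> \<int>" "s \<le> t" by auto
    let ?d = "\<lambda>j. cardinal_bspline q (s - real j) - cardinal_bspline q (s - real (Suc j))"
    have "((\<lambda>s. cardinal_bspline (Suc q) (s - real j)) has_real_derivative ?d j) (at s)" for j
    proof -
      have "s - real j \<notin> \<int>" using s by simp
      from cardinal_bspline_has_deriv_nonint[OF this, of q]
      show ?thesis using DERIV_shift[of "cardinal_bspline (Suc q)" _ s "- real j"]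
        by (simp add: algebra_simps)
    qed
    then have "(G has_real_derivative (\<Sum>j<J. ?d j)) (at s)"
      unfolding G_def by (intro DERIV_sum) auto
    also have "(\<Sum>j<J. ?d j) = cardinal_bspline q s"
      using s J cardinal_bspline_support[of "s - real J" q]
      by (subst sum_lessThan_telescope') simp
    finally show "(G has_vector_derivative cardinal_bspline q s) (at s)"
      by (simp add: has_real_derivative_iff_has_vector_derivative)
  next
    have "continuous_on UNIV (\<lambda>s. cardinal_bspline (Suc q) (s - real j))" for j
      by (rule continuous_on_compose2[OF continuous_on_cardinal_bspline]) (auto intro!: continuous_intros)
    then show "continuous_on {t - 1..t} G"
      unfolding G_def by (intro continuous_on_sum) (auto intro: continuous_on_subset)
  qed (auto simp: finite_Ints_atLeastAtMost)
  also have "G t - G (t - 1) = (\<Sum>j<J. cardinal_bspline (Suc q) (t - real j) - cardinal_bspline (Suc q) (t - real (Suc j)))"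
    unfolding G_def sum_subtractf by (simp add: algebra_simps)
  also have "\<dots> = cardinal_bspline (Suc q) t"
    using J cardinal_bspline_support[of "t - real J" "Suc q"] by (subst sum_lessThan_telescope') simp
  finally show ?thesis .
qed

text \<open>The symbols evaluate derivatives at integers, exactly where the recursion cannot be
  differentiated termwise. The integral over [t - 1, t] of a continuous function, however, is
  differentiable everywhere.\<close>

lemma cardinal_bspline_has_deriv:
  assumes "q \<ge> 1"
  shows "(cardinal_bspline (Suc q) has_real_derivative
            cardinal_bspline q t - cardinal_bspline q (t - 1)) (at t)"
proof -
  \<comment> \<open>The base point t - 3 only has to lie to the left of s - 1 for all s near
    t.\<close>
  define I where "I s = integral {t - 3..s} (cardinal_bspline q)" for s
  have cont: "continuous_on S (cardinal_bspline q)" for S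
    using continuous_on_cardinal_bspline[OF assms] continuous_on_subset by blast
  have int: "cardinal_bspline q integrable_on {a..b}" for a b
    by (intro integrable_continuous_real cont)
  have I: "(I has_real_derivative cardinal_bspline q u) (at u)" if "u \<in> {t - 3<..<t + 3}" for u
  proof -
    have "(I has_real_derivative cardinal_bspline q u) (at u within {t - 3..t + 3})"
      unfolding I_def using that by (intro integral_has_real_derivative cont) auto
    moreover have "at u within {t - 3..t + 3} = at u"
      using that by (intro at_within_interior) (simp add: interior_atLeastAtMost_real)
    ultimately show ?thesis by simp
  qed
  have "((\<lambda>s. I s - I (s - 1)) has_real_derivative cardinal_bspline q t - cardinal_bspline q (t - 1)) (at t)"
    by (intro DERIV_diff I has_real_derivative_shift_minus_one) auto
  then show ?thesis
  proof (rule has_field_derivative_transform_within_open[where S = "{t - 1<..<t + 1}"])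
    fix s assume that: "s \<in> {t - 1<..<t + 1}"
    have "I (s - 1) + integral {s - 1..s} (cardinal_bspline q) = I s"
      unfolding I_def using that by (intro Henstock_Kurzweil_Integration.integral_combine int) auto
    then show "I s - I (s - 1) = cardinal_bspline (Suc q) s"
      using integral_unique[OF cardinal_bspline_has_integral[of q s]] by simp
  qed auto
qed

lemma cardinal_bspline_bounded: "\<exists>K\<ge>0. \<forall>t. \<bar>cardinal_bspline q t\<bar> \<le> K"
proof (induction q)
  case 0
  then show ?case by (intro exI[of _ 1]) auto
next
  case (Suc q)
  have "compact {0..real q + 2}" by simp
  then have "compact (cardinal_bspline (Suc q) ` {0..real q + 2})"
    by (intro compact_continuous_image continuous_on_subset[OF continuous_on_cardinal_bspline]) auto
  then obtain K where K: "\<And>t. t \<in> {0..real q + 2} \<Longrightarrow> \<bar>cardinal_bspline (Suc q) t\<bar> \<le> K"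
    using compact_imp_bounded bounded_iff by (metis image_eqI real_norm_def)
  have "\<bar>cardinal_bspline (Suc q) t\<bar> \<le> max K 0" for t
    using K[of t] cardinal_bspline_support[of t "Suc q"]
    by (cases "t \<in> {0..real q + 2}") (auto simp: le_max_iff_disj)
  then show ?case by (intro exI[of _ "max K 0"]) auto
qed

section \<open>Convolution and correlation of cardinal B-splines\<close>

lemma cardinal_bspline_integrable: "integrable lborel (\<lambda>t. cardinal_bspline q t)"
proof -
  obtain K where K: "\<And>t. \<bar>cardinal_bspline q t\<bar> \<le> K" using cardinal_bspline_bounded by blast
  have "integrable lborel (\<lambda>t. indicator {0..real q + 1} t *\<^sub>R K)"
    by (intro integrable_real_indicator integrable_scaleR_left) auto
  then show ?thesis
  proof (rule Bochner_Integration.integrable_bound)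
    have "norm (cardinal_bspline q t) \<le> norm (indicator {0..real q + 1} t *\<^sub>R K)" for t
      using K[of t] cardinal_bspline_support[of t q] by (auto simp: indicator_def)
    then show "AE t in lborel. norm (cardinal_bspline q t) \<le> norm (indicator {0..real q + 1} t *\<^sub>R K)"
      by simp
  qed measurable
qed

lemma cardinal_bspline_lborel_integral:
  "(\<integral>u. indicator {0..1} u * cardinal_bspline q (t - u) \<partial>lborel) = cardinal_bspline (Suc q) t"
proof -
  have "(\<integral>u. indicator {0..1} u * cardinal_bspline q (t - u) \<partial>lborel) =
      (\<integral>u. indicator {t - 1..t} u * cardinal_bspline q u \<partial>lborel)"
    by (subst lborel_integral_real_affine[of "-1" _ t])
      (auto intro!: Bochner_Integration.integral_cong simp: indicator_def)
  also have "\<dots> = (LINT u:{t - 1..t}|lborel. cardinal_bspline q u)"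
    by (simp add: set_lebesgue_integral_def)
  also have "\<dots> = integral {t - 1..t} (cardinal_bspline q)"
    by (intro set_borel_integral_eq_integral(2))
      (auto simp: set_integrable_def intro!: integrable_mult_indicator[where 'b = real, unfolded real_scaleR_def] cardinal_bspline_integrable)
  finally show ?thesis using integral_unique[OF cardinal_bspline_has_integral[of q t]] by simp
qed

text \<open>Raising the degree by one is convolution with the indicator of the unit interval, so the
  induction on \<open>b\<close> is Fubini's theorem, with an integrable majorant that is a
  product.\<close>

lemma cardinal_bspline_convolution:
  "(\<integral>t. cardinal_bspline a t * cardinal_bspline b (s - t) \<partial>lborel) = cardinal_bspline (a + b + 1) s"
proof (induction b arbitrary: s)
  case 0
  have "(\<integral>t. cardinal_bspline a t * cardinal_bspline 0 (s - t) \<partial>lborel) =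
      (\<integral>t. cardinal_bspline a (s - t) * cardinal_bspline 0 t \<partial>lborel)"
    by (subst lborel_integral_real_affine[of "-1" _ s]) (auto intro!: Bochner_Integration.integral_cong)
  also have "\<dots> = (\<integral>t. indicator {0..1} t * cardinal_bspline a (s - t) \<partial>lborel)"
    \<comment> \<open>The closed interval and the half-open support of degree zero differ only at
      1.\<close>
    by (intro integral_cong_AE AE_I'[of "{1}"] )
       (auto simp: indicator_def)
  finally show ?case using cardinal_bspline_lborel_integral by simp
next
  case (Suc b)
  obtain K where K: "K \<ge> 0" "\<And>t. \<bar>cardinal_bspline b t\<bar> \<le> K" using cardinal_bspline_bounded by blast
  define f where "f t u = cardinal_bspline a t * (indicator {0..1} u * cardinal_bspline b (s - t - u))" for t u
  have [measurable]: "case_prod f \<in> borel_measurable (lborel \<Otimes>\<^sub>M lborel)"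
    unfolding f_def by measurable
  have int: "integrable (lborel \<Otimes>\<^sub>M lborel) (case_prod f)"
  proof (rule Bochner_Integration.integrable_bound)
    show "integrable (lborel \<Otimes>\<^sub>M lborel) (\<lambda>(t, u). \<bar>cardinal_bspline a t\<bar> * (indicator {0..1::real} u * K))"
      by (rule lborel_pair.Fubini_integrable)
        (auto simp: abs_mult intro!: integrable_mult_left integrable_mult_right integrable_abs cardinal_bspline_integrable integrable_real_indicator)
    show "AE x in lborel \<Otimes>\<^sub>M lborel. norm (case_prod f x)
         \<le> norm (case x of (t, u) \<Rightarrow> \<bar>cardinal_bspline a t\<bar> * (indicator {0..1::real} u * K))"
      using K by (intro AE_I2) (auto simp: f_def indicator_def abs_mult split: prod.split intro!: mult_left_mono)
  qed measurable
  have "(\<integral>t. cardinal_bspline a t * cardinal_bspline (Suc b) (s - t) \<partial>lborel) = (\<integral>t. \<integral>u. f t u \<partial>lborel \<partial>lborel)"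
    unfolding f_def by (simp add: cardinal_bspline_lborel_integral)
  also have "\<dots> = (\<integral>u. \<integral>t. f t u \<partial>lborel \<partial>lborel)"
    by (rule lborel_pair.Fubini_integral[OF int, symmetric])
  also have "\<dots> = (\<integral>u. indicator {0..1} u * (\<integral>t. cardinal_bspline a t * cardinal_bspline b ((s - u) - t) \<partial>lborel) \<partial>lborel)"
    unfolding f_def by (subst integral_mult_right_zero[symmetric])
      (auto intro!: Bochner_Integration.integral_cong simp: algebra_simps)
  also have "\<dots> = cardinal_bspline (Suc (a + b + 1)) s"
    unfolding Suc.IH by (rule cardinal_bspline_lborel_integral)
  finally show ?case by simp
qed

lemma cardinal_bspline_prod_integrable:
  "integrable lborel (\<lambda>t. cardinal_bspline a (t + r) * cardinal_bspline b (t + s))"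
proof -
  obtain K where K: "K \<ge> 0" "\<And>t. \<bar>cardinal_bspline a t\<bar> \<le> K" using cardinal_bspline_bounded by blast
  have "integrable lborel (\<lambda>t. K * cardinal_bspline b (s + 1 * t))"
    by (intro integrable_mult_right lborel_integrable_real_affine cardinal_bspline_integrable) auto
  then show ?thesis
  proof (rule Bochner_Integration.integrable_bound)
    show "AE t in lborel. norm (cardinal_bspline a (t + r) * cardinal_bspline b (t + s))
        \<le> norm (K * cardinal_bspline b (s + 1 * t))"
      using K by (intro AE_I2) (auto simp: abs_mult add.commute intro!: mult_right_mono)
  qed measurable
qed

text \<open>Reflecting the second factor turns the correlation into a convolution. For
  \<open>b = 0\<close> the reflection fails at two points, so the integrands agree only almost
  everywhere.\<close>

lemma cardinal_bspline_correlation: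
  "(\<integral>t. cardinal_bspline a (t + r) * cardinal_bspline b (t + s) \<partial>lborel) =
    cardinal_bspline (a + b + 1) (real b + 1 - s + r)"
proof -
  have "(\<integral>t. cardinal_bspline a (t + r) * cardinal_bspline b (t + s) \<partial>lborel) =
      (\<integral>t. cardinal_bspline a t * cardinal_bspline b (t + (s - r)) \<partial>lborel)"
    by (subst lborel_integral_real_affine[of 1 _ "- r"])
      (auto intro!: Bochner_Integration.integral_cong simp: algebra_simps)
  also have "\<dots> = (\<integral>t. cardinal_bspline a t * cardinal_bspline b ((real b + 1 - (s - r)) - t) \<partial>lborel)"
  proof (intro integral_cong_AE AE_I'[of "{- (s - r), 1 - (s - r)}"])
    have "cardinal_bspline b (real b + 1 - (s - r) - t) = cardinal_bspline b (t + (s - r))"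
      if "t \<notin> {- (s - r), 1 - (s - r)}" for t
      using cardinal_bspline_symmetric[of b "t + (s - r)"] that by (auto simp: algebra_simps)
    then show "{t \<in> space lborel. cardinal_bspline a t * cardinal_bspline b (t + (s - r)) \<noteq>
        cardinal_bspline a t * cardinal_bspline b (real b + 1 - (s - r) - t)} \<subseteq> {- (s - r), 1 - (s - r)}"
      by (metis (mono_tags, lifting) mem_Collect_eq subsetI)
  qed (auto simp: finite_imp_null_set_lborel)
  finally show ?thesis
    unfolding cardinal_bspline_convolution by (simp add: algebra_simps)
qed

text \<open>A representative of the derivative of \<phi> of degree \<open>p\<close> that has a
  sensible value at the knots too; for \<open>p = 1\<close> the derivative does not exist
  there.\<close>

definition cardinal_bspline_slope :: "nat \<Rightarrow> real \<Rightarrow> real" where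
  "cardinal_bspline_slope p t = cardinal_bspline (p - 1) t - cardinal_bspline (p - 1) (t - 1)"

lemma deriv_cardinal_bspline:
  assumes "p \<ge> 1" "t \<notin> \<int>"
  shows "(cardinal_bspline p has_real_derivative cardinal_bspline_slope p t) (at t)"
  using cardinal_bspline_has_deriv_nonint[OF assms(2), of "p - 1"] assms(1)
  by (simp add: cardinal_bspline_slope_def)

lemma deriv_cardinal_bspline_odd:
  assumes "p \<ge> 1"
  shows "deriv (cardinal_bspline (2 * p + 1)) t = cardinal_bspline (2 * p) t - cardinal_bspline (2 * p) (t - 1)"
  using cardinal_bspline_has_deriv[of "2 * p" t] assms by (intro DERIV_imp_deriv) simp

text \<open>From p \<ge> 1 follows 2p - 1 \<ge> 1, so both differentiations are valid at every
  point, integers included.\<close>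

lemma deriv2_cardinal_bspline_odd:
  assumes "p \<ge> 1"
  shows "(deriv ^^ 2) (cardinal_bspline (2 * p + 1)) t =
    cardinal_bspline (2 * p - 1) t - 2 * cardinal_bspline (2 * p - 1) (t - 1) + cardinal_bspline (2 * p - 1) (t - 2)"
proof -
  have d: "(cardinal_bspline (2 * p) has_real_derivative
      cardinal_bspline (2 * p - 1) t - cardinal_bspline (2 * p - 1) (t - 1)) (at t)" for t
    using cardinal_bspline_has_deriv[of "2 * p - 1" t] assms by simp
  have "deriv (\<lambda>t. cardinal_bspline (2 * p) t - cardinal_bspline (2 * p) (t - 1)) t =
      (cardinal_bspline (2 * p - 1) t - cardinal_bspline (2 * p - 1) (t - 1)) -
      (cardinal_bspline (2 * p - 1) (t - 1) - cardinal_bspline (2 * p - 1) (t - 1 - 1))"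
    by (intro DERIV_imp_deriv DERIV_diff d has_real_derivative_shift_minus_one)
  moreover have "deriv (cardinal_bspline (2 * p + 1)) =
      (\<lambda>t. cardinal_bspline (2 * p) t - cardinal_bspline (2 * p) (t - 1))"
    using deriv_cardinal_bspline_odd[OF assms] by blast
  ultimately show ?thesis by (simp add: numeral_2_eq_2)
qed

text \<open>The slope is a difference of two B-splines of degree p - 1. Its correlations with degree
  p have degree 2p, and their difference is a derivative in degree 2p + 1; the reflection inside the
  correlation produces the minus sign.\<close>

lemma correlation_slope:
  assumes "p \<ge> 1"
  shows "integrable lborel (\<lambda>t. cardinal_bspline p t * cardinal_bspline_slope p (t + s))" (is ?i)
    and "(\<integral>t. cardinal_bspline p t * cardinal_bspline_slope p (t + s) \<partial>lborel) =
      - deriv (cardinal_bspline (2 * p + 1)) (real p + 1 - s)" (is ?e)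
proof -
  let ?I = "\<lambda>t. cardinal_bspline p (t + 0) * cardinal_bspline (p - 1) (t + s)"
  let ?J = "\<lambda>t. cardinal_bspline p (t + 0) * cardinal_bspline (p - 1) (t + (s - 1))"
  have eq: "(\<lambda>t. cardinal_bspline p t * cardinal_bspline_slope p (t + s)) = (\<lambda>t. ?I t - ?J t)"
    by (simp add: cardinal_bspline_slope_def algebra_simps)
  show ?i unfolding eq by (intro Bochner_Integration.integrable_diff cardinal_bspline_prod_integrable)
  have i: "p + (p - 1) + 1 = 2 * p" "real (p - 1) = real p - 1" using assms by auto
  have "(\<integral>t. ?I t - ?J t \<partial>lborel) = integral\<^sup>L lborel ?I - integral\<^sup>L lborel ?J"
    by (rule Bochner_Integration.integral_diff) (rule cardinal_bspline_prod_integrable)+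
  then show ?e
    unfolding eq deriv_cardinal_bspline_odd[OF assms] cardinal_bspline_correlation i
    by (simp add: algebra_simps)
qed

lemma correlation_slope_slope:
  assumes "p \<ge> 1"
  shows "integrable lborel (\<lambda>t. cardinal_bspline_slope p t * cardinal_bspline_slope p (t + s))" (is ?i)
    and "(\<integral>t. cardinal_bspline_slope p t * cardinal_bspline_slope p (t + s) \<partial>lborel) =
      - (deriv ^^ 2) (cardinal_bspline (2 * p + 1)) (real p + 1 - s)" (is ?e)
proof -
  let ?b = "cardinal_bspline (p - 1)"
  let ?f = "\<lambda>t. ?b (t + 0) * ?b (t + s)" and ?g = "\<lambda>t. ?b (t + 0) * ?b (t + (s - 1))"
    and ?h = "\<lambda>t. ?b (t + (- 1)) * ?b (t + s)" and ?k = "\<lambda>t. ?b (t + (- 1)) * ?b (t + (s - 1))"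
  have eq: "(\<lambda>t. cardinal_bspline_slope p t * cardinal_bspline_slope p (t + s)) =
      (\<lambda>t. (?f t - ?g t) - (?h t - ?k t))"
    by (simp add: cardinal_bspline_slope_def algebra_simps)
  have f: "integrable lborel ?f" "integrable lborel ?g" "integrable lborel ?h" "integrable lborel ?k"
    by (rule cardinal_bspline_prod_integrable)+
  show ?i unfolding eq by (intro Bochner_Integration.integrable_diff f)
  have i: "p - 1 + (p - 1) + 1 = 2 * p - 1" "real (p - 1) = real p - 1" using assms by auto
  have "(\<integral>t. (?f t - ?g t) - (?h t - ?k t) \<partial>lborel) =
     (integral\<^sup>L lborel ?f - integral\<^sup>L lborel ?g) - (integral\<^sup>L lborel ?h - integral\<^sup>L lborel ?k)"
    using f by (simp only: Bochner_Integration.integral_diff Bochner_Integration.integrable_diff)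
  then show ?e
    unfolding eq deriv2_cardinal_bspline_odd[OF assms] cardinal_bspline_correlation i
    by (simp add: algebra_simps)
qed

text \<open>The conditions on a and c place the whole support of the rescaled function inside [0,1],
  so the integral over the interval is one over the line.\<close>

lemma integral_rescale:
  fixes f :: "real \<Rightarrow> real"
  assumes f: "integrable lborel f" "\<And>t. t \<notin> {0..c} \<Longrightarrow> f t = 0" and n: "n > 0" and a: "0 \<le> a" "a + c \<le> n"
  shows "integral {0..1} (\<lambda>x. f (n * x - a)) = (\<integral>t. f t \<partial>lborel) / n"
proof -
  have int: "integrable lborel (\<lambda>x. f (- a + n * x))"
    using n by (intro lborel_integrable_real_affine f) auto
  have z: "indicator {0..1} x *\<^sub>R f (- a + n * x) = f (- a + n * x)" for x
  proof (cases "x \<in> {0..1}")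
    case False
    then have "x < 0 \<or> x > 1" by auto
    then have "n * x - a \<notin> {0..c}"
    proof
      assume "x < 0"
      then have "n * x < 0" using n by (simp add: mult_pos_neg)
      then show ?thesis using a by simp
    next
      assume "x > 1"
      then have "n * x > n * 1" using n by (intro mult_strict_left_mono)
      then show ?thesis using a by simp
    qed
    then show ?thesis using f(2)[of "n * x - a"] by simp
  qed simp
  have "integral {0..1} (\<lambda>x. f (n * x - a)) = (LINT x:{0..1}|lborel. f (- a + n * x))"
    using set_borel_integral_eq_integral(2)[of "{0..1}" "\<lambda>x. f (- a + n * x)"] int
    unfolding set_integrable_def z by simp
  also have "\<dots> = (\<integral>x. f (- a + n * x) \<partial>lborel)"
    unfolding set_lebesgue_integral_def z ..
  also have "\<dots> = (\<integral>t. f t \<partial>lborel) / n"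
    using lborel_integral_real_affine[of n f "- a"] n by simp
  finally show ?thesis .
qed

section \<open>B-splines on the open knot vector\<close>

text \<open>Truncated subtraction absorbs the repeated knot 0 and \<open>min\<close> the repeated
  knot 1.\<close>

lemma knot_eq: "n \<ge> 1 \<Longrightarrow> knot p n i = real (min (i - (p + 1)) n) / real n"
  by (auto simp: knot_def min_def)

lemma knot_mono: "n \<ge> 1 \<Longrightarrow> i \<le> j \<Longrightarrow> knot p n i \<le> knot p n j"
  unfolding knot_eq by (intro divide_right_mono) auto

text \<open>All knots lie on the grid of multiples of 1/n. This bounds the slopes of the weights in
  the recursion by n, unless the denominator is zero.\<close>

lemma knot_gap:
  assumes "n \<ge> 1" "i \<le> j" "knot p n i \<noteq> knot p n j"
  shows "1 / real n \<le> knot p n j - knot p n i"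
proof -
  have "min (i - (p + 1)) n \<noteq> min (j - (p + 1)) n" "min (i - (p + 1)) n \<le> min (j - (p + 1)) n"
    using assms by (auto simp: knot_eq)
  then have "real (min (i - (p + 1)) n) + 1 \<le> real (min (j - (p + 1)) n)" by linarith
  then show ?thesis
    using assms(1) by (simp only: knot_eq diff_divide_distrib[symmetric]) (intro divide_right_mono, auto)
qed

lemma knot_width: "n \<ge> 1 \<Longrightarrow> knot p n (i + k) - knot p n i \<le> real k / real n"
proof -
  assume n: "n \<ge> 1"
  have "real (min (i + k - (p + 1)) n) \<le> real (min (i - (p + 1)) n) + real k" by linarith
  then show ?thesis
    using n by (simp only: knot_eq diff_divide_distrib[symmetric]) (intro divide_right_mono, auto)
qed

lemma knot_mult_Ints: "n \<ge> 1 \<Longrightarrow> real n * knot p n i \<in> \<int>"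
  by (simp add: knot_eq)

lemma bspline_support:
  assumes n: "n \<ge> 1" and "x < knot p n i \<or> knot p n (i + k + 1) \<le> x"
  shows "bspline p n k i x = 0"
  using assms(2)
proof (induction k arbitrary: i)
  case (Suc k)
  have "x < knot p n (i + 1)" if "x < knot p n i" using that knot_mono[OF n, of i "i + 1" p] by simp
  moreover have "knot p n (i + k + 1) \<le> x" if "knot p n (i + Suc k + 1) \<le> x"
    using that knot_mono[OF n, of "i + k + 1" "i + Suc k + 1" p] by simp
  ultimately show ?case
    using Suc.IH[of i] Suc.IH[of "i + 1"] Suc.prems by (auto simp: add.commute add.left_commute)
qed auto

section \<open>Size and slope of all B-splines, uniformly in the number of knots\<close>

lemma abs_bspline_weight_le_one:
  fixes x a b :: real
  assumes "a \<le> x" "x \<le> b" shows "\<bar>(x - a) / (b - a)\<bar> \<le> 1" "\<bar>(b - x) / (b - a)\<bar> \<le> 1"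
proof -
  have "0 \<le> (x - a) / (b - a)" "0 \<le> (b - x) / (b - a)" using assms by simp_all
  moreover have "(x - a) / (b - a) \<le> 1" "(b - x) / (b - a) \<le> 1" using assms by (auto simp: divide_le_eq_1)
  ultimately show "\<bar>(x - a) / (b - a)\<bar> \<le> 1" "\<bar>(b - x) / (b - a)\<bar> \<le> 1" unfolding abs_le_iff by linarith+
qed

text \<open>Where the spline behind a weight is nonzero, the weight lies between 0 and 1, so each
  degree at most doubles the bound. Any constant independent of \<open>n\<close> serves the
  purpose.\<close>

lemma abs_bspline_le:
  assumes n: "n \<ge> 1" shows "\<bar>bspline p n k i x\<bar> \<le> 2 ^ k"
proof (induction k arbitrary: i)
  case (Suc k)
  have a: "\<bar>(x - knot p n i) / (knot p n (i + Suc k) - knot p n i) * bspline p n k i x\<bar> \<le> 2 ^ k"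
  proof (cases "x < knot p n i \<or> knot p n (i + k + 1) \<le> x")
    case False
    then show ?thesis unfolding abs_mult
      using mult_mono[OF abs_bspline_weight_le_one(1) Suc.IH[of i], of "knot p n i" x "knot p n (i + Suc k)"] by simp
  qed (use bspline_support[OF n] in simp)
  have b: "\<bar>(knot p n (i + Suc k + 1) - x) / (knot p n (i + Suc k + 1) - knot p n (i + 1)) *
      bspline p n k (i + 1) x\<bar> \<le> 2 ^ k"
  proof (cases "x < knot p n (i + 1) \<or> knot p n (i + 1 + k + 1) \<le> x")
    case False
    then show ?thesis unfolding abs_mult
      using mult_mono[OF abs_bspline_weight_le_one(2) Suc.IH[of "i + 1"], of "knot p n (i + 1)" x "knot p n (i + Suc k + 1)"]
      by simp
  next
    case True
    then show ?thesis by (subst bspline_support[OF n True]) simp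
  qed
  show ?case unfolding bspline.simps power_Suc mult_2 by (rule order_trans[OF abs_triangle_ineq add_mono[OF a b]])
qed auto

lemma deriv_bspline_support:
  assumes n: "n \<ge> 1" and "x < knot p n i \<or> knot p n (i + k + 1) < x"
  shows "(bspline p n k i has_real_derivative 0) (at x)"
proof -
  have "\<forall>\<^sub>F y in nhds x. y \<in> {..<knot p n i} \<union> {knot p n (i + k + 1)<..}"
    using assms(2) by (intro eventually_nhds_in_open) auto
  then have "\<forall>\<^sub>F y in nhds x. bspline p n k i y = 0"
    by eventually_elim (use bspline_support[OF n] in fastforce)
  then have "(bspline p n k i has_real_derivative 0) (at x) \<longleftrightarrow> ((\<lambda>_. 0) has_real_derivative 0) (at x)"
    by (intro DERIV_cong_ev refl)
  then show ?thesis by simp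
qed

text \<open>One summand of the recursion, with \<open>e = 1\<close> or \<open>e = - 1\<close>. The
  product rule gives two terms: the slope of the weight is at most n by the knot gap, and the weight
  itself is at most 1 wherever \<open>D\<close> can be nonzero. If \<open>a = b\<close>, division by
  zero makes everything vanish.\<close>

lemma deriv_bspline_summand:
  fixes a b c e x C D :: real
  assumes N: "(N has_real_derivative D) (at x)" and D: "\<bar>D\<bar> \<le> C * real n" "\<not> (a \<le> x \<and> x \<le> b) \<Longrightarrow> D = 0"
    and N': "\<bar>N x\<bar> \<le> 2 ^ k" and ab: "a = b \<or> 1 / real n \<le> b - a" and n: "n \<ge> 1"
    and e: "\<bar>e\<bar> \<le> 1" and w: "a \<le> x \<and> x \<le> b \<Longrightarrow> \<bar>(e * x + c) / (b - a)\<bar> \<le> 1"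
  shows "\<exists>E. ((\<lambda>x. (e * x + c) / (b - a) * N x) has_real_derivative E) (at x) \<and> \<bar>E\<bar> \<le> (2 ^ k + C) * real n"
proof (intro exI conjI)
  show "((\<lambda>x. (e * x + c) / (b - a) * N x) has_real_derivative
      (e / (b - a) * N x + (e * x + c) / (b - a) * D)) (at x)"
    unfolding divide_inverse by (rule derivative_eq_intros N refl | simp add: algebra_simps)+
  have "\<bar>e / (b - a)\<bar> \<le> real n"
  proof (cases "a = b")
    case False
    with ab have "1 / real n \<le> b - a" by simp
    moreover from this have "0 < b - a" using n by (smt (verit) divide_pos_pos of_nat_0_less_iff zero_less_one less_eq_Suc_le One_nat_def)
    ultimately have "1 / (b - a) \<le> real n" using n by (simp add: field_simps)
    moreover have "\<bar>e / (b - a)\<bar> \<le> 1 / (b - a)" using e \<open>0 < b - a\<close> by (simp add: divide_right_mono)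
    ultimately show ?thesis by linarith
  qed simp
  then have "\<bar>e / (b - a) * N x\<bar> \<le> real n * 2 ^ k"
    unfolding abs_mult using N' by (intro mult_mono) auto
  moreover have "\<bar>(e * x + c) / (b - a) * D\<bar> \<le> C * real n"
  proof (cases "a \<le> x \<and> x \<le> b")
    case True
    have "\<bar>(e * x + c) / (b - a) * D\<bar> \<le> 1 * (C * real n)"
      unfolding abs_mult using w[OF True] D(1) by (intro mult_mono) auto
    then show ?thesis by simp
  next
    case False
    then show ?thesis using D by simp
  qed
  moreover have "real n * 2 ^ k + C * real n = (2 ^ k + C) * real n" by (simp add: algebra_simps)
  ultimately show "\<bar>e / (b - a) * N x + (e * x + c) / (b - a) * D\<bar> \<le> (2 ^ k + C) * real n"
    by linarith
qed

text \<open>The constant depends on \<open>p\<close> and \<open>k\<close> only. This is all that is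
  known about derivatives of splines with repeated knots; passing to the next degree replaces
  \<open>C\<close> by \<open>2 * (2 ^ k + C)\<close>.\<close>

lemma bspline_has_deriv:
  "\<exists>C\<ge>0. \<forall>n i x. n \<ge> 1 \<longrightarrow> real n * x \<notin> \<int> \<longrightarrow>
     (\<exists>D. (bspline p n k i has_real_derivative D) (at x) \<and> \<bar>D\<bar> \<le> C * real n)"
proof (induction k)
  case 0
  have "(bspline p n 0 i has_real_derivative 0) (at x)" if n: "n \<ge> 1" and x: "real n * x \<notin> \<int>" for n i x
  proof (cases "x < knot p n i \<or> knot p n (i + 0 + 1) < x")
    case False
    with x n knot_mult_Ints[OF n, of p] have "x \<in> {knot p n i<..<knot p n (i + 1)}"
      by (metis add_0_right greaterThanLessThan_iff linorder_less_linear)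
    then have "\<forall>\<^sub>F y in nhds x. y \<in> {knot p n i<..<knot p n (i + 1)}" by (intro eventually_nhds_in_open) auto
    then have "\<forall>\<^sub>F y in nhds x. bspline p n 0 i y = 1" by eventually_elim auto
    then have "(bspline p n 0 i has_real_derivative 0) (at x) \<longleftrightarrow> ((\<lambda>_. 1) has_real_derivative 0) (at x)"
      by (intro DERIV_cong_ev refl)
    then show ?thesis by simp
  qed (use deriv_bspline_support[OF n] in blast)
  then have "\<forall>n i x. n \<ge> 1 \<longrightarrow> real n * x \<notin> \<int> \<longrightarrow>
     (\<exists>D. (bspline p n 0 i has_real_derivative D) (at x) \<and> \<bar>D\<bar> \<le> 0 * real n)"
    by (metis abs_zero mult_zero_left order_refl)
  then show ?case by blast
next
  case (Suc k)
  then obtain C where C: "C \<ge> 0" "\<And>n i x. n \<ge> 1 \<Longrightarrow> real n * x \<notin> \<int> \<Longrightarrow>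
     \<exists>D. (bspline p n k i has_real_derivative D) (at x) \<and> \<bar>D\<bar> \<le> C * real n" by blast
  have "\<exists>D. (bspline p n (Suc k) i has_real_derivative D) (at x) \<and> \<bar>D\<bar> \<le> 2 * (2 ^ k + C) * real n"
    if n: "n \<ge> 1" and x: "real n * x \<notin> \<int>" for n i x
  proof -
    have gap: "knot p n j = knot p n (j + Suc k) \<or> 1 / real n \<le> knot p n (j + Suc k) - knot p n j" for j
      using knot_gap[OF n, of j "j + Suc k" p] by auto
    have D: "\<exists>D. (bspline p n k j has_real_derivative D) (at x) \<and> \<bar>D\<bar> \<le> C * real n \<and>
        (\<not> (knot p n j \<le> x \<and> x \<le> knot p n (j + Suc k)) \<longrightarrow> D = 0)" for j
    proof (cases "knot p n j \<le> x \<and> x \<le> knot p n (j + Suc k)")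
      case False
      then have "(bspline p n k j has_real_derivative 0) (at x)"
        by (intro deriv_bspline_support[OF n]) auto
      then show ?thesis using C(1) by force
    qed (use C(2)[OF n x] in blast)
    obtain D0 where D0: "(bspline p n k i has_real_derivative D0) (at x)" "\<bar>D0\<bar> \<le> C * real n"
      "\<not> (knot p n i \<le> x \<and> x \<le> knot p n (i + Suc k)) \<Longrightarrow> D0 = 0" using D by blast
    obtain D1 where D1: "(bspline p n k (i + 1) has_real_derivative D1) (at x)" "\<bar>D1\<bar> \<le> C * real n"
      "\<not> (knot p n (i + 1) \<le> x \<and> x \<le> knot p n (i + 1 + Suc k)) \<Longrightarrow> D1 = 0" using D by blast
    obtain E0 where E0: "((\<lambda>x. (1 * x + - knot p n i) / (knot p n (i + Suc k) - knot p n i) * bspline p n k i x)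
        has_real_derivative E0) (at x)" "\<bar>E0\<bar> \<le> (2 ^ k + C) * real n"
      using deriv_bspline_summand[OF D0 abs_bspline_le[OF n] gap[of i] n, where e = 1 and c = "- knot p n i"]
        abs_bspline_weight_le_one(1)[of "knot p n i" x "knot p n (i + Suc k)"] by auto
    obtain E1 where E1: "((\<lambda>x. ((- 1) * x + knot p n (i + 1 + Suc k)) / (knot p n (i + 1 + Suc k) - knot p n (i + 1))
          * bspline p n k (i + 1) x)
        has_real_derivative E1) (at x)" "\<bar>E1\<bar> \<le> (2 ^ k + C) * real n"
      using deriv_bspline_summand[OF D1 abs_bspline_le[OF n] gap[of "i + 1"] n, where e = "- 1" and c = "knot p n (i + 1 + Suc k)"]
        abs_bspline_weight_le_one(2)[of "knot p n (i + 1)" x "knot p n (i + 1 + Suc k)"] by auto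
    have "bspline p n (Suc k) i = (\<lambda>x. (1 * x + - knot p n i) / (knot p n (i + Suc k) - knot p n i) * bspline p n k i x
        + ((- 1) * x + knot p n (i + 1 + Suc k)) / (knot p n (i + 1 + Suc k) - knot p n (i + 1)) * bspline p n k (i + 1) x)"
      by (auto simp: fun_eq_iff)
    then have "(bspline p n (Suc k) i has_real_derivative E0 + E1) (at x)"
      using DERIV_add[OF E0(1) E1(1)] by simp
    moreover have "\<bar>E0 + E1\<bar> \<le> 2 * (2 ^ k + C) * real n" using E0(2) E1(2) by linarith
    ultimately show ?thesis by blast
  qed
  then show ?case using C(1) by (intro exI[of _ "2 * (2 ^ k + C)"]) (auto simp del: bspline.simps)
qed

text \<open>The knots involved are those with numbers \<open>i\<close> to \<open>i + k + 1\<close>.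
  Since \<open>p + 1\<close> is the last copy of 0 and \<open>p + n + 1\<close> the first copy of 1,
  they are equispaced with step 1/n, and the two recursions coincide.\<close>

lemma bspline_eq_cardinal:
  assumes n: "n \<ge> 1" and "p + 1 \<le> i" "i + k \<le> p + n"
  shows "bspline p n k i x = cardinal_bspline k (real n * x - real (i - (p + 1)))"
  using assms(2-)
proof (induction k arbitrary: i)
  case 0
  then have "knot p n i = real (i - (p + 1)) / real n" "knot p n (i + 1) = (real (i - (p + 1)) + 1) / real n"
    using n by (auto simp: knot_eq min_def of_nat_diff)
  moreover have "a / real n \<le> x \<longleftrightarrow> a \<le> real n * x" "x < a / real n \<longleftrightarrow> real n * x < a" for a
    using n by (simp_all add: field_simps)
  ultimately show ?case by (simp add: algebra_simps)
next
  case (Suc k)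
  let ?a = "real (i - (p + 1))"
  have kn: "knot p n (i + j) = (?a + real j) / real n" if "j \<le> k + 2" for j
    using that Suc.prems n by (auto simp: knot_eq min_def of_nat_diff)
  have k: "knot p n i = ?a / real n" "knot p n (i + Suc k) = (?a + real k + 1) / real n"
    "knot p n (i + 1) = (?a + 1) / real n" "knot p n (i + Suc k + 1) = (?a + real k + 2) / real n"
    using kn[of 0] kn[of "Suc k"] kn[of 1] kn[of "k + 2"] by (simp_all add: add_ac)
  have IH: "bspline p n k i x = cardinal_bspline k (real n * x - ?a)"
    "bspline p n k (i + 1) x = cardinal_bspline k (real n * x - ?a - 1)"
    using Suc.IH[of i] Suc.IH[of "i + 1"] Suc.prems by (simp_all add: of_nat_diff algebra_simps)
  have d: "(?a + real k + 1) / real n - ?a / real n = (real k + 1) / real n"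
    "(?a + real k + 2) / real n - (?a + 1) / real n = (real k + 1) / real n"
    by (simp_all add: diff_divide_distrib[symmetric])
  have q: "(x - ?a / real n) / ((real k + 1) / real n) = (real n * x - ?a) / (real k + 1)"
     "((?a + real k + 2) / real n - x) / ((real k + 1) / real n) = (real k + 2 - (real n * x - ?a)) / (real k + 1)"
  proof -
    have "(x - ?a / real n) = (real n * x - ?a) / real n" "(?a + real k + 2) / real n - x = (real k + 2 - (real n * x - ?a)) / real n"
      using n by (simp_all add: field_simps)
    then show "(x - ?a / real n) / ((real k + 1) / real n) = (real n * x - ?a) / (real k + 1)"
      "((?a + real k + 2) / real n - x) / ((real k + 1) / real n) = (real k + 2 - (real n * x - ?a)) / (real k + 1)"
      using n by simp_all
  qed
  show ?case
    unfolding bspline.simps IH k d q cardinal_bspline_rec by (simp add: add_divide_distrib)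
qed

section \<open>Gram integrals\<close>

text \<open>Holds for non-integrable \<open>g\<close> as well, since \<^const>\<open>integral\<close> is then \<open>0\<close>.\<close>
lemma abs_integral_le_supported:
  fixes g :: "real \<Rightarrow> real"
  assumes S: "finite S" and K: "K \<ge> 0" and g: "\<And>x. x \<in> {0..1} - S \<Longrightarrow> \<bar>g x\<bar> \<le> K"
    and z: "\<And>x. x \<in> {0..1} - S \<Longrightarrow> x \<notin> {c..d} \<Longrightarrow> g x = 0" and cd: "c \<le> d"
  shows "\<bar>integral {0..1} g\<bar> \<le> K * (d - c)"
proof (cases "g integrable_on {0..1}")
  case True
  define g' where "g' x = (if x \<in> S then 0 else g x)" for x
  have "g' integrable_on {0..1}"
    by (rule integrable_spike[OF True negligible_finite[OF S]]) (auto simp: g'_def)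
  moreover have "(\<lambda>x. if x \<in> {c..d} then K else 0) integrable_on {0..1}"
    unfolding integrable_restrict_Int Int_atLeastAtMost by (intro integrable_continuous_real continuous_on_const)
  ultimately have "norm (integral {0..1} g') \<le> integral {0..1} (\<lambda>x. if x \<in> {c..d} then K else 0)"
  proof (rule integral_norm_bound_integral)
    fix x :: real assume "x \<in> {0..1}"
    then show "norm (g' x) \<le> (if x \<in> {c..d} then K else 0)"
      using g[of x] z[of x] K by (auto simp: g'_def)
  qed
  also have "\<dots> \<le> K * (d - c)"
  proof -
    have "integral {0..1} (\<lambda>x. if x \<in> {c..d} then K else 0) = integral {max c 0..min d 1} (\<lambda>_. K)"
      unfolding Henstock_Kurzweil_Integration.integral_restrict_Int Int_atLeastAtMost by simp
    also have "\<dots> \<le> K * (d - c)"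
      using K cd by (auto simp: mult.commute intro!: mult_left_mono)
    finally show ?thesis .
  qed
  also have "integral {0..1} g' = integral {0..1} g"
    by (rule integral_spike[OF negligible_finite[OF S]]) (auto simp: g'_def)
  finally show ?thesis by simp
next
  case False
  then show ?thesis using K cd by (simp add: not_integrable_integral)
qed

lemma finite_mult_Ints: "n \<noteq> 0 \<Longrightarrow> finite {x \<in> {0..1 :: real}. n * x \<in> \<int>}"
proof -
  assume n: "n \<noteq> 0"
  have "{x \<in> {0..1 :: real}. n * x \<in> \<int>} \<subseteq> (\<lambda>y. y / n) ` (\<int> \<inter> {- \<bar>n\<bar>..\<bar>n\<bar>})"
  proof
    fix x assume x: "x \<in> {x \<in> {0..1 :: real}. n * x \<in> \<int>}"
    then have "\<bar>n * x\<bar> \<le> \<bar>n\<bar> * 1" unfolding abs_mult by (intro mult_left_mono) auto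
    then have "n * x \<in> \<int> \<inter> {- \<bar>n\<bar>..\<bar>n\<bar>}" using x by auto
    then show "x \<in> (\<lambda>y. y / n) ` (\<int> \<inter> {- \<bar>n\<bar>..\<bar>n\<bar>})" using n by (intro image_eqI[of _ _ "n * x"]) auto
  qed
  then show ?thesis using finite_surj finite_Ints_atLeastAtMost by blast
qed

text \<open>The flags say which factor is differentiated, so that mass, advection and stiffness
  matrices are treated at once.\<close>

definition gram_entry :: "bool \<Rightarrow> bool \<Rightarrow> nat \<Rightarrow> nat \<Rightarrow> nat \<Rightarrow> nat \<Rightarrow> real" where
  "gram_entry d e p n i j = integral {0..1} (\<lambda>x.
     (if d then deriv (bspline p n p (i + 2)) x else bspline p n p (i + 2) x) *
     (if e then deriv (bspline p n p (j + 2)) x else bspline p n p (j + 2) x))"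

definition gram_symbol :: "bool \<Rightarrow> bool \<Rightarrow> nat \<Rightarrow> real \<Rightarrow> real" where
  "gram_symbol d e p s = (\<integral>t.
     (if d then cardinal_bspline_slope p t else cardinal_bspline p t) *
     (if e then cardinal_bspline_slope p (t + s) else cardinal_bspline p (t + s)) \<partial>lborel)"

lemma bspline_or_deriv_bounds:
  "\<exists>C\<ge>0. \<forall>n i x d. n \<ge> 1 \<longrightarrow> real n * x \<notin> \<int> \<longrightarrow>
     \<bar>if d then deriv (bspline p n p i) x else bspline p n p i x\<bar> \<le> (if d then C * real n else C) \<and>
     (x \<notin> {knot p n i..knot p n (i + p + 1)} \<longrightarrow> (if d then deriv (bspline p n p i) x else bspline p n p i x) = 0)"
proof -
  obtain C where C: "C \<ge> 0" "\<And>n i x. n \<ge> 1 \<Longrightarrow> real n * x \<notin> \<int> \<Longrightarrow>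
     \<exists>D. (bspline p n p i has_real_derivative D) (at x) \<and> \<bar>D\<bar> \<le> C * real n"
    using bspline_has_deriv[of p p] by blast
  have "\<bar>if d then deriv (bspline p n p i) x else bspline p n p i x\<bar> \<le>
         (if d then max C (2 ^ p) * real n else max C (2 ^ p)) \<and>
     (x \<notin> {knot p n i..knot p n (i + p + 1)} \<longrightarrow> (if d then deriv (bspline p n p i) x else bspline p n p i x) = 0)"
    if n: "n \<ge> 1" and x: "real n * x \<notin> \<int>" for n i x d
  proof (cases d)
    case True
    obtain D where D: "(bspline p n p i has_real_derivative D) (at x)" "\<bar>D\<bar> \<le> C * real n" using C(2)[OF n x] by blast
    have "C * real n \<le> max C (2 ^ p) * real n" by (intro mult_right_mono) auto
    moreover have "deriv (bspline p n p i) x = 0" if "x \<notin> {knot p n i..knot p n (i + p + 1)}"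
      using that by (intro DERIV_imp_deriv deriv_bspline_support[OF n]) auto
    ultimately show ?thesis using True D DERIV_imp_deriv[OF D(1)] by auto
  next
    case False
    then show ?thesis using abs_bspline_le[OF n, of p p i x] bspline_support[OF n, of x p i p]
      by (auto simp: le_max_iff_disj)
  qed
  then show ?thesis using C(1) by (intro exI[of _ "max C (2 ^ p)"]) (simp only: le_max_iff_disj, blast)
qed

text \<open>Each derivative costs a factor n, and the length of the support, or the substitution t =
  n x - a, a factor 1/n.\<close>

definition gram_scale :: "bool \<Rightarrow> bool \<Rightarrow> nat \<Rightarrow> real" where
  "gram_scale d e n = (if d then real n else 1) * (if e then real n else 1) / real n"

text \<open>Sup bounds of the factors times the length of one support, at most (p + 1)/n. No
  translation structure enters, so the boundary splines are covered.\<close>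

lemma gram_entry_bounds:
  "\<exists>C\<ge>0. \<forall>d e n i j. n \<ge> 1 \<longrightarrow> \<bar>gram_entry d e p n i j\<bar> \<le> C * gram_scale d e n \<and>
     (\<not> (i \<le> j + p \<and> j \<le> i + p) \<longrightarrow> gram_entry d e p n i j = 0)"
proof -
  obtain C where C0: "C \<ge> 0" and C: "\<And>n i x d. n \<ge> 1 \<Longrightarrow> real n * x \<notin> \<int> \<Longrightarrow>
     \<bar>if d then deriv (bspline p n p i) x else bspline p n p i x\<bar> \<le> (if d then C * real n else C)"
    "\<And>n i x d. n \<ge> 1 \<Longrightarrow> real n * x \<notin> \<int> \<Longrightarrow> x \<notin> {knot p n i..knot p n (i + p + 1)} \<Longrightarrow>
     (if d then deriv (bspline p n p i) x else bspline p n p i x) = 0"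
    using bspline_or_deriv_bounds[of p] by metis
  have "\<bar>gram_entry d e p n i j\<bar> \<le> C * C * (real p + 1) * gram_scale d e n \<and>
     (\<not> (i \<le> j + p \<and> j \<le> i + p) \<longrightarrow> gram_entry d e p n i j = 0)" if n: "n \<ge> 1" for d e n i j
  proof
    let ?S = "{x \<in> {0..1 :: real}. real n * x \<in> \<int>}"
    let ?f = "\<lambda>i d x. if d then deriv (bspline p n p i) x else bspline p n p i x"
    let ?K = "(if d then C * real n else C) * (if e then C * real n else C)"
    have S: "finite ?S" using n by (intro finite_mult_Ints) auto
    have k: "knot p n (i + 2) \<le> knot p n (i + 2 + p + 1)" by (intro knot_mono[OF n]) auto
    have "\<bar>gram_entry d e p n i j\<bar> \<le> ?K * (knot p n (i + 2 + p + 1) - knot p n (i + 2))"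
      unfolding gram_entry_def
    proof (rule abs_integral_le_supported[OF S _ _ _ k])
      fix x assume "x \<in> {0..1} - ?S"
      then have x: "real n * x \<notin> \<int>" by auto
      show "\<bar>?f (i + 2) d x * ?f (j + 2) e x\<bar> \<le> ?K"
        unfolding abs_mult using C0 by (intro mult_mono C(1)[OF n x]) auto
      show "?f (i + 2) d x * ?f (j + 2) e x = 0" if "x \<notin> {knot p n (i + 2)..knot p n (i + 2 + p + 1)}"
        using C(2)[OF n x that, of d] by simp
    qed (use C0 in auto)
    also have "\<dots> \<le> ?K * (real (p + 1) / real n)"
      using knot_width[OF n, of p "i + 2" "p + 1"] C0 by (intro mult_left_mono) (auto simp: add_ac)
    also have "\<dots> = C * C * (real p + 1) * gram_scale d e n"
      by (auto simp: gram_scale_def field_simps)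
    finally show "\<bar>gram_entry d e p n i j\<bar> \<le> C * C * (real p + 1) * gram_scale d e n" .
    show "\<not> (i \<le> j + p \<and> j \<le> i + p) \<longrightarrow> gram_entry d e p n i j = 0"
    proof
      assume "\<not> (i \<le> j + p \<and> j \<le> i + p)"
      then have "i + 2 + p + 1 \<le> j + 2 \<or> j + 2 + p + 1 \<le> i + 2" by auto
      then have disj: "knot p n (i + 2 + p + 1) \<le> knot p n (j + 2) \<or> knot p n (j + 2 + p + 1) \<le> knot p n (i + 2)"
        using knot_mono[OF n] by blast
      \<comment> \<open>The supports share at most a knot, and knots are excluded; so the integrand
        is bounded by zero off a finite set.\<close>
      have "\<bar>gram_entry d e p n i j\<bar> \<le> 0 * (1 - 0)"
        unfolding gram_entry_def
      proof (rule abs_integral_le_supported[OF S])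
        fix x assume "x \<in> {0..1} - ?S"
        then have x: "real n * x \<notin> \<int>" by auto
        have "x \<noteq> knot p n m" for m using x knot_mult_Ints[OF n] by metis
        then have "x \<notin> {knot p n (i + 2)..knot p n (i + 2 + p + 1)} \<or> x \<notin> {knot p n (j + 2)..knot p n (j + 2 + p + 1)}"
          using disj by (metis atLeastAtMost_iff order_antisym order_trans)
        then have "?f (i + 2) d x = 0 \<or> ?f (j + 2) e x = 0" using C(2)[OF n x] by blast
        then show "\<bar>?f (i + 2) d x * ?f (j + 2) e x\<bar> \<le> 0" by auto
      qed auto
      then show "gram_entry d e p n i j = 0" by simp
    qed
  qed
  then show ?thesis using C0 by (intro exI[of _ "C * C * (real p + 1)"]) auto
qed

lemma gram_symbol_eq:
  assumes "p \<ge> 1"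
  shows "gram_symbol False False p s = cardinal_bspline (2 * p + 1) (real p + 1 - s)"
    "gram_symbol False True p s = - deriv (cardinal_bspline (2 * p + 1)) (real p + 1 - s)"
    "gram_symbol True True p s = - (deriv ^^ 2) (cardinal_bspline (2 * p + 1)) (real p + 1 - s)"
  using correlation_slope(2)[OF assms] correlation_slope_slope(2)[OF assms]
    cardinal_bspline_correlation[of p 0 p s]
  by (simp_all add: gram_symbol_def mult_2 del: funpow.simps)

lemma bspline_or_deriv_eq_cardinal:
  assumes n: "n \<ge> 1" and p: "p \<ge> 1" and i: "p + 1 \<le> i" "i \<le> n" and x: "real n * x \<notin> \<int>"
  shows "(if d then deriv (bspline p n p i) x else bspline p n p i x) =
    (if d then real n else 1) * (if d then cardinal_bspline_slope p (real n * x - real (i - (p + 1)))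
       else cardinal_bspline p (real n * x - real (i - (p + 1))))"
proof -
  have eq: "bspline p n p i = (\<lambda>x. cardinal_bspline p (real n * x - real (i - (p + 1))))"
    using bspline_eq_cardinal[OF n i(1), of p] i(2) by (auto simp: fun_eq_iff)
  have "real n * x - real (i - (p + 1)) \<notin> \<int>" using x by (metis Ints_diff Ints_of_nat Ints_add diff_add_cancel)
  note D = deriv_cardinal_bspline[OF p this]
  have "((\<lambda>x. cardinal_bspline p (real n * x - real (i - (p + 1)))) has_real_derivative
     cardinal_bspline_slope p (real n * x - real (i - (p + 1))) * real n) (at x)"
    by (rule DERIV_chain2[where g = "\<lambda>x. real n * x - real (i - (p + 1))", OF D]) (auto intro!: derivative_eq_intros)
  from DERIV_imp_deriv[OF this] show ?thesis unfolding eq by simp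
qed

lemma slope_support: "p \<ge> 1 \<Longrightarrow> t \<notin> {0..real p + 1} \<Longrightarrow> cardinal_bspline_slope p t = 0"
  using cardinal_bspline_support[of t "p - 1"] cardinal_bspline_support[of "t - 1" "p - 1"]
  by (auto simp: cardinal_bspline_slope_def of_nat_diff)

text \<open>The spline with number i + 2 avoids repeated knots exactly if p + 1 \<le> i + 2 and i +
  2 + p \<le> p + n. Both factors are then translates of one function in the variable n x, and only
  the difference of the indices survives the substitution.\<close>

lemma gram_entry_interior:
  assumes n: "n \<ge> 1" and p: "p \<ge> 1" and i: "p \<le> i + 1" "i + 2 \<le> n" and j: "p \<le> j + 1" "j + 2 \<le> n"
    and de: "d \<longrightarrow> e"
  shows "gram_entry d e p n i j = gram_scale d e n * gram_symbol d e p (real i - real j)"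
proof -
  let ?c = "\<lambda>d t. if d then cardinal_bspline_slope p t else cardinal_bspline p t"
  define a where "a = real (i + 2 - (p + 1))"
  have b: "real (j + 2 - (p + 1)) = a - (real i - real j)" using i j by (auto simp: a_def of_nat_diff)
  let ?s = "real i - real j"
  let ?F = "\<lambda>t. ?c d t * ?c e (t + ?s)"
  let ?N = "(if d then real n else 1) * (if e then real n else 1)"
  have "gram_entry d e p n i j = integral {0..1} (\<lambda>x. ?N * ?F (real n * x - a))"
    unfolding gram_entry_def
  proof (rule integral_spike)
    show "negligible {x \<in> {0..1 :: real}. real n * x \<in> \<int>}" using n by (intro negligible_finite finite_mult_Ints) auto
    fix x assume "x \<in> {0..1} - {x \<in> {0..1 :: real}. real n * x \<in> \<int>}"
    then have x: "real n * x \<notin> \<int>" by auto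
    have i': "p + 1 \<le> i + 2" and j': "p + 1 \<le> j + 2" using i j by auto
    have "real n * x - real (j + 2 - (p + 1)) = real n * x - a + ?s" unfolding b by simp
    note eqs = bspline_or_deriv_eq_cardinal[OF n p i' i(2) x, of d, folded a_def]
      bspline_or_deriv_eq_cardinal[OF n p j' j(2) x, of e, unfolded this]
    show "?N * ?F (real n * x - a) =
       (if d then deriv (bspline p n p (i + 2)) x else bspline p n p (i + 2) x) *
       (if e then deriv (bspline p n p (j + 2)) x else bspline p n p (j + 2) x)"
      unfolding eqs by (simp only: mult_ac)
  qed
  also have "\<dots> = ?N * integral {0..1} (\<lambda>x. ?F (real n * x - a))"
    by (rule Henstock_Kurzweil_Integration.integral_mult_right)
  also have "integral {0..1} (\<lambda>x. ?F (real n * x - a)) = (\<integral>t. ?F t \<partial>lborel) / real n"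
  proof (rule integral_rescale[where c = "real p + 1"])
    show "integrable lborel ?F"
      using de correlation_slope(1)[OF p, of ?s] correlation_slope_slope(1)[OF p, of ?s]
        cardinal_bspline_prod_integrable[of p 0 p ?s] by (cases d; cases e) auto
    fix t assume "t \<notin> {0..real p + 1}"
    then show "?F t = 0"
      using slope_support[OF p, of t] cardinal_bspline_support[of t p] by auto
  qed (use n i in \<open>auto simp: a_def of_nat_diff\<close>)
  finally show ?thesis by (simp add: gram_scale_def gram_symbol_def)
qed

section \<open>Eigenvalues and traces\<close>

lemma pow_mat_upper_triangular:
  fixes B :: "'a :: comm_ring_1 mat"
  assumes B: "B \<in> carrier_mat n n" and ut: "upper_triangular B"
  shows "upper_triangular (B ^\<^sub>m k) \<and> (\<forall>i<n. (B ^\<^sub>m k) $$ (i, i) = (B $$ (i, i)) ^ k)"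
proof (induction k)
  case 0
  then show ?case using B by auto
next
  case (Suc k)
  let ?P = "B ^\<^sub>m k"
  have P: "?P \<in> carrier_mat n n" using B by simp
  have e: "(?P * B) $$ (i, j) = (\<Sum>l = 0..<n. ?P $$ (i, l) * B $$ (l, j))" if "i < n" "j < n" for i j
    using that B P by (simp add: scalar_prod_def)
  have z: "?P $$ (i, l) * B $$ (l, j) = 0" if "i < n" "l < n" "j < n" "l < i \<or> j < l" for i l j
    using that Suc.IH ut B P by (auto simp: upper_triangular_def)
  have "(?P * B) $$ (i, j) = 0" if "i < n" "j < i" for i j
    using that by (subst e) (auto intro!: sum.neutral z)
  moreover have "(?P * B) $$ (i, i) = B $$ (i, i) ^ Suc k" if i: "i < n" for i
  proof -
    have "(?P * B) $$ (i, i) = (\<Sum>l\<in>{i}. ?P $$ (i, l) * B $$ (l, i))"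
      unfolding e[OF i i] using i by (intro sum.mono_neutral_right) (auto intro!: z)
    then show ?thesis using Suc.IH i by (simp add: mult.commute)
  qed
  ultimately show ?case using B P by (auto simp: upper_triangular_def)
qed

lemma sum_diag_mult_commute:
  fixes A B :: "'a :: comm_ring_1 mat"
  assumes "A \<in> carrier_mat n n" "B \<in> carrier_mat n n"
  shows "(\<Sum>i<n. (A * B) $$ (i, i)) = (\<Sum>i<n. (B * A) $$ (i, i))"
proof -
  have "(\<Sum>i<n. (A * B) $$ (i, i)) = (\<Sum>i<n. \<Sum>j<n. A $$ (i, j) * B $$ (j, i))"
    using assms by (intro sum.cong) (auto simp: scalar_prod_def lessThan_atLeast0)
  also have "\<dots> = (\<Sum>j<n. \<Sum>i<n. B $$ (j, i) * A $$ (i, j))"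
    by (subst sum.swap) (simp add: mult.commute)
  also have "\<dots> = (\<Sum>i<n. (B * A) $$ (i, i))"
    using assms by (intro sum.cong) (auto simp: scalar_prod_def lessThan_atLeast0)
  finally show ?thesis .
qed

lemma eigenvalue_mset_linear_factors:
  "char_poly A = (\<Prod>a\<leftarrow>as. [:- a, 1:]) \<Longrightarrow> eigenvalue_mset A = mset as"
proof -
  have "proots (\<Prod>a\<leftarrow>as. [:- a, 1:]) = mset as" for as :: "complex list"
  proof (induction as)
    case (Cons a as)
    have "(\<Prod>a\<leftarrow>as. [:- a, 1:]) \<noteq> 0" by (auto simp: prod_list_zero_iff)
    then have "proots ([:- a, 1:] * (\<Prod>a\<leftarrow>as. [:- a, 1:])) = {#a#} + proots (\<Prod>a\<leftarrow>as. [:- a, 1:])"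
      by (subst proots_mult) auto
    then show ?case using Cons by simp
  qed simp
  then show "char_poly A = (\<Prod>a\<leftarrow>as. [:- a, 1:]) \<Longrightarrow> ?thesis" by (simp add: eigenvalue_mset_def)
qed

lemma size_eigenvalue_mset: "A \<in> carrier_mat n n \<Longrightarrow> size (eigenvalue_mset A) = n"
  using char_poly_factorized[of A n] eigenvalue_mset_linear_factors[of A] by fastforce

text \<open>Schur triangularisation: the diagonal of the triangular factor lists the eigenvalues
  with multiplicity, its powers have the powers on the diagonal, and the trace is invariant under
  the similarity.\<close>

lemma sum_eigenvalue_mset_power:
  assumes A: "A \<in> carrier_mat n n"
  shows "(\<Sum>z\<in>#eigenvalue_mset A. z ^ k) = (\<Sum>i<n. (A ^\<^sub>m k) $$ (i, i))"
proof -
  from char_poly_factorized[OF A]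
  obtain as where as: "char_poly A = (\<Prod>a\<leftarrow>as. [:- a, 1:])" "length as = n" by (elim exE conjE)
  obtain B P Q where "schur_decomposition A as = (B, P, Q)" by (metis prod_cases3)
  from schur_decomposition[OF A as(1) this]
  have sim: "similar_mat_wit A B P Q" and ut: "upper_triangular B" and diag: "diag_mat B = as" by auto
  from similar_mat_witD2[OF A sim] have B: "B \<in> carrier_mat n n" and P: "P \<in> carrier_mat n n"
    and Q: "Q \<in> carrier_mat n n" and QP: "Q * P = 1\<^sub>m n" by auto
  have Bk: "B ^\<^sub>m k \<in> carrier_mat n n" using B by simp
  have "(\<Sum>i<n. (A ^\<^sub>m k) $$ (i, i)) = (\<Sum>i<n. (Q * (P * B ^\<^sub>m k)) $$ (i, i))"
    unfolding similar_mat_wit_pow_id[OF sim] by (rule sum_diag_mult_commute) (use P Q Bk in auto)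
  also have "Q * (P * B ^\<^sub>m k) = B ^\<^sub>m k"
    using assoc_mult_mat[OF Q P Bk, symmetric] unfolding QP left_mult_one_mat[OF Bk] .
  also have "(\<Sum>i<n. (B ^\<^sub>m k) $$ (i, i)) = (\<Sum>i<n. B $$ (i, i) ^ k)"
    using pow_mat_upper_triangular[OF B ut, of k] by simp
  also have "\<dots> = (\<Sum>i<n. (as ! i) ^ k)"
    using diag B as(2) by (intro sum.cong) (auto simp: diag_mat_def)
  also have "\<dots> = (\<Sum>z\<in>#mset as. z ^ k)"
    using as(2) by (simp only: mset_map[symmetric] sum_mset_sum_list sum_list_sum_nth length_map) (simp add: lessThan_atLeast0)
  finally show ?thesis unfolding eigenvalue_mset_linear_factors[OF as(1)] ..
qed

section \<open>Location of eigenvalues\<close>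

lemma eigenvalue_mset_imp_eigenvector:
  assumes A: "A \<in> carrier_mat n n" and z: "z \<in># eigenvalue_mset A"
  shows "\<exists>v. (\<exists>i<n. v i \<noteq> 0) \<and> (\<forall>i<n. (\<Sum>j<n. A $$ (i, j) * v j) = z * v i)"
proof -
  have "char_poly A \<noteq> 0" using degree_monic_char_poly[OF A] by auto
  then have "eigenvalue A z" using z eigenvalue_root_char_poly[OF A] by (simp add: eigenvalue_mset_def)
  then obtain v where v: "v \<in> carrier_vec n" "v \<noteq> 0\<^sub>v n" "A *\<^sub>v v = z \<cdot>\<^sub>v v"
    using A unfolding eigenvalue_def eigenvector_def by auto
  have "\<exists>i<n. v $ i \<noteq> 0" using v by (metis eq_vecI carrier_vecD index_zero_vec)
  moreover have "(\<Sum>j<n. A $$ (i, j) * v $ j) = z * v $ i" if i: "i < n" for i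
  proof -
    have "(A *\<^sub>v v) $ i = (\<Sum>j<n. A $$ (i, j) * v $ j)"
      using A v(1) i by (auto simp: scalar_prod_def lessThan_atLeast0)
    then show ?thesis using v i by simp
  qed
  ultimately show ?thesis by (intro exI[of _ "\<lambda>i. v $ i"]) blast
qed

text \<open>The quadratic form of an eigenvector is its own conjugate, and equals the eigenvalue
  times a positive number.\<close>

lemma hermitian_eigenvalue_real:
  assumes A: "A \<in> carrier_mat n n" and z: "z \<in># eigenvalue_mset A"
    and herm: "\<And>i j. i < n \<Longrightarrow> j < n \<Longrightarrow> A $$ (j, i) = cnj (A $$ (i, j))"
  shows "z \<in> \<real>"
proof -
  obtain v where v: "\<exists>i<n. v i \<noteq> 0" "\<And>i. i < n \<Longrightarrow> (\<Sum>j<n. A $$ (i, j) * v j) = z * v i"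
    using eigenvalue_mset_imp_eigenvector[OF A z] by blast
  define S where "S = (\<Sum>i<n. \<Sum>j<n. cnj (v i) * A $$ (i, j) * v j)"
  define N where "N = (\<Sum>i<n. (cmod (v i))\<^sup>2)"
  have "S = (\<Sum>i<n. cnj (v i) * (z * v i))"
    unfolding S_def by (intro sum.cong refl) (simp add: v(2)[symmetric] sum_distrib_left mult.assoc)
  also have "\<dots> = z * of_real N"
    unfolding N_def of_real_sum sum_distrib_left
    by (intro sum.cong refl) (simp add: complex_norm_square[unfolded of_real_power] mult_ac)
  finally have S: "S = z * of_real N" .
  have "cnj S = (\<Sum>i<n. \<Sum>j<n. v i * A $$ (j, i) * cnj (v j))"
    unfolding S_def by (auto simp: herm[symmetric] intro!: sum.cong)
  also have "\<dots> = S"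
    unfolding S_def by (subst sum.swap) (simp add: mult_ac)
  finally have "cnj z * of_real N = z * of_real N" unfolding S by simp
  moreover have "N > 0"
  proof -
    obtain i where "i < n" "v i \<noteq> 0" using v(1) by blast
    then show ?thesis unfolding N_def by (intro sum_pos2[of _ i]) simp_all
  qed
  ultimately show ?thesis by (simp add: Reals_cnj_iff)
qed

text \<open>The eigenvalue equation is read at a coordinate where the eigenvector has largest
  modulus, as for Gershgorin discs.\<close>

lemma eigenvalue_norm_le:
  assumes A: "A \<in> carrier_mat n n" and z: "z \<in># eigenvalue_mset A"
    and R: "\<And>i. i < n \<Longrightarrow> (\<Sum>j<n. norm (A $$ (i, j))) \<le> R"
  shows "norm z \<le> R"
proof -
  obtain v where v: "\<exists>i<n. v i \<noteq> 0" "\<And>i. i < n \<Longrightarrow> (\<Sum>j<n. A $$ (i, j) * v j) = z * v i"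
    using eigenvalue_mset_imp_eigenvector[OF A z] by blast
  let ?V = "(\<lambda>i. norm (v i)) ` {..<n}"
  have ne: "finite ?V" "?V \<noteq> {}" using v(1) by auto
  obtain i where i: "i < n" "norm (v i) = Max ?V" using Max_in[OF ne] by auto
  have mx: "norm (v j) \<le> norm (v i)" if "j < n" for j using that ne i by auto
  obtain j where "j < n" "v j \<noteq> 0" using v(1) by blast
  then have pos: "norm (v i) > 0" using mx[of j] by (meson less_le_trans zero_less_norm_iff)
  have "norm z * norm (v i) = norm (\<Sum>j<n. A $$ (i, j) * v j)" using v(2)[OF i(1)] by (simp add: norm_mult)
  also have "\<dots> \<le> (\<Sum>j<n. norm (A $$ (i, j)) * norm (v i))"
    by (rule sum_norm_le) (auto simp: norm_mult intro!: mult_left_mono mx)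
  also have "\<dots> \<le> R * norm (v i)"
    unfolding sum_distrib_right[symmetric] using R[OF i(1)] by (intro mult_right_mono) auto
  finally show ?thesis using pos by simp
qed

section \<open>Fourier coefficients of powers of a trigonometric symbol\<close>

abbreviation torus :: "(real \<times> real) set" where "torus \<equiv> cbox (- pi, - pi) (pi, pi)"

definition character :: "int \<Rightarrow> int \<Rightarrow> real \<times> real \<Rightarrow> complex" where
  "character u w \<theta> = cis (real_of_int u * fst \<theta>) * cis (real_of_int w * snd \<theta>)"

lemma character_diff: "character u w \<theta> * character (- v) (- z) \<theta> = character (u - v) (w - z) \<theta>"
  by (simp add: character_def cis_mult algebra_simps)

lemma continuous_on_character [continuous_intros]: "continuous_on S (character u w)"
  unfolding character_def by (intro continuous_intros)

lemma integral_cis: "integral {- pi..pi} (\<lambda>t. cis (real_of_int u * t)) = (if u = 0 then complex_of_real (2 * pi) else 0)"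
proof (cases "u = 0")
  case False
  let ?F = "\<lambda>t. cis (real_of_int u * t) / (\<i> * of_int u)"
  have "((\<lambda>t. cis (real_of_int u * t)) has_integral (?F pi - ?F (- pi))) {- pi..pi}"
  proof (rule fundamental_theorem_of_calculus)
    fix t :: real
    have "((\<lambda>t. exp (\<i> * of_int u * complex_of_real t) / (\<i> * of_int u)) has_vector_derivative
       exp (\<i> * of_int u * complex_of_real t)) (at t within {- pi..pi})"
      using False by (auto intro!: derivative_eq_intros has_vector_derivative_real_field)
    then show "(?F has_vector_derivative cis (real_of_int u * t)) (at t within {- pi..pi})"
      by (simp add: cis_conv_exp mult_ac)
  qed simp
  moreover have "?F pi = ?F (- pi)"
  proof -
    have "cis (real_of_int u * pi) = cis (real_of_int u * - pi)"
      by (simp add: complex_eq_iff sin_times_pi_eq_0)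
    then show ?thesis by simp
  qed
  ultimately show ?thesis using False by (simp add: integral_unique)
qed (simp add: scaleR_conv_of_real)

lemma integral_character:
  "integral torus (character u w) = (if u = 0 \<and> w = 0 then complex_of_real (4 * pi\<^sup>2) else 0)"
proof -
  have "integral torus (character u w) =
      integral (cbox (- pi) pi) (\<lambda>x. integral (cbox (- pi) pi) (\<lambda>y. character u w (x, y)))"
    by (rule integral_prod_continuous) (rule continuous_on_character)
  also have "\<dots> = integral {- pi..pi} (\<lambda>x. cis (real_of_int u * x)) * integral {- pi..pi} (\<lambda>y. cis (real_of_int w * y))"
    by (simp add: character_def)
  finally show ?thesis by (simp add: integral_cis power2_eq_square)
qed

definition trig_symbol :: "nat \<Rightarrow> (nat \<Rightarrow> nat \<Rightarrow> int \<Rightarrow> int \<Rightarrow> complex) \<Rightarrow> nat \<Rightarrow> nat \<Rightarrow> real \<times> real \<Rightarrow> complex" where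
  "trig_symbol p T a b \<theta> = (\<Sum>v\<in>{- int p..int p}. \<Sum>w\<in>{- int p..int p}. T a b v w * character v w \<theta>)"

text \<open>Powers of the matrix-valued symbol as plain functions, so that continuity and
  integration can be handled entry by entry. Multiplication on the right matches the recursion of
  \<open>pow_mat\<close>.\<close>

primrec power_symbol :: "nat \<Rightarrow> nat \<Rightarrow> (nat \<Rightarrow> nat \<Rightarrow> int \<Rightarrow> int \<Rightarrow> complex) \<Rightarrow> nat \<Rightarrow> nat \<Rightarrow> nat \<Rightarrow> real \<times> real \<Rightarrow> complex" where
  "power_symbol s p T 0 a b \<theta> = (if a = b then 1 else 0)"
| "power_symbol s p T (Suc k) a b \<theta> = (\<Sum>d<s. power_symbol s p T k a d \<theta> * trig_symbol p T d b \<theta>)"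

text \<open>The Fourier coefficient with index (u, w) of an entry of the power; the divisor is the
  area of the torus.\<close>

definition power_coeff :: "nat \<Rightarrow> nat \<Rightarrow> (nat \<Rightarrow> nat \<Rightarrow> int \<Rightarrow> int \<Rightarrow> complex) \<Rightarrow> nat \<Rightarrow> nat \<Rightarrow> nat \<Rightarrow> int \<Rightarrow> int \<Rightarrow> complex" where
  "power_coeff s p T k a b u w =
     integral torus (\<lambda>\<theta>. power_symbol s p T k a b \<theta> * character (- u) (- w) \<theta>) / of_real (4 * pi\<^sup>2)"

lemma continuous_on_power_symbol [continuous_intros]: "continuous_on S (power_symbol s p T k a b)"
proof (induction k arbitrary: b)
  case (Suc k)
  then show ?case unfolding power_symbol.simps trig_symbol_def by (intro continuous_intros)
qed simp

lemma power_coeff_0: "power_coeff s p T 0 a b u w = (if a = b \<and> u = 0 \<and> w = 0 then 1 else 0)"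
  by (auto simp: power_coeff_def integral_character)

text \<open>Multiplication by the symbol is convolution with its finitely many coefficients. This is
  the recursion that the entries of matrix powers obey away from the ends.\<close>

lemma power_coeff_Suc:
  "power_coeff s p T (Suc k) a b u w =
    (\<Sum>d<s. \<Sum>v\<in>{- int p..int p}. \<Sum>z\<in>{- int p..int p}. power_coeff s p T k a d (u - v) (w - z) * T d b v z)"
proof -
  let ?B = "{- int p..int p}"
  let ?g = "\<lambda>d v z \<theta>. power_symbol s p T k a d \<theta> * character (- (u - v)) (- (w - z)) \<theta>"
  have int: "?g d v z integrable_on torus" for d v z
    by (intro integrable_continuous continuous_intros)
  have "power_symbol s p T (Suc k) a b \<theta> * character (- u) (- w) \<theta> =
     (\<Sum>d<s. \<Sum>v\<in>?B. \<Sum>z\<in>?B. ?g d v z \<theta> * T d b v z)" for \<theta>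
  proof -
    have c: "character v z \<theta> * character (- u) (- w) \<theta> = character (- (u - v)) (- (w - z)) \<theta>" for v z
      using character_diff[of v z \<theta> u w] by simp
    show ?thesis
      unfolding power_symbol.simps trig_symbol_def sum_distrib_left sum_distrib_right c[symmetric]
      by (simp add: mult_ac)
  qed
  then have "integral torus (\<lambda>\<theta>. power_symbol s p T (Suc k) a b \<theta> * character (- u) (- w) \<theta>) =
     integral torus (\<lambda>\<theta>. \<Sum>d<s. \<Sum>v\<in>?B. \<Sum>z\<in>?B. ?g d v z \<theta> * T d b v z)" by presburger
  also have "\<dots> =
     (\<Sum>d<s. \<Sum>v\<in>?B. \<Sum>z\<in>?B. integral torus (?g d v z) * T d b v z)"
    using int by (simp only: Henstock_Kurzweil_Integration.integral_sum integrable_sum integrable_on_mult_left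
        Henstock_Kurzweil_Integration.integral_mult_left finite_lessThan finite_atLeastAtMost_int)
  finally show ?thesis
    by (simp add: power_coeff_def sum_divide_distrib del: power_symbol.simps)
qed

section \<open>Powers of nearly block Toeplitz matrices\<close>

text \<open>Mixed radix notation with digits block, first direction, second direction. It agrees
  with the indexing of a four-block matrix of Kronecker products.\<close>

definition block_index :: "nat \<Rightarrow> nat \<Rightarrow> nat \<Rightarrow> nat \<Rightarrow> nat \<Rightarrow> nat" where
  "block_index N1 N2 a i j = (a * N1 + i) * N2 + j"

lemma mult_add_less: "i < m \<Longrightarrow> j < n \<Longrightarrow> i * n + j < m * (n :: nat)"
proof -
  assume "i < m" "j < n"
  then have "i * n + j < Suc i * n" by simp
  also have "\<dots> \<le> m * n" using \<open>i < m\<close> by (intro mult_le_mono1) simp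
  finally show ?thesis .
qed

lemma block_index_less:
  "a < s \<Longrightarrow> i < N1 \<Longrightarrow> j < N2 \<Longrightarrow> block_index N1 N2 a i j < s * N1 * N2"
  unfolding block_index_def by (intro mult_add_less)

lemma mult_add_inject:
  assumes "i < n" "j < n" "a * n + i = b * n + (j :: nat)" shows "a = b \<and> i = j"
proof -
  have "(a * n + i) div n = a" "(a * n + i) mod n = i" "(b * n + j) div n = b" "(b * n + j) mod n = j"
    using assms(1,2) by simp_all
  then show ?thesis using assms(3) by simp
qed

lemma block_index_inject:
  assumes "i < N1" "k < N1" "j < N2" "l < N2" "block_index N1 N2 a i j = block_index N1 N2 b k l"
  shows "a = b \<and> i = k \<and> j = l"
  using mult_add_inject[OF assms(3,4)] mult_add_inject[OF assms(1,2)] assms(5)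
  unfolding block_index_def by blast

lemma sum_lessThan_mult:
  fixes f :: "nat \<Rightarrow> 'a :: comm_monoid_add"
  shows "(\<Sum>i<m * n. f i) = (\<Sum>i<m. \<Sum>j<n. f (i * n + j))"
proof -
  have "sum f {i * n..<i * n + n} = (\<Sum>j<n. f (i * n + j))" for i
    by (rule sum.reindex_bij_witness[of _ "\<lambda>j. i * n + j" "\<lambda>j. j - i * n"]) auto
  then show ?thesis by (simp flip: sum.nat_group)
qed

lemma sum_block_index:
  fixes f :: "nat \<Rightarrow> 'a :: comm_monoid_add"
  shows "(\<Sum>i<s * N1 * N2. f i) = (\<Sum>a<s. \<Sum>i<N1. \<Sum>j<N2. f (block_index N1 N2 a i j))"
  by (simp add: sum_lessThan_mult block_index_def)

lemma sum_band_eq: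
  fixes g :: "nat \<Rightarrow> 'a :: comm_monoid_add"
  assumes "p \<le> k" "k + p < N" and z: "\<And>m. m < N \<Longrightarrow> \<bar>int m - int k\<bar> > int p \<Longrightarrow> g m = 0"
  shows "(\<Sum>m<N. g m) = (\<Sum>v\<in>{- int p..int p}. g (nat (int k + v)))"
proof -
  have "(\<Sum>m<N. g m) = (\<Sum>m\<in>{k - p..k + p}. g m)"
    using assms(1,2) by (intro sum.mono_neutral_right ballI z) auto
  also have "\<dots> = (\<Sum>v\<in>{- int p..int p}. g (nat (int k + v)))"
    using assms(1) by (intro sum.reindex_bij_witness[of _ "\<lambda>v. nat (int k + v)" "\<lambda>m. int m - int k"]) auto
  finally show ?thesis .
qed

lemma card_band_le: "card {m. m < N \<and> \<bar>int m - int k\<bar> \<le> int p} \<le> 2 * p + 1"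
proof -
  have "card {m. m < N \<and> \<bar>int m - int k\<bar> \<le> int p} \<le> card {k - p..k + p}"
    by (intro card_mono) auto
  then show ?thesis by simp
qed

lemma sum_band_le:
  fixes g :: "nat \<Rightarrow> real"
  assumes K: "K \<ge> 0" and g: "\<And>m. m < N \<Longrightarrow> \<bar>int m - int k\<bar> \<le> int p \<Longrightarrow> g m \<le> K"
    and z: "\<And>m. m < N \<Longrightarrow> \<bar>int m - int k\<bar> > int p \<Longrightarrow> g m \<le> 0"
  shows "(\<Sum>m<N. g m) \<le> real (2 * p + 1) * K"
proof -
  have "(\<Sum>m<N. g m) \<le> (\<Sum>m<N. if \<bar>int m - int k\<bar> \<le> int p then K else 0)"
    using g z by (intro sum_mono) auto
  also have "\<dots> = (\<Sum>m\<in>{m. m < N \<and> \<bar>int m - int k\<bar> \<le> int p}. K)"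
    by (rule sum.mono_neutral_cong_right) auto
  also have "\<dots> \<le> real (2 * p + 1) * K"
    using card_band_le[of N k p] K by (auto intro!: mult_right_mono simp del: of_nat_add)
  finally show ?thesis .
qed

text \<open>\<open>K\<close> and \<open>T\<close> are meant to be shared by all matrices of a
  sequence, while the sizes and \<open>A\<close> vary. Only the column is kept 2p away from the
  ends; within the band this leaves the row a distance p, enough for both splines to avoid repeated
  knots.\<close>

locale near_block_toeplitz =
  fixes s p :: nat and K :: real and T :: "nat \<Rightarrow> nat \<Rightarrow> int \<Rightarrow> int \<Rightarrow> complex" and N1 N2 :: nat
    and A :: "complex mat"
  assumes carrier: "A \<in> carrier_mat (s * N1 * N2) (s * N1 * N2)" and nonneg: "K \<ge> 0"
    and bounded: "\<And>a b i k j l. a < s \<Longrightarrow> b < s \<Longrightarrow> i < N1 \<Longrightarrow> k < N1 \<Longrightarrow> j < N2 \<Longrightarrow> l < N2 \<Longrightarrow>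
      norm (A $$ (block_index N1 N2 a i j, block_index N1 N2 b k l)) \<le> K"
    and banded: "\<And>a b i k j l. a < s \<Longrightarrow> b < s \<Longrightarrow> i < N1 \<Longrightarrow> k < N1 \<Longrightarrow> j < N2 \<Longrightarrow> l < N2 \<Longrightarrow>
      \<bar>int i - int k\<bar> > int p \<or> \<bar>int j - int l\<bar> > int p \<Longrightarrow>
      A $$ (block_index N1 N2 a i j, block_index N1 N2 b k l) = 0"
    and toeplitz: "\<And>a b i k j l. a < s \<Longrightarrow> b < s \<Longrightarrow> i < N1 \<Longrightarrow> k < N1 \<Longrightarrow> j < N2 \<Longrightarrow> l < N2 \<Longrightarrow>
      2 * p \<le> k \<Longrightarrow> k + 2 * p < N1 \<Longrightarrow> 2 * p \<le> l \<Longrightarrow> l + 2 * p < N2 \<Longrightarrow>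
      \<bar>int i - int k\<bar> \<le> int p \<Longrightarrow> \<bar>int j - int l\<bar> \<le> int p \<Longrightarrow>
      A $$ (block_index N1 N2 a i j, block_index N1 N2 b k l) = T a b (int i - int k) (int j - int l)"

lemma pow_mat_Suc_block_index:
  assumes A: "A \<in> carrier_mat (s * N1 * N2) (s * N1 * N2)" and x: "x < s * N1 * N2" "y < s * N1 * N2"
  shows "(A ^\<^sub>m Suc k) $$ (x, y) = (\<Sum>d<s. \<Sum>m<N1. \<Sum>q<N2.
     (A ^\<^sub>m k) $$ (x, block_index N1 N2 d m q) * A $$ (block_index N1 N2 d m q, y))"
proof -
  have "A ^\<^sub>m k \<in> carrier_mat (s * N1 * N2) (s * N1 * N2)" using A by simp
  then have "(A ^\<^sub>m Suc k) $$ (x, y) = (\<Sum>z<s * N1 * N2. (A ^\<^sub>m k) $$ (x, z) * A $$ (z, y))"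
    using A x by (simp add: scalar_prod_def lessThan_atLeast0)
  then show ?thesis unfolding sum_block_index .
qed

lemma sum_near_ends_le: "(\<Sum>i<N. if r \<le> i \<and> i + r < N then 0 else 1 :: real) \<le> 2 * real r"
proof -
  have "(\<Sum>i<N. if r \<le> i \<and> i + r < N then 0 else 1 :: real) \<le>
      (\<Sum>i<N. (if i < r then 1 else 0) + (if N - r \<le> i then 1 else 0))"
    by (intro sum_mono) auto
  also have "\<dots> = (\<Sum>i<N. if i < r then 1 else 0) + (\<Sum>i<N. if N - r \<le> i then 1 else 0)"
    by (rule sum.distrib)
  also have "(\<Sum>i<N. if i < r then 1 else 0 :: real) = (\<Sum>i<min N r. 1)"
    by (rule sum.mono_neutral_cong_right) auto
  also have "(\<Sum>i<N. if N - r \<le> i then 1 else 0 :: real) = (\<Sum>i\<in>{N - r..<N}. 1)"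
    by (rule sum.mono_neutral_cong_right) auto
  also have "(\<Sum>i<min N r. 1) + (\<Sum>i\<in>{N - r..<N}. 1) \<le> 2 * real r" by simp
  finally show ?thesis .
qed

lemma sum_sum_add_mult:
  fixes f g :: "nat \<Rightarrow> real"
  shows "(\<Sum>i<m. \<Sum>j<n. (f i + g j) * c) = (real n * (\<Sum>i<m. f i) + real m * (\<Sum>j<n. g j)) * c"
proof -
  have "(\<Sum>i<m. \<Sum>j<n. (f i + g j) * c) = (\<Sum>i<m. real n * f i + (\<Sum>j<n. g j)) * c"
    unfolding sum_distrib_right by (simp add: sum.distrib sum_distrib_right distrib_right mult.assoc)
  then show ?thesis by (simp add: sum.distrib sum_distrib_left)
qed

text \<open>Bounds every column sum of absolute values: \<open>s\<close> blocks, at most (2p + 1)^2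
  band positions in each, entries at most \<open>K\<close>.\<close>

definition band_norm :: "nat \<Rightarrow> nat \<Rightarrow> real \<Rightarrow> real" where
  "band_norm s p K = real s * (real (2 * p + 1) * (real (2 * p + 1) * K))"

lemma band_norm_nonneg: "K \<ge> 0 \<Longrightarrow> band_norm s p K \<ge> 0"
  by (simp add: band_norm_def)

context near_block_toeplitz
begin

text \<open>Writing the next power as the old one times \<open>A\<close> moves only the column
  index, by at most p in each direction. So each factor consumes a margin p beyond the 2p required
  by \<open>toeplitz\<close>, and the row stays arbitrary.\<close>

lemma pow_mat_block_toeplitz:
  assumes x: "a < s" "i < N1" "j < N2" and b: "b < s"
    and "(k + 2) * p \<le> m" "m + (k + 2) * p < N1" "(k + 2) * p \<le> q" "q + (k + 2) * p < N2"
  shows "(A ^\<^sub>m k) $$ (block_index N1 N2 a i j, block_index N1 N2 b m q) =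
    power_coeff s p T k a b (int i - int m) (int j - int q)"
  using b assms(5-)
proof (induction k arbitrary: b m q)
  case 0
  then have m: "m < N1" "q < N2" by linarith+
  have "block_index N1 N2 a i j = block_index N1 N2 b m q \<longleftrightarrow> a = b \<and> i = m \<and> j = q"
    using block_index_inject x m by blast
  then show ?case
    using carrier block_index_less[OF x] block_index_less[OF 0(1) m]
    by (auto simp: power_coeff_0)
next
  case (Suc k)
  define r where "r = (k + 2) * p"
  have e: "(Suc k + 2) * p = r + p" and r: "2 * p \<le> r" unfolding r_def by simp_all
  note prems = Suc.prems[unfolded e] and IH = Suc.IH[folded r_def]
  have m: "m < N1" "q < N2" using prems by linarith+
  have p: "p \<le> m" "m + p < N1" "p \<le> q" "q + p < N2" "2 * p \<le> m" "m + 2 * p < N1" "2 * p \<le> q" "q + 2 * p < N2"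
    using prems r by linarith+
  let ?B = "{- int p..int p}"
  let ?x = "block_index N1 N2 a i j" and ?y = "block_index N1 N2 b m q"
  let ?t = "\<lambda>d m' q'. (A ^\<^sub>m k) $$ (?x, block_index N1 N2 d m' q') * A $$ (block_index N1 N2 d m' q', ?y)"
  have "(A ^\<^sub>m Suc k) $$ (?x, ?y) = (\<Sum>d<s. \<Sum>m'<N1. \<Sum>q'<N2. ?t d m' q')"
    by (rule pow_mat_Suc_block_index[OF carrier block_index_less block_index_less]) (rule x m prems(1))+
  \<comment> \<open>The band around an interior column is not cut off by the ends, so the sums may
    run over all offsets, as they do in \<open>power_coeff_Suc\<close>.\<close>
  also have "\<dots> = (\<Sum>d<s. \<Sum>v\<in>?B. \<Sum>z\<in>?B. ?t d (nat (int m + v)) (nat (int q + z)))"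
  proof (intro sum.cong refl)
    fix d assume d: "d \<in> {..<s}"
    have "(\<Sum>m'<N1. \<Sum>q'<N2. ?t d m' q') = (\<Sum>v\<in>?B. \<Sum>q'<N2. ?t d (nat (int m + v)) q')"
      using p d m prems(1) by (intro sum_band_eq sum.neutral ballI) (simp_all add: banded)
    also have "\<dots> = (\<Sum>v\<in>?B. \<Sum>z\<in>?B. ?t d (nat (int m + v)) (nat (int q + z)))"
    proof (rule sum.cong[OF refl])
      fix v assume "v \<in> ?B"
      then have "nat (int m + v) < N1" using p by (simp add: nat_less_iff)
      then show "(\<Sum>q'<N2. ?t d (nat (int m + v)) q') = (\<Sum>z\<in>?B. ?t d (nat (int m + v)) (nat (int q + z)))"
        using p d m prems(1) by (intro sum_band_eq) (simp_all add: banded)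
    qed
    finally show "(\<Sum>m'<N1. \<Sum>q'<N2. ?t d m' q') = \<dots>" .
  qed
  also have "\<dots> = (\<Sum>d<s. \<Sum>v\<in>?B. \<Sum>z\<in>?B.
      power_coeff s p T k a d ((int i - int m) - v) ((int j - int q) - z) * T d b v z)"
  proof (intro sum.cong refl)
    fix d v z assume d: "d \<in> {..<s}" and v: "v \<in> ?B" and z: "z \<in> ?B"
    let ?m = "nat (int m + v)" and ?q = "nat (int q + z)"
    have im: "int ?m = int m + v" "int ?q = int q + z" using p v z by auto
    have mq: "r \<le> ?m" "?m + r < N1" "r \<le> ?q" "?q + r < N2"
      using prems v z im by auto
    have "(A ^\<^sub>m k) $$ (?x, block_index N1 N2 d ?m ?q) =
        power_coeff s p T k a d ((int i - int m) - v) ((int j - int q) - z)"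
      using IH[OF _ mq, of d] d unfolding im by (simp only: lessThan_iff diff_diff_eq)
    moreover have "A $$ (block_index N1 N2 d ?m ?q, ?y) = T d b v z"
    proof -
      have "?m < N1" "?q < N2" using mq by linarith+
      moreover have "\<bar>int ?m - int m\<bar> \<le> int p" "\<bar>int ?q - int q\<bar> \<le> int p" using v z unfolding im by auto
      ultimately have "A $$ (block_index N1 N2 d ?m ?q, ?y) = T d b (int ?m - int m) (int ?q - int q)"
        using d[unfolded lessThan_iff] prems(1) p m by (intro toeplitz)
      then show ?thesis unfolding im by simp
    qed
    ultimately show "?t d ?m ?q = power_coeff s p T k a d ((int i - int m) - v) ((int j - int q) - z) * T d b v z"
      by simp
  qed
  finally show ?case unfolding power_coeff_Suc .
qed

lemma column_sum_le:
  assumes y: "b < s" "m < N1" "q < N2"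
  shows "(\<Sum>d<s. \<Sum>i<N1. \<Sum>j<N2. norm (A $$ (block_index N1 N2 d i j, block_index N1 N2 b m q))) \<le> band_norm s p K"
proof -
  let ?n = "\<lambda>d i j. norm (A $$ (block_index N1 N2 d i j, block_index N1 N2 b m q))"
  have "(\<Sum>i<N1. \<Sum>j<N2. ?n d i j) \<le> real (2 * p + 1) * (real (2 * p + 1) * K)" if d: "d < s" for d
  proof (rule sum_band_le)
    fix i assume i: "i < N1"
    show "(\<Sum>j<N2. ?n d i j) \<le> real (2 * p + 1) * K"
      using d i y by (intro sum_band_le[where k = q]) (auto simp: bounded banded nonneg)
    show "(\<Sum>j<N2. ?n d i j) \<le> 0" if "\<bar>int i - int m\<bar> > int p"
      using d i y that by (intro sum_nonpos) (auto simp: banded)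
  qed (use nonneg in auto)
  then have "(\<Sum>d<s. \<Sum>i<N1. \<Sum>j<N2. ?n d i j) \<le> (\<Sum>d<s. real (2 * p + 1) * (real (2 * p + 1) * K))"
    by (intro sum_mono) auto
  then show ?thesis by (simp add: band_norm_def)
qed

text \<open>Column sums are submultiplicative. The bound holds at the boundary too and does not
  depend on the size of the matrix.\<close>

lemma norm_pow_mat_le:
  assumes x: "x < s * N1 * N2" and y: "b < s" "m < N1" "q < N2"
  shows "norm ((A ^\<^sub>m k) $$ (x, block_index N1 N2 b m q)) \<le> band_norm s p K ^ k"
  using y
proof (induction k arbitrary: b m q)
  case 0
  then show ?case using carrier x block_index_less[OF 0] by auto
next
  case (Suc k)
  let ?R = "band_norm s p K" and ?y = "block_index N1 N2 b m q"
  let ?n = "\<lambda>d i j. norm (A $$ (block_index N1 N2 d i j, ?y))"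
  have R: "?R \<ge> 0" by (rule band_norm_nonneg[OF nonneg])
  have "norm ((A ^\<^sub>m Suc k) $$ (x, ?y)) \<le> (\<Sum>d<s. \<Sum>i<N1. \<Sum>j<N2. ?R ^ k * ?n d i j)"
    unfolding pow_mat_Suc_block_index[OF carrier x block_index_less[OF Suc.prems]]
    by (intro sum_norm_le) (auto simp: norm_mult intro!: mult_right_mono Suc.IH)
  also have "\<dots> = ?R ^ k * (\<Sum>d<s. \<Sum>i<N1. \<Sum>j<N2. ?n d i j)"
    by (simp add: sum_distrib_left)
  also have "\<dots> \<le> ?R ^ k * ?R"
    using column_sum_le[OF Suc.prems] R by (intro mult_left_mono) auto
  finally show ?case by (simp add: mult.commute)
qed

text \<open>At interior diagonal positions the power equals its coefficient. At the others, at most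
  2r near the ends in each direction, both terms are bounded separately; counting the corners twice
  makes the estimate a sum over the two directions.\<close>

lemma trace_pow_mat:
  shows "norm ((\<Sum>x<s * N1 * N2. (A ^\<^sub>m k) $$ (x, x)) - of_nat (N1 * N2) * (\<Sum>a<s. power_coeff s p T k a a 0 0))
    \<le> 2 * real ((k + 2) * p) * (real N1 + real N2) * (\<Sum>a<s. band_norm s p K ^ k + norm (power_coeff s p T k a a 0 0))"
proof -
  define r where "r = (k + 2) * p"
  let ?c = "\<lambda>a. power_coeff s p T k a a 0 0"
  let ?w = "\<lambda>a i j. (A ^\<^sub>m k) $$ (block_index N1 N2 a i j, block_index N1 N2 a i j)"
  have one: "norm (\<Sum>i<N1. \<Sum>j<N2. ?w a i j - ?c a) \<le> 2 * real r * (real N1 + real N2) * (band_norm s p K ^ k + norm (?c a))"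
    if a: "a < s" for a
  proof -
    let ?M = "band_norm s p K ^ k + norm (?c a)"
    let ?b = "\<lambda>N i. if r \<le> i \<and> i + r < N then 0 else 1 :: real"
    have M: "?M \<ge> 0" by (intro add_nonneg_nonneg zero_le_power band_norm_nonneg nonneg norm_ge_zero)
    have "norm (?w a i j - ?c a) \<le> (?b N1 i + ?b N2 j) * ?M" if ij: "i < N1" "j < N2" for i j
    proof (cases "(r \<le> i \<and> i + r < N1) \<and> (r \<le> j \<and> j + r < N2)")
      case True
      then have "?w a i j = ?c a" using pow_mat_block_toeplitz[OF a ij a, of k i j, folded r_def] by simp
      then show ?thesis using M by simp
    next
      case False
      have "norm (?w a i j - ?c a) \<le> norm (?w a i j) + norm (?c a)" by (rule norm_triangle_ineq4)
      also have "\<dots> \<le> 1 * ?M"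
        using norm_pow_mat_le[OF block_index_less[OF a ij] a ij, of k] by simp
      also have "\<dots> \<le> (?b N1 i + ?b N2 j) * ?M" using False M by (intro mult_right_mono) auto
      finally show ?thesis .
    qed
    then have "norm (\<Sum>i<N1. \<Sum>j<N2. ?w a i j - ?c a) \<le> (\<Sum>i<N1. \<Sum>j<N2. (?b N1 i + ?b N2 j) * ?M)"
      by (intro sum_norm_le) (simp only: lessThan_iff)
    also have "\<dots> = (real N2 * (\<Sum>i<N1. ?b N1 i) + real N1 * (\<Sum>j<N2. ?b N2 j)) * ?M"
      by (rule sum_sum_add_mult)
    also have "\<dots> \<le> (real N2 * (2 * real r) + real N1 * (2 * real r)) * ?M"
      by (intro mult_right_mono add_mono mult_left_mono M sum_near_ends_le of_nat_0_le_iff)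
    also have "\<dots> = 2 * real r * (real N1 + real N2) * ?M"
    proof -
      have "n * (2 * x) + m * (2 * x) = 2 * x * (m + n)" for n m x :: real by (simp add: algebra_simps)
      then show ?thesis by (rule arg_cong)
    qed
    finally show ?thesis .
  qed
  have eq: "(\<Sum>x<s * N1 * N2. (A ^\<^sub>m k) $$ (x, x)) - of_nat (N1 * N2) * (\<Sum>a<s. ?c a) =
     (\<Sum>a<s. \<Sum>i<N1. \<Sum>j<N2. ?w a i j - ?c a)"
    unfolding sum_block_index sum_subtractf sum_constant sum_distrib_left
    by (simp only: card_lessThan of_nat_mult mult.assoc)
  show ?thesis
    unfolding eq unfolding sum_distrib_left r_def[symmetric]
    by (intro sum_norm_le one) (simp only: lessThan_iff)
qed

end

section \<open>From moments to continuous test functions\<close>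

text \<open>
  Abstracts the two functionals to be compared, the mean over the eigenvalues and the mean of the
  symbol: both are determined up to \<open>\<epsilon>\<close> by their moments as soon as a polynomial is
  within \<open>\<epsilon>\<close> of the test function on \<open>[-C, C]\<close>.
\<close>
definition real_mean :: "real \<Rightarrow> ((complex \<Rightarrow> complex) \<Rightarrow> complex) \<Rightarrow> bool" where
  "real_mean C \<Lambda> \<longleftrightarrow> (\<forall>F a m \<epsilon>. continuous_on UNIV F \<longrightarrow>
     (\<forall>x. \<bar>x\<bar> \<le> C \<longrightarrow> norm (F (of_real x) - (\<Sum>i\<le>m. a i * of_real x ^ i)) \<le> \<epsilon>) \<longrightarrow>
     norm (\<Lambda> F - (\<Sum>i\<le>m. a i * \<Lambda> (\<lambda>z. z ^ i))) \<le> \<epsilon>)"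

text \<open>Real and imaginary parts are approximated within e/2 on the real segment, and the two
  polynomials are padded to a common degree.\<close>

lemma Weierstrass_complex_valued:
  fixes F :: "complex \<Rightarrow> complex"
  assumes F: "continuous_on UNIV F" and e: "e > 0"
  shows "\<exists>a m. \<forall>x. \<bar>x\<bar> \<le> C \<longrightarrow> norm (F (of_real x) - (\<Sum>i\<le>m. a i * of_real x ^ i)) < e"
proof -
  have "continuous_on {- C..C} (\<lambda>x. F (of_real x))"
    by (rule continuous_on_compose2[OF F]) (intro continuous_on_of_real continuous_on_id, simp)
  then have c: "continuous_on {- C..C} (\<lambda>x. Re (F (of_real x)))" "continuous_on {- C..C} (\<lambda>x. Im (F (of_real x)))"
    by (rule continuous_on_Re, rule continuous_on_Im)
  have SW: "\<exists>g. real_polynomial_function g \<and> (\<forall>x\<in>{- C..C}. \<bar>f x - g x\<bar> < e / 2)"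
    if "continuous_on {- C..C} f" for f :: "real \<Rightarrow> real"
  proof (rule Stone_Weierstrass_real_polynomial_function[OF _ that])
    show "0 < e / 2" using e by simp
  qed auto
  obtain g where g: "real_polynomial_function g" "\<forall>x\<in>{- C..C}. \<bar>Re (F (of_real x)) - g x\<bar> < e / 2"
    using SW[OF c(1)] by (elim exE conjE)
  obtain h where h: "real_polynomial_function h" "\<forall>x\<in>{- C..C}. \<bar>Im (F (of_real x)) - h x\<bar> < e / 2"
    using SW[OF c(2)] by (elim exE conjE)
  obtain a m where a: "g = (\<lambda>x. \<Sum>i\<le>m. a i * x ^ i)" using g(1) unfolding real_polynomial_function_iff_sum by (elim exE)
  obtain b l where b: "h = (\<lambda>x. \<Sum>i\<le>l. b i * x ^ i)" using h(1) unfolding real_polynomial_function_iff_sum by (elim exE)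
  let ?a = "\<lambda>i. complex_of_real (if i \<le> m then a i else 0) + \<i> * of_real (if i \<le> l then b i else 0)"
  have ext: "(\<Sum>i\<le>max m l. (if i \<le> n then c i else 0) * x ^ i) = (\<Sum>i\<le>n. c i * x ^ i)"
    if "n \<le> max m l" for n and c :: "nat \<Rightarrow> real" and x :: real
    using that by (intro sum.mono_neutral_cong_right) auto
  have p: "(\<Sum>i\<le>max m l. ?a i * of_real x ^ i) = of_real (g x) + \<i> * of_real (h x)" for x
  proof -
    have "(\<Sum>i\<le>max m l. ?a i * of_real x ^ i) =
       of_real (\<Sum>i\<le>max m l. (if i \<le> m then a i else 0) * x ^ i) +
       \<i> * of_real (\<Sum>i\<le>max m l. (if i \<le> l then b i else 0) * x ^ i)"
      by (simp only: of_real_sum of_real_mult of_real_power sum_distrib_left distrib_right sum.distrib mult.assoc)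
    then show ?thesis unfolding ext[OF max.cobounded1] ext[OF max.cobounded2] a b .
  qed
  show ?thesis
  proof (intro exI allI impI)
    fix x :: real assume "\<bar>x\<bar> \<le> C"
    then have x: "x \<in> {- C..C}" by auto
    let ?w = "F (of_real x) - (\<Sum>i\<le>max m l. ?a i * of_real x ^ i)"
    have "Re ?w = Re (F (of_real x)) - g x" "Im ?w = Im (F (of_real x)) - h x" unfolding p by simp_all
    then have "\<bar>Re ?w\<bar> + \<bar>Im ?w\<bar> < e" using bspec[OF g(2) x] bspec[OF h(2) x] by linarith
    then show "norm ?w < e" using cmod_le[of ?w] by linarith
  qed
qed

text \<open>An argument with e/3: \<open>real_mean\<close> compares each functional with its values
  on one polynomial, and these values converge by linearity in the moments.\<close>

lemma real_mean_tendsto: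
  assumes E: "\<forall>\<^sub>F n in \<Phi>. real_mean C (E n)" and L: "real_mean C \<Lambda>"
    and mom: "\<And>k. ((\<lambda>n. E n (\<lambda>z. z ^ k)) \<longlongrightarrow> \<Lambda> (\<lambda>z. z ^ k)) \<Phi>"
    and F: "continuous_on UNIV F"
  shows "((\<lambda>n. E n F) \<longlongrightarrow> \<Lambda> F) \<Phi>"
proof (rule tendstoI)
  fix e :: real assume e: "e > 0"
  have e3: "0 < e / 3" using e by simp
  obtain a m where a: "\<forall>x. \<bar>x\<bar> \<le> C \<longrightarrow> norm (F (of_real x) - (\<Sum>i\<le>m. a i * of_real x ^ i)) < e / 3"
    using Weierstrass_complex_valued[OF F e3, of C] by (elim exE)
  let ?P = "\<lambda>M. (\<Sum>i\<le>m. a i * M (\<lambda>z. z ^ i))"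
  have bd: "norm (M F - ?P M) \<le> e / 3" if "real_mean C M" for M
  proof -
    have "\<forall>x. \<bar>x\<bar> \<le> C \<longrightarrow> norm (F (of_real x) - (\<Sum>i\<le>m. a i * of_real x ^ i)) \<le> e / 3"
      using a by (simp add: less_imp_le)
    moreover have "continuous_on UNIV F \<longrightarrow>
        (\<forall>x. \<bar>x\<bar> \<le> C \<longrightarrow> norm (F (of_real x) - (\<Sum>i\<le>m. a i * of_real x ^ i)) \<le> e / 3) \<longrightarrow>
        norm (M F - ?P M) \<le> e / 3"
      using that unfolding real_mean_def by (elim allE)
    ultimately show ?thesis using F by blast
  qed
  have "((\<lambda>n. ?P (E n)) \<longlongrightarrow> ?P \<Lambda>) \<Phi>" by (intro tendsto_intros mom)
  then have "\<forall>\<^sub>F n in \<Phi>. dist (?P (E n)) (?P \<Lambda>) < e / 3" using e by (intro tendstoD) auto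
  with E show "\<forall>\<^sub>F n in \<Phi>. dist (E n F) (\<Lambda> F) < e"
  proof eventually_elim
    fix n assume n: "real_mean C (E n)" and "dist (?P (E n)) (?P \<Lambda>) < e / 3"
    then have d: "norm (?P (E n) - ?P \<Lambda>) < e / 3" by (simp add: dist_norm)
    have "E n F - \<Lambda> F = (E n F - ?P (E n)) + (?P (E n) - ?P \<Lambda>) - (\<Lambda> F - ?P \<Lambda>)" by simp
    then have "norm (E n F - \<Lambda> F) = norm ((E n F - ?P (E n)) + (?P (E n) - ?P \<Lambda>) - (\<Lambda> F - ?P \<Lambda>))" by (rule arg_cong)
    then have "norm (E n F - \<Lambda> F) \<le> norm (E n F - ?P (E n)) + norm (?P (E n) - ?P \<Lambda>) + norm (\<Lambda> F - ?P \<Lambda>)"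
      using norm_triangle_ineq4[of "(E n F - ?P (E n)) + (?P (E n) - ?P \<Lambda>)" "\<Lambda> F - ?P \<Lambda>"]
        norm_triangle_ineq[of "E n F - ?P (E n)" "?P (E n) - ?P \<Lambda>"] by linarith
    then show "dist (E n F) (\<Lambda> F) < e" using bd[OF n] bd[OF L] d by (simp add: dist_norm)
  qed
qed

section \<open>Means over multisets and means over boxes\<close>

lemma norm_sum_mset_le:
  fixes g :: "'a \<Rightarrow> 'b :: real_normed_vector"
  shows "(\<And>z. z \<in># M \<Longrightarrow> norm (g z) \<le> e) \<Longrightarrow> norm (\<Sum>z\<in>#M. g z) \<le> real (size M) * e"
proof (induction M)
  case (add x M)
  have "norm (g x + (\<Sum>z\<in>#M. g z)) \<le> e + real (size M) * e"
    using add by (intro order_trans[OF norm_triangle_ineq add_mono]) auto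
  then show ?case by (simp add: algebra_simps)
qed simp

lemma sum_mset_minus_polynomial:
  fixes F :: "complex \<Rightarrow> complex"
  shows "(\<Sum>z\<in>#M. F z - (\<Sum>i\<le>m. a i * z ^ i)) = (\<Sum>z\<in>#M. F z) - (\<Sum>i\<le>m. a i * (\<Sum>z\<in>#M. z ^ i))"
  by (induction M) (simp_all add: sum.distrib algebra_simps)

lemma norm_sum_mset_minus_polynomial_le:
  fixes F :: "complex \<Rightarrow> complex"
  assumes M: "\<And>z. z \<in># M \<Longrightarrow> z \<in> \<real> \<and> norm z \<le> C"
    and a: "\<forall>x. \<bar>x\<bar> \<le> C \<longrightarrow> norm (F (of_real x) - (\<Sum>i\<le>m. a i * of_real x ^ i)) \<le> e"
  shows "norm ((\<Sum>z\<in>#M. F z) - (\<Sum>i\<le>m. a i * (\<Sum>z\<in>#M. z ^ i))) \<le> real (size M) * e"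
  unfolding sum_mset_minus_polynomial[symmetric]
proof (rule norm_sum_mset_le)
  fix z assume "z \<in># M"
  then have "z \<in> \<real>" and zC: "norm z \<le> C" using M by blast+
  then obtain x where x: "z = of_real x" by (elim Reals_cases)
  then have "\<bar>x\<bar> \<le> C" using zC by simp
  then show "norm (F z - (\<Sum>i\<le>m. a i * z ^ i)) \<le> e" using a unfolding x by blast
qed

lemma real_mean_mset:
  assumes M: "\<And>z. z \<in># M \<Longrightarrow> z \<in> \<real> \<and> norm z \<le> C" and n: "size M = n" "n > 0"
  shows "real_mean C (\<lambda>F. (1 / of_nat n) * (\<Sum>z\<in>#M. F z))"
  unfolding real_mean_def
proof (intro allI impI)
  fix F :: "complex \<Rightarrow> complex" and a m and e :: real
  assume a: "\<forall>x. \<bar>x\<bar> \<le> C \<longrightarrow> norm (F (of_real x) - (\<Sum>i\<le>m. a i * of_real x ^ i)) \<le> e"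
  let ?S = "(\<Sum>z\<in>#M. F z) - (\<Sum>i\<le>m. a i * (\<Sum>z\<in>#M. z ^ i))"
  have "(1 / of_nat n) * (\<Sum>z\<in>#M. F z) - (\<Sum>i\<le>m. a i * ((1 / of_nat n) * (\<Sum>z\<in>#M. z ^ i))) = (1 / of_nat n) * ?S"
    by (simp only: right_diff_distrib sum_distrib_left mult.left_commute)
  moreover have "norm ((1 / of_nat n) * ?S) = norm ?S / real n" unfolding norm_mult by (simp add: norm_divide)
  moreover have "norm ?S / real n \<le> e" using norm_sum_mset_minus_polynomial_le[of M, OF M a] n by (subst pos_divide_le_eq) (simp_all only: of_nat_0_less_iff mult.commute)
  ultimately show "norm ((1 / of_nat n) * (\<Sum>z\<in>#M. F z) - (\<Sum>i\<le>m. a i * ((1 / of_nat n) * (\<Sum>z\<in>#M. z ^ i)))) \<le> e" by (simp only:)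
qed

lemma set_integral_continuous_cbox:
  fixes f :: "'a :: euclidean_space \<Rightarrow> complex"
  assumes "continuous_on (cbox a b) f"
  shows "(LINT t:cbox a b|lebesgue. f t) = integral (cbox a b) f"
  by (rule set_lebesgue_integral_eq_integral(2)[OF absolutely_integrable_continuous[OF assms]])

text \<open>Continuity of the sums over the multisets lets the Lebesgue integral be replaced by the
  gauge integral, for which linearity and the norm bound are used.\<close>

lemma real_mean_integral:
  fixes M :: "'a :: euclidean_space \<Rightarrow> complex multiset"
  assumes M: "\<And>t z. t \<in> cbox u v \<Longrightarrow> z \<in># M t \<Longrightarrow> z \<in> \<real> \<and> norm z \<le> C"
    and s: "\<And>t. t \<in> cbox u v \<Longrightarrow> size (M t) = s" "s > 0"
    and cont: "\<And>F :: complex \<Rightarrow> complex. continuous_on UNIV F \<Longrightarrow> continuous_on (cbox u v) (\<lambda>t. \<Sum>z\<in>#M t. F z)"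
    and pos: "measure lebesgue (cbox u v) > 0"
  shows "real_mean C (\<lambda>F. (1 / of_real (measure lebesgue (cbox u v))) *
     (LINT t:cbox u v|lebesgue. (1 / of_nat s) * (\<Sum>z\<in>#M t. F z)))"
  unfolding real_mean_def
proof (intro allI impI)
  fix F :: "complex \<Rightarrow> complex" and a m and e :: real
  assume F: "continuous_on UNIV F"
    and a: "\<forall>x. \<bar>x\<bar> \<le> C \<longrightarrow> norm (F (of_real x) - (\<Sum>i\<le>m. a i * of_real x ^ i)) \<le> e"
  let ?G = "cbox u v" and ?c = "1 / of_real (measure lebesgue (cbox u v)) :: complex"
  let ?f = "\<lambda>F t. (1 / of_nat s) * (\<Sum>z\<in>#M t. F z) :: complex"
  let ?p = "\<lambda>i z. z ^ i :: complex"
  have cf: "continuous_on ?G (?f F)"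
    by (rule continuous_on_mult_left[OF cont[OF F]])
  have cp: "continuous_on ?G (?f (?p i))" for i
    by (rule continuous_on_mult_left[OF cont]) (intro continuous_intros)
  note int = cf[THEN integrable_continuous] cp[THEN integrable_continuous]
  let ?D = "\<lambda>t. ?f F t - (\<Sum>i\<le>m. a i * ?f (?p i) t)"
  have D: "?D t = (1 / of_nat s) * ((\<Sum>z\<in>#M t. F z) - (\<Sum>i\<le>m. a i * (\<Sum>z\<in>#M t. z ^ i)))" for t
    by (simp only: right_diff_distrib sum_distrib_left mult.left_commute)
  have De: "norm (?D t) \<le> e" if t: "t \<in> ?G" for t
  proof -
    have "norm (?D t) = norm ((\<Sum>z\<in>#M t. F z) - (\<Sum>i\<le>m. a i * (\<Sum>z\<in>#M t. z ^ i))) / real s"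
      unfolding D norm_mult by (simp add: norm_divide)
    also have "\<dots> \<le> e"
      using norm_sum_mset_minus_polynomial_le[of "M t", OF M[OF t] a] s(1)[OF t] s(2)
      by (subst pos_divide_le_eq) (simp_all only: of_nat_0_less_iff mult.commute)
    finally show ?thesis .
  qed
  \<comment> \<open>\<open>real_mean\<close> puts no sign on the error, but the integral bound needs
    it nonnegative; any point of the box yields this.\<close>
  have "?G \<noteq> {}" using pos by auto
  then have e: "e \<ge> 0" using De by (meson ex_in_conv norm_ge_zero order_trans)
  have "integral ?G ?D = integral ?G (?f F) - (\<Sum>i\<le>m. a i * integral ?G (?f (?p i)))"
    using int
    by (simp only: Henstock_Kurzweil_Integration.integral_diff Henstock_Kurzweil_Integration.integral_sum integrable_sum
       integrable_on_mult_right Henstock_Kurzweil_Integration.integral_mult_right finite_atMost)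
  then have eq: "?c * (LINT t:?G|lebesgue. ?f F t) - (\<Sum>i\<le>m. a i * (?c * (LINT t:?G|lebesgue. ?f (?p i) t))) =
      ?c * integral ?G ?D"
    unfolding set_integral_continuous_cbox[OF cf] set_integral_continuous_cbox[OF cp]
    by (simp only: right_diff_distrib sum_distrib_left mult.left_commute)
  have "continuous_on ?G ?D" by (intro continuous_on_diff continuous_on_sum cf) (rule continuous_on_mult_left[OF cp])
  then have "norm (integral ?G ?D) \<le> e * measure lborel ?G"
    using De e by (intro has_integral_bound[OF _ integrable_integral] integrable_continuous) auto
  then have bd: "norm (integral ?G ?D) \<le> e * measure lebesgue ?G" by (simp only: measure_completion sets_lborel borel_closed closed_cbox)
  have nc: "norm ?c = 1 / measure lebesgue ?G" unfolding norm_divide norm_one norm_of_real using pos by (simp only: abs_of_pos)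
  have "1 / m * x \<le> e" if "x \<le> e * m" "m > 0" for m x :: real using that by (simp add: divide_le_eq)
  from this[OF bd pos] have "1 / measure lebesgue ?G * norm (integral ?G ?D) \<le> e" .
  then show "norm (?c * (LINT t:?G|lebesgue. ?f F t) - (\<Sum>i\<le>m. a i * (?c * (LINT t:?G|lebesgue. ?f (?p i) t)))) \<le> e"
    unfolding eq norm_mult nc .
qed

section \<open>Entries of the curl-div matrix\<close>

lemma gram_mats_carrier [simp]:
  "mass_mat p n \<in> carrier_mat (n + p - 2) (n + p - 2)"
  "advection_mat p n \<in> carrier_mat (n + p - 2) (n + p - 2)"
  "stiffness_mat p n \<in> carrier_mat (n + p - 2) (n + p - 2)"
  by (simp_all add: mass_mat_def advection_mat_def stiffness_mat_def)

lemma gram_mats_index: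
  assumes "i < n + p - 2" "j < n + p - 2"
  shows "mass_mat p n $$ (i, j) = gram_entry False False p n i j"
    "advection_mat p n $$ (i, j) = gram_entry False True p n i j"
    "stiffness_mat p n $$ (i, j) = gram_entry True True p n i j"
  using assms by (simp_all add: mass_mat_def advection_mat_def stiffness_mat_def gram_entry_def)

lemma kronecker_mat_carrier:
  "A \<in> carrier_mat m m \<Longrightarrow> B \<in> carrier_mat n n \<Longrightarrow> A \<otimes>\<^sub>K B \<in> carrier_mat (m * n) (m * n)"
  by (simp add: kronecker_mat_def)

lemma kronecker_mat_index:
  assumes A: "A \<in> carrier_mat m m" and B: "B \<in> carrier_mat n n"
    and "i < m" "k < m" "j < n" "l < n"
  shows "(A \<otimes>\<^sub>K B) $$ (i * n + j, k * n + l) = A $$ (i, k) * B $$ (j, l)"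
  using assms mult_add_less[of i m j n] mult_add_less[of k m l n]
  by (simp add: kronecker_mat_def)

lemma four_block_mat_index:
  assumes "P \<in> carrier_mat N N" "Q \<in> carrier_mat N N" "R \<in> carrier_mat N N" "S \<in> carrier_mat N N"
    and "x < N" "y < N" "a < 2" "b < 2"
  shows "four_block_mat P Q R S $$ (a * N + x, b * N + y) =
    (if a = 0 then if b = 0 then P else Q else if b = 0 then R else S) $$ (x, y)"
proof -
  have "a = 0 \<or> a = 1" "b = 0 \<or> b = 1" using assms(7,8) by auto
  then show ?thesis using assms(1-6) by (elim disjE) (auto simp: index_mat_four_block)
qed

lemma index_mat_combination:
  fixes P Q :: "'a :: semiring_1 mat"
  assumes "P \<in> carrier_mat m m" "Q \<in> carrier_mat m m" "x < m" "y < m"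
  shows "(a \<cdot>\<^sub>m P + b \<cdot>\<^sub>m Q) $$ (x, y) = a * P $$ (x, y) + b * Q $$ (x, y)"
  using assms by simp

text \<open>Transposed advection blocks appear as \<open>A\<close> with its two indices
  exchanged.\<close>

definition curl_div_entry ::
    "nat \<Rightarrow> real \<Rightarrow> real \<Rightarrow> nat \<Rightarrow> nat \<Rightarrow> nat \<Rightarrow> nat \<Rightarrow> nat \<Rightarrow> nat \<Rightarrow> nat \<Rightarrow> nat \<Rightarrow> real" where
  "curl_div_entry p \<alpha> \<beta> n1 n2 a b i k j l =
    (let M = gram_entry False False p; A = gram_entry False True p; S = gram_entry True True p
     in if a = 0 then
       if b = 0 then \<alpha> * (M n1 i k * S n2 j l) + \<beta> * (S n1 i k * M n2 j l)
       else \<alpha> * (- A n1 k i * A n2 j l) + \<beta> * (A n1 i k * A n2 l j)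
     else
       if b = 0 then \<alpha> * (- A n1 i k * A n2 l j) + \<beta> * (A n1 k i * A n2 j l)
       else \<alpha> * (S n1 i k * M n2 j l) + \<beta> * (M n1 i k * S n2 j l))"

lemma
  defines "N p n \<equiv> n + p - (2 :: nat)"
  shows curl_div_mat_carrier:
      "curl_div_mat p \<alpha> \<beta> n1 n2 \<in> carrier_mat (2 * N p n1 * N p n2) (2 * N p n1 * N p n2)" (is ?c)
    and curl_div_mat_index:
      "a < 2 \<Longrightarrow> b < 2 \<Longrightarrow> i < N p n1 \<Longrightarrow> k < N p n1 \<Longrightarrow> j < N p n2 \<Longrightarrow> l < N p n2 \<Longrightarrow>
       curl_div_mat p \<alpha> \<beta> n1 n2 $$ (block_index (N p n1) (N p n2) a i j, block_index (N p n1) (N p n2) b k l) =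
       curl_div_entry p \<alpha> \<beta> n1 n2 a b i k j l" (is "_ \<Longrightarrow> _ \<Longrightarrow> _ \<Longrightarrow> _ \<Longrightarrow> _ \<Longrightarrow> _ \<Longrightarrow> ?e")
proof -
  define N1 N2 where "N1 = N p n1" "N2 = N p n2"
  define M1 A1 S1 where "M1 = mass_mat p n1" "A1 = advection_mat p n1" "S1 = stiffness_mat p n1"
  define M2 A2 S2 where "M2 = mass_mat p n2" "A2 = advection_mat p n2" "S2 = stiffness_mat p n2"
  have c1: "M1 \<in> carrier_mat N1 N1" "A1 \<in> carrier_mat N1 N1" "S1 \<in> carrier_mat N1 N1"
    and c2: "M2 \<in> carrier_mat N2 N2" "A2 \<in> carrier_mat N2 N2" "S2 \<in> carrier_mat N2 N2"
    unfolding N1_N2_def N_def M1_A1_S1_def M2_A2_S2_def by simp_all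
  have t1: "transpose_mat A1 \<in> carrier_mat N1 N1" "- A1 \<in> carrier_mat N1 N1" "- transpose_mat A1 \<in> carrier_mat N1 N1"
    and t2: "transpose_mat A2 \<in> carrier_mat N2 N2" using c1 c2 by simp_all
  note k = kronecker_mat_carrier[OF c1(1) c2(3)] kronecker_mat_carrier[OF t1(3) c2(2)]
    kronecker_mat_carrier[OF t1(2) t2] kronecker_mat_carrier[OF c1(3) c2(1)]
    kronecker_mat_carrier[OF c1(2) t2] kronecker_mat_carrier[OF t1(1) c2(2)]
  let ?P = "four_block_mat (M1 \<otimes>\<^sub>K S2) (- (transpose_mat A1) \<otimes>\<^sub>K A2) (- A1 \<otimes>\<^sub>K transpose_mat A2) (S1 \<otimes>\<^sub>K M2)"
  let ?Q = "four_block_mat (S1 \<otimes>\<^sub>K M2) (A1 \<otimes>\<^sub>K transpose_mat A2) (transpose_mat A1 \<otimes>\<^sub>K A2) (M1 \<otimes>\<^sub>K S2)"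
  have PQ: "?P \<in> carrier_mat (N1 * N2 + N1 * N2) (N1 * N2 + N1 * N2)"
    "?Q \<in> carrier_mat (N1 * N2 + N1 * N2) (N1 * N2 + N1 * N2)"
    by (intro four_block_carrier_mat k)+
  have two: "2 * N1 * N2 = N1 * N2 + N1 * N2" by simp
  have eq: "curl_div_mat p \<alpha> \<beta> n1 n2 = \<alpha> \<cdot>\<^sub>m ?P + \<beta> \<cdot>\<^sub>m ?Q"
    unfolding curl_div_mat_def Let_def M1_A1_S1_def M2_A2_S2_def ..
  show ?c unfolding eq N1_N2_def[symmetric] two
    by (intro add_carrier_mat smult_carrier_mat PQ)
  show ?e if ab: "a < 2" "b < 2" and ij: "i < N p n1" "k < N p n1" "j < N p n2" "l < N p n2"
  proof -
    let ?x = "i * N2 + j" and ?y = "k * N2 + l"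
    note ij' = ij[folded N1_N2_def]
    have x: "?x < N1 * N2" "?y < N1 * N2" using ij' by (auto intro: mult_add_less)
    \<comment> \<open>The leading digit selects one of the four blocks, and the remaining two are
      the Kronecker index.\<close>
    have ix: "block_index N1 N2 a i j = a * (N1 * N2) + ?x" "block_index N1 N2 b k l = b * (N1 * N2) + ?y"
      by (simp_all add: block_index_def algebra_simps)
    have xN: "block_index N1 N2 a i j < N1 * N2 + N1 * N2" "block_index N1 N2 b k l < N1 * N2 + N1 * N2"
      using block_index_less[OF ab(1) ij'(1,3)] block_index_less[OF ab(2) ij'(2,4)] unfolding two by auto
    have "curl_div_mat p \<alpha> \<beta> n1 n2 $$ (block_index N1 N2 a i j, block_index N1 N2 b k l) =
       \<alpha> * ?P $$ (block_index N1 N2 a i j, block_index N1 N2 b k l) +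
       \<beta> * ?Q $$ (block_index N1 N2 a i j, block_index N1 N2 b k l)"
      unfolding eq by (rule index_mat_combination[OF PQ xN])
    also have "\<dots> = \<alpha> * (if a = 0 then if b = 0 then M1 \<otimes>\<^sub>K S2 else (- (transpose_mat A1) \<otimes>\<^sub>K A2)
          else if b = 0 then - A1 \<otimes>\<^sub>K transpose_mat A2 else S1 \<otimes>\<^sub>K M2) $$ (?x, ?y) +
        \<beta> * (if a = 0 then if b = 0 then S1 \<otimes>\<^sub>K M2 else A1 \<otimes>\<^sub>K transpose_mat A2
          else if b = 0 then transpose_mat A1 \<otimes>\<^sub>K A2 else M1 \<otimes>\<^sub>K S2) $$ (?x, ?y)"
      unfolding ix four_block_mat_index[OF k(1) k(2) k(3) k(4) x ab]
        four_block_mat_index[OF k(4) k(5) k(6) k(1) x ab] ..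
    also have "\<dots> = curl_div_entry p \<alpha> \<beta> n1 n2 a b i k j l"
    proof -
      have g1: "M1 $$ (i, k) = gram_entry False False p n1 i k" "A1 $$ (i, k) = gram_entry False True p n1 i k"
        "A1 $$ (k, i) = gram_entry False True p n1 k i" "S1 $$ (i, k) = gram_entry True True p n1 i k"
        using ij unfolding N_def M1_A1_S1_def by (simp_all add: gram_mats_index)
      have g2: "M2 $$ (j, l) = gram_entry False False p n2 j l" "A2 $$ (j, l) = gram_entry False True p n2 j l"
        "A2 $$ (l, j) = gram_entry False True p n2 l j" "S2 $$ (j, l) = gram_entry True True p n2 j l"
        using ij unfolding N_def M2_A2_S2_def by (simp_all add: gram_mats_index)
      have g3: "transpose_mat A1 $$ (i, k) = A1 $$ (k, i)" "transpose_mat A2 $$ (j, l) = A2 $$ (l, j)"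
        "(- A1) $$ (i, k) = - A1 $$ (i, k)" "(- transpose_mat A1) $$ (i, k) = - A1 $$ (k, i)"
        using c1 c2 ij' by simp_all
      note kk = kronecker_mat_index[OF c1(1) c2(3) ij'] kronecker_mat_index[OF t1(3) c2(2) ij']
        kronecker_mat_index[OF t1(2) t2 ij'] kronecker_mat_index[OF c1(3) c2(1) ij']
        kronecker_mat_index[OF c1(2) t2 ij'] kronecker_mat_index[OF t1(1) c2(2) ij']
      show ?thesis
        by (cases "a = 0"; cases "b = 0") (simp_all only: if_True if_False kk g3 g1 g2 curl_div_entry_def Let_def simp_thms)
    qed
    finally show ?thesis unfolding N1_N2_def .
  qed
qed

text \<open>Mass and stiffness integrals are symmetric, and transposing one off-diagonal Kronecker
  block gives the other. No interior assumption enters, so the eigenvalues are exactly real.\<close>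

lemma curl_div_entry_sym: "curl_div_entry p \<alpha> \<beta> n1 n2 b a k i l j = curl_div_entry p \<alpha> \<beta> n1 n2 a b i k j l"
proof -
  have s: "gram_entry d d p n x y = gram_entry d d p n y x" for d n x y
    by (simp add: gram_entry_def mult.commute)
  show ?thesis
    unfolding curl_div_entry_def Let_def s[of False n1 k i] s[of True n1 k i] s[of False n2 l j] s[of True n2 l j]
    by (cases "a = 0"; cases "b = 0") simp_all
qed

text \<open>\<phi> of degree 2p + 1 is symmetric about p + 1; there its value and second derivative
  are even and its first derivative is odd. All degrees down to 2p - 1 are positive, so reflection
  holds at every point.\<close>

lemma gram_symbol_parity:
  assumes "p \<ge> 1"
  shows "gram_symbol False False p (- s) = gram_symbol False False p s"
    "gram_symbol False True p (- s) = - gram_symbol False True p s"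
    "gram_symbol True True p (- s) = gram_symbol True True p s"
proof -
  have sym: "cardinal_bspline q t = cardinal_bspline q u" if "q \<ge> 1" "t = real q + 1 - u" for q t u
    using cardinal_bspline_symmetric[of q u] that by simp
  have "cardinal_bspline (2 * p + 1) (real p + 1 + s) = cardinal_bspline (2 * p + 1) (real p + 1 - s)"
    by (rule sym) auto
  then show "gram_symbol False False p (- s) = gram_symbol False False p s"
    by (simp add: gram_symbol_eq[OF assms])
  have "cardinal_bspline (2 * p) (real p + 1 + s) = cardinal_bspline (2 * p) (real p - s)"
    "cardinal_bspline (2 * p) (real p + s) = cardinal_bspline (2 * p) (real p + 1 - s)"
    using assms by (intro sym; simp)+
  then show "gram_symbol False True p (- s) = - gram_symbol False True p s"
    unfolding gram_symbol_eq[OF assms] deriv_cardinal_bspline_odd[OF assms] by (simp add: algebra_simps)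
  have "cardinal_bspline (2 * p - 1) (real p + 1 + s) = cardinal_bspline (2 * p - 1) (real p - 1 - s)"
    "cardinal_bspline (2 * p - 1) (real p + s) = cardinal_bspline (2 * p - 1) (real p - s)"
    "cardinal_bspline (2 * p - 1) (real p - 1 + s) = cardinal_bspline (2 * p - 1) (real p + 1 - s)"
    using assms by (intro sym; simp add: of_nat_diff)+
  then show "gram_symbol True True p (- s) = gram_symbol True True p s"
    unfolding gram_symbol_eq[OF assms] deriv2_cardinal_bspline_odd[OF assms] by (simp add: algebra_simps)
qed

text \<open>The off-diagonal sign is opposite to the one in the symbol: exchanging the indices of an
  odd coefficient contributes one minus sign here, and the product of two imaginary Fourier sums
  contributes another later.\<close>

definition curl_div_coeff ::
    "nat \<Rightarrow> real \<Rightarrow> real \<Rightarrow> real \<Rightarrow> real \<Rightarrow> nat \<Rightarrow> nat \<Rightarrow> real \<Rightarrow> real \<Rightarrow> real" where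
  "curl_div_coeff p \<alpha> \<beta> \<nu>1 \<nu>2 a b v w =
    (let M = gram_symbol False False p; A = gram_symbol False True p; S = gram_symbol True True p
     in if a = b then
       if a = 0 then \<alpha> * (\<nu>2 / \<nu>1) * (M v * S w) + \<beta> * (\<nu>1 / \<nu>2) * (S v * M w)
       else \<alpha> * (\<nu>1 / \<nu>2) * (S v * M w) + \<beta> * (\<nu>2 / \<nu>1) * (M v * S w)
     else (\<alpha> - \<beta>) * (A v * A w))"

lemma gram_scale_simps:
  "gram_scale False False n = 1 / real n" "n \<ge> 1 \<Longrightarrow> gram_scale False True n = 1"
  "n \<ge> 1 \<Longrightarrow> gram_scale True True n = real n"
  by (simp_all add: gram_scale_def)

text \<open>In the products of two Gram entries the scales combine to n2/n1, n1/n2 or 1. The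
  prescribed ratio makes these independent of the size, so one constant and one set of coefficients
  serve the whole sequence.\<close>

lemma curl_div_near_block_toeplitz:
  assumes p: "p \<ge> 1"
  shows "\<exists>K. \<forall>n1 n2. n1 \<ge> 1 \<longrightarrow> n2 \<ge> 1 \<longrightarrow> real n1 * \<nu>2 = real n2 * \<nu>1 \<longrightarrow> \<nu>1 > 0 \<longrightarrow> \<nu>2 > 0 \<longrightarrow>
    near_block_toeplitz 2 p K (\<lambda>a b v w. complex_of_real (curl_div_coeff p \<alpha> \<beta> \<nu>1 \<nu>2 a b (of_int v) (of_int w)))
      (n1 + p - 2) (n2 + p - 2) (map_mat complex_of_real (curl_div_mat p \<alpha> \<beta> n1 n2))"
proof -
  obtain C where C0: "C \<ge> 0" and C: "\<And>d e n i j. n \<ge> 1 \<Longrightarrow> \<bar>gram_entry d e p n i j\<bar> \<le> C * gram_scale d e n"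
    and band: "\<And>d e n i j. n \<ge> 1 \<Longrightarrow> \<not> (i \<le> j + p \<and> j \<le> i + p) \<Longrightarrow> gram_entry d e p n i j = 0"
    using gram_entry_bounds[of p] by metis
  let ?r = "\<nu>2 / \<nu>1" and ?s = "\<nu>1 / \<nu>2"
  \<comment> \<open>Every entry is \<alpha> x + \<beta> y with products x, y of two Gram entries,
    and the last factor dominates all three possible products of scales.\<close>
  let ?K = "(\<bar>\<alpha>\<bar> + \<bar>\<beta>\<bar>) * (C * C * (1 + \<bar>?r\<bar> + \<bar>?s\<bar>))"
  have "near_block_toeplitz 2 p ?K (\<lambda>a b v w. complex_of_real (curl_div_coeff p \<alpha> \<beta> \<nu>1 \<nu>2 a b (of_int v) (of_int w)))
      (n1 + p - 2) (n2 + p - 2) (map_mat complex_of_real (curl_div_mat p \<alpha> \<beta> n1 n2))"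
    if n: "n1 \<ge> 1" "n2 \<ge> 1" and ratio: "real n1 * \<nu>2 = real n2 * \<nu>1" and \<nu>: "\<nu>1 > 0" "\<nu>2 > 0" for n1 n2
  proof -
    define N1 N2 where "N1 = n1 + p - 2" "N2 = n2 + p - 2"
    note car = curl_div_mat_carrier[of p \<alpha> \<beta> n1 n2, folded N1_N2_def]
    have r: "real n2 / real n1 = ?r" "real n1 / real n2 = ?s"
      using ratio n \<nu> by (simp_all add: field_simps)
    have idx: "map_mat complex_of_real (curl_div_mat p \<alpha> \<beta> n1 n2) $$ (block_index N1 N2 a i j, block_index N1 N2 b k l) =
        complex_of_real (curl_div_entry p \<alpha> \<beta> n1 n2 a b i k j l)"
      if "a < 2" "b < 2" "i < N1" "k < N1" "j < N2" "l < N2" for a b i k j l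
      using car block_index_less[OF that(1,3,5)] block_index_less[OF that(2,4,6)]
        curl_div_mat_index[of a b i n1 p k j n2 l \<alpha> \<beta>, folded N1_N2_def, OF that]
      by (subst index_map_mat) auto
    show ?thesis unfolding N1_N2_def[symmetric]
    proof (unfold_locales, goal_cases)
      case 1
      show ?case using car by simp
    next
      case 2
      show ?case using C0 by (intro mult_nonneg_nonneg add_nonneg_nonneg) auto
    next
      case (3 a b i k j l)
      have prod: "\<bar>x * y\<bar> \<le> C * C * (1 + \<bar>?r\<bar> + \<bar>?s\<bar>)"
        if "\<bar>x\<bar> \<le> C * u" "\<bar>y\<bar> \<le> C * v" "u * v \<le> 1 + \<bar>?r\<bar> + \<bar>?s\<bar>" for x y u v
      proof -
        have "\<bar>x * y\<bar> \<le> (C * u) * (C * v)"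
          unfolding abs_mult using that(1,2) by (intro mult_mono) (auto intro: order_trans[OF abs_ge_zero])
        also have "\<dots> = C * C * (u * v)" by (simp add: algebra_simps)
        also have "\<dots> \<le> C * C * (1 + \<bar>?r\<bar> + \<bar>?s\<bar>)" using that(3) C0 by (intro mult_left_mono) auto
        finally show ?thesis .
      qed
      have two: "\<bar>\<alpha> * x + \<beta> * y\<bar> \<le> ?K"
        if "\<bar>x\<bar> \<le> C * C * (1 + \<bar>?r\<bar> + \<bar>?s\<bar>)" "\<bar>y\<bar> \<le> C * C * (1 + \<bar>?r\<bar> + \<bar>?s\<bar>)" for x y
      proof -
        have "\<bar>\<alpha> * x\<bar> \<le> \<bar>\<alpha>\<bar> * (C * C * (1 + \<bar>?r\<bar> + \<bar>?s\<bar>))" "\<bar>\<beta> * y\<bar> \<le> \<bar>\<beta>\<bar> * (C * C * (1 + \<bar>?r\<bar> + \<bar>?s\<bar>))"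
          unfolding abs_mult using that by (intro mult_left_mono; simp)+
        then show ?thesis unfolding distrib_right by linarith
      qed
      have sc: "gram_scale False False n1 * gram_scale True True n2 \<le> 1 + \<bar>?r\<bar> + \<bar>?s\<bar>"
        "gram_scale True True n1 * gram_scale False False n2 \<le> 1 + \<bar>?r\<bar> + \<bar>?s\<bar>"
        "gram_scale False True n1 * gram_scale False True n2 \<le> 1 + \<bar>?r\<bar> + \<bar>?s\<bar>"
      proof -
        have "gram_scale False False n1 * gram_scale True True n2 = ?r"
          "gram_scale True True n1 * gram_scale False False n2 = ?s"
          "gram_scale False True n1 * gram_scale False True n2 = 1"
          using r n by (simp_all add: gram_scale_simps)
        moreover have "?r \<le> \<bar>?r\<bar>" "?s \<le> \<bar>?s\<bar>" "0 \<le> \<bar>?r\<bar>" "0 \<le> \<bar>?s\<bar>" by (simp_all only: abs_ge_self abs_ge_zero)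
        ultimately show "gram_scale False False n1 * gram_scale True True n2 \<le> 1 + \<bar>?r\<bar> + \<bar>?s\<bar>"
          "gram_scale True True n1 * gram_scale False False n2 \<le> 1 + \<bar>?r\<bar> + \<bar>?s\<bar>"
          "gram_scale False True n1 * gram_scale False True n2 \<le> 1 + \<bar>?r\<bar> + \<bar>?s\<bar>"
          by linarith+
      qed
      have neg: "\<bar>- gram_entry False True p n x y\<bar> \<le> C * gram_scale False True n" if "n \<ge> 1" for n x y
        using C[OF that, of False True] by simp
      note bd = prod[OF C[OF n(1)] C[OF n(2)] sc(1)] prod[OF C[OF n(1)] C[OF n(2)] sc(2)]
        prod[OF C[OF n(1)] C[OF n(2)] sc(3)] prod[OF neg[OF n(1)] C[OF n(2)] sc(3)]
      have "\<bar>curl_div_entry p \<alpha> \<beta> n1 n2 a b i k j l\<bar> \<le> ?K"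
        unfolding curl_div_entry_def Let_def
        by (cases "a = 0"; cases "b = 0"; simp only: if_True if_False simp_thms; intro two bd)
      then show ?case unfolding idx[OF 3] norm_of_real .
    next
      case (4 a b i k j l)
      then have "\<not> (i \<le> k + p \<and> k \<le> i + p) \<or> \<not> (j \<le> l + p \<and> l \<le> j + p)" by linarith
      \<comment> \<open>Both orders of the indices are needed because of the transposed
        blocks.\<close>
      then have z: "gram_entry d e p n1 i k = 0 \<and> gram_entry d e p n1 k i = 0 \<or>
          gram_entry d' e' p n2 j l = 0 \<and> gram_entry d' e' p n2 l j = 0" for d e d' e'
        using band[OF n(1)] band[OF n(2)] by blast
      have "curl_div_entry p \<alpha> \<beta> n1 n2 a b i k j l = 0"
        using z[of False False True True] z[of True True False False] z[of False True False True]
        unfolding curl_div_entry_def Let_def by auto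
      then show ?case unfolding idx[OF 4(1-6)] by simp
    next
      case (5 a b i k j l)
      \<comment> \<open>The margin 2p less the band width p leaves i \<ge> p and i + p < n1 + p - 2,
        which is inside the range where Gram entries are Toeplitz; likewise in the other
        direction.\<close>
      have N: "int N1 = int n1 + int p - 2" "int N2 = int n2 + int p - 2" using n p by (auto simp: N1_N2_def)
      have ik: "p \<le> i + 1" "i + 2 \<le> n1" "p \<le> k + 1" "k + 2 \<le> n1"
        and jl: "p \<le> j + 1" "j + 2 \<le> n2" "p \<le> l + 1" "l + 2 \<le> n2"
        using 5(7-) N by linarith+
      let ?v = "real i - real k" and ?w = "real j - real l"
      note par = gram_symbol_parity(2)[OF p, of ?v] gram_symbol_parity(2)[OF p, of ?w]
      note g1 = gram_entry_interior[OF n(1) p ik] gram_entry_interior[OF n(1) p ik(3,4) ik(1,2)]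
      note g2 = gram_entry_interior[OF n(2) p jl] gram_entry_interior[OF n(2) p jl(3,4) jl(1,2)]
      have e1: "gram_entry False False p n1 i k = gram_symbol False False p ?v / real n1"
        "gram_entry False True p n1 i k = gram_symbol False True p ?v"
        "gram_entry False True p n1 k i = - gram_symbol False True p ?v"
        "gram_entry True True p n1 i k = real n1 * gram_symbol True True p ?v"
        using g1(1)[of False False] g1(1)[of False True] g1(2)[of False True] g1(1)[of True True] n par(1)
        by (simp_all add: gram_scale_simps)
      have e2: "gram_entry False False p n2 j l = gram_symbol False False p ?w / real n2"
        "gram_entry False True p n2 j l = gram_symbol False True p ?w"
        "gram_entry False True p n2 l j = - gram_symbol False True p ?w"
        "gram_entry True True p n2 j l = real n2 * gram_symbol True True p ?w"
        using g2(1)[of False False] g2(1)[of False True] g2(2)[of False True] g2(1)[of True True] n par(2)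
        by (simp_all add: gram_scale_simps)
      define mv av sv mw aw sw where defs: "mv = gram_symbol False False p ?v" "av = gram_symbol False True p ?v"
        "sv = gram_symbol True True p ?v" "mw = gram_symbol False False p ?w" "aw = gram_symbol False True p ?w"
        "sw = gram_symbol True True p ?w"
      have s: "mv / real n1 * (real n2 * sw) = ?r * (mv * sw)" "real n1 * sv * (mw / real n2) = ?s * (sv * mw)"
        unfolding r[symmetric] by simp_all
      have ab: "a = 0 \<or> a = 1" "b = 0 \<or> b = 1" using 5(1,2) by auto
      have iv: "real_of_int (int i - int k) = ?v" "real_of_int (int j - int l) = ?w" by simp_all
      have "curl_div_entry p \<alpha> \<beta> n1 n2 a b i k j l = curl_div_coeff p \<alpha> \<beta> \<nu>1 \<nu>2 a b ?v ?w"
        unfolding curl_div_entry_def curl_div_coeff_def Let_def e1 e2 defs[symmetric] s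
        using ab by (elim disjE) (simp_all add: algebra_simps)
      then show ?case unfolding idx[OF 5(1-6)] iv by (rule arg_cong)
    qed
  qed
  then show ?thesis by blast
qed

section \<open>The symbol\<close>

lemma sum_int_symmetric:
  fixes g :: "int \<Rightarrow> 'a :: comm_monoid_add"
  shows "(\<Sum>v\<in>{- int p..int p}. g v) = g 0 + (\<Sum>k=1..p. g (int k) + g (- int k))"
proof (induction p)
  case (Suc p)
  have "{- int (Suc p)..int (Suc p)} = insert (int (Suc p)) (insert (- int (Suc p)) {- int p..int p})" by auto
  then have "(\<Sum>v\<in>{- int (Suc p)..int (Suc p)}. g v) = g (int (Suc p)) + (g (- int (Suc p)) + (\<Sum>v\<in>{- int p..int p}. g v))"
    by simp
  then show ?case unfolding Suc.IH by (simp add: add_ac)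
qed simp

text \<open>Opposite frequencies are paired: even coefficients give cosines, odd ones give sines
  with a factor \<open>\<i>\<close>.\<close>

lemma symbol_fourier_sums:
  assumes p: "p \<ge> 1"
  shows "(\<Sum>v\<in>{- int p..int p}. of_real (gram_symbol False False p (of_int v)) * cis (of_int v * t)) =
      of_real (mass_symbol p t)"
    and "(\<Sum>v\<in>{- int p..int p}. of_real (gram_symbol False True p (of_int v)) * cis (of_int v * t)) =
      \<i> * of_real (advection_symbol p t)"
    and "(\<Sum>v\<in>{- int p..int p}. of_real (gram_symbol True True p (of_int v)) * cis (of_int v * t)) =
      of_real (stiffness_symbol p t)"
proof -
  note par = gram_symbol_parity[OF p]
  have neg: "real_of_int (- int k) = - real k" "real_of_int (int k) = real k" for k by simp_all
  have pos: "cis (real k * t) + cis (- real k * t) = of_real (2 * cos (real k * t))"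
    "cis (real k * t) - cis (- real k * t) = \<i> * of_real (2 * sin (real k * t))" for k
    by (simp_all add: complex_eq_iff)
  have even: "of_real x * cis (real k * t) + of_real x * cis (- real k * t) = of_real (2 * (x * cos (real k * t)))" for x k
    unfolding distrib_left[symmetric] pos by simp
  have odd: "of_real x * cis (real k * t) + of_real (- x) * cis (- real k * t) = \<i> * of_real (2 * (x * sin (real k * t)))" for x k
    using pos(2)[of k] by (simp add: algebra_simps flip: right_diff_distrib)
  have odd0: "gram_symbol False True p 0 = 0" using par(2)[of 0] by simp
  show "(\<Sum>v\<in>{- int p..int p}. of_real (gram_symbol False False p (of_int v)) * cis (of_int v * t)) =
      of_real (mass_symbol p t)"
    unfolding sum_int_symmetric neg par even mass_symbol_def
    by (simp add: gram_symbol_eq[OF p] sum_distrib_left)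
  show "(\<Sum>v\<in>{- int p..int p}. of_real (gram_symbol False True p (of_int v)) * cis (of_int v * t)) =
      \<i> * of_real (advection_symbol p t)"
    unfolding sum_int_symmetric neg par odd of_int_0 odd0 advection_symbol_def
    by (simp add: gram_symbol_eq[OF p] sum_distrib_left sum_negf)
  show "(\<Sum>v\<in>{- int p..int p}. of_real (gram_symbol True True p (of_int v)) * cis (of_int v * t)) =
      of_real (stiffness_symbol p t)"
    unfolding sum_int_symmetric neg par even stiffness_symbol_def
    by (simp add: gram_symbol_eq[OF p] sum_distrib_left sum_negf del: funpow.simps)
qed

lemma double_sum_product:
  fixes X Y :: "int \<Rightarrow> complex"
  shows "(\<Sum>v\<in>B. \<Sum>w\<in>B. (c * (X v * Y w)) * (e v * f w)) = c * ((\<Sum>v\<in>B. X v * e v) * (\<Sum>w\<in>B. Y w * f w))"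
  unfolding sum_product unfolding sum_distrib_left by (simp only: mult_ac)

abbreviation curl_div_fourier :: "nat \<Rightarrow> real \<Rightarrow> real \<Rightarrow> real \<Rightarrow> real \<Rightarrow> nat \<Rightarrow> nat \<Rightarrow> int \<Rightarrow> int \<Rightarrow> complex" where
  "curl_div_fourier p \<alpha> \<beta> \<nu>1 \<nu>2 a b v w \<equiv> complex_of_real (curl_div_coeff p \<alpha> \<beta> \<nu>1 \<nu>2 a b (of_int v) (of_int w))"

lemma curl_div_symbol_index:
  "curl_div_symbol p \<alpha> \<beta> \<nu>1 \<nu>2 \<theta> \<in> carrier_mat 2 2"
  "curl_div_symbol p \<alpha> \<beta> \<nu>1 \<nu>2 \<theta> $$ (0, 0) = of_real (\<alpha> * (\<nu>2 / \<nu>1) * mass_symbol p (fst \<theta>) * stiffness_symbol p (snd \<theta>)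
     + \<beta> * (\<nu>1 / \<nu>2) * stiffness_symbol p (fst \<theta>) * mass_symbol p (snd \<theta>))"
  "curl_div_symbol p \<alpha> \<beta> \<nu>1 \<nu>2 \<theta> $$ (0, Suc 0) = of_real (- (\<alpha> - \<beta>) * advection_symbol p (fst \<theta>) * advection_symbol p (snd \<theta>))"
  "curl_div_symbol p \<alpha> \<beta> \<nu>1 \<nu>2 \<theta> $$ (Suc 0, 0) = of_real (- (\<alpha> - \<beta>) * advection_symbol p (fst \<theta>) * advection_symbol p (snd \<theta>))"
  "curl_div_symbol p \<alpha> \<beta> \<nu>1 \<nu>2 \<theta> $$ (Suc 0, Suc 0) = of_real (\<alpha> * (\<nu>1 / \<nu>2) * stiffness_symbol p (fst \<theta>) * mass_symbol p (snd \<theta>)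
     + \<beta> * (\<nu>2 / \<nu>1) * mass_symbol p (fst \<theta>) * stiffness_symbol p (snd \<theta>))"
  by (auto simp: curl_div_symbol_def Let_def mat_of_rows_list_def split: prod.split)

lemma trig_symbol_curl_div:
  assumes p: "p \<ge> 1" and ab: "a < 2" "b < 2"
  shows "trig_symbol p (curl_div_fourier p \<alpha> \<beta> \<nu>1 \<nu>2) a b \<theta> = curl_div_symbol p \<alpha> \<beta> \<nu>1 \<nu>2 \<theta> $$ (a, b)"
proof -
  let ?B = "{- int p..int p}"
  let ?e = "\<lambda>v. cis (real_of_int v * fst \<theta>)" and ?f = "\<lambda>v. cis (real_of_int v * snd \<theta>)"
  let ?M = "\<lambda>v. complex_of_real (gram_symbol False False p (real_of_int v))"
  let ?A = "\<lambda>v. complex_of_real (gram_symbol False True p (real_of_int v))"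
  let ?S = "\<lambda>v. complex_of_real (gram_symbol True True p (real_of_int v))"
  note four = symbol_fourier_sums[OF p]
  have diag: "(\<Sum>v\<in>?B. \<Sum>w\<in>?B. complex_of_real (x * (gram_symbol False False p (of_int v) * gram_symbol True True p (of_int w)) +
        y * (gram_symbol True True p (of_int v) * gram_symbol False False p (of_int w))) * (?e v * ?f w)) =
      of_real (x * mass_symbol p (fst \<theta>) * stiffness_symbol p (snd \<theta>) + y * stiffness_symbol p (fst \<theta>) * mass_symbol p (snd \<theta>))" for x y
  proof -
    have "(\<Sum>v\<in>?B. \<Sum>w\<in>?B. complex_of_real (x * (gram_symbol False False p (of_int v) * gram_symbol True True p (of_int w)) +
        y * (gram_symbol True True p (of_int v) * gram_symbol False False p (of_int w))) * (?e v * ?f w)) =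
       (\<Sum>v\<in>?B. \<Sum>w\<in>?B. (of_real x * (?M v * ?S w)) * (?e v * ?f w)) + (\<Sum>v\<in>?B. \<Sum>w\<in>?B. (of_real y * (?S v * ?M w)) * (?e v * ?f w))"
      unfolding sum.distrib[symmetric] distrib_right[symmetric] by (simp only: of_real_add of_real_mult)
    also have "\<dots> = of_real x * (of_real (mass_symbol p (fst \<theta>)) * of_real (stiffness_symbol p (snd \<theta>))) +
        of_real y * (of_real (stiffness_symbol p (fst \<theta>)) * of_real (mass_symbol p (snd \<theta>)))"
      unfolding double_sum_product four ..
    finally show ?thesis by (simp only: of_real_add of_real_mult mult.assoc)
  qed
  have diag': "(\<Sum>v\<in>?B. \<Sum>w\<in>?B. complex_of_real (y * (gram_symbol True True p (of_int v) * gram_symbol False False p (of_int w)) +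
        x * (gram_symbol False False p (of_int v) * gram_symbol True True p (of_int w))) * (?e v * ?f w)) =
      of_real (y * stiffness_symbol p (fst \<theta>) * mass_symbol p (snd \<theta>) + x * mass_symbol p (fst \<theta>) * stiffness_symbol p (snd \<theta>))" for x y
    using diag[of x y] by (simp only: add.commute)
  have off: "(\<Sum>v\<in>?B. \<Sum>w\<in>?B. complex_of_real ((\<alpha> - \<beta>) * (gram_symbol False True p (of_int v) * gram_symbol False True p (of_int w))) * (?e v * ?f w)) =
      of_real (- (\<alpha> - \<beta>) * advection_symbol p (fst \<theta>) * advection_symbol p (snd \<theta>))"
  proof -
    have "(\<Sum>v\<in>?B. \<Sum>w\<in>?B. complex_of_real ((\<alpha> - \<beta>) * (gram_symbol False True p (of_int v) * gram_symbol False True p (of_int w))) * (?e v * ?f w)) =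
       (\<Sum>v\<in>?B. \<Sum>w\<in>?B. (of_real (\<alpha> - \<beta>) * (?A v * ?A w)) * (?e v * ?f w))"
      by (simp only: of_real_mult)
    \<comment> \<open>The two imaginary units multiply to the minus sign of the off-diagonal
      entry.\<close>
    also have "\<dots> = of_real (\<alpha> - \<beta>) * ((\<i> * of_real (advection_symbol p (fst \<theta>))) * (\<i> * of_real (advection_symbol p (snd \<theta>))))"
      unfolding double_sum_product four ..
    also have "\<dots> = of_real (- (\<alpha> - \<beta>) * advection_symbol p (fst \<theta>) * advection_symbol p (snd \<theta>))"
      by (simp add: algebra_simps)
    finally show ?thesis .
  qed
  have "a = 0 \<or> a = 1" "b = 0 \<or> b = 1" using ab by auto
  then show ?thesis
    unfolding trig_symbol_def character_def curl_div_coeff_def Let_def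
  proof (elim disjE, goal_cases)
    case 1
    then show ?case by (simp only: simp_thms if_True diag curl_div_symbol_index)
  next
    case 2
    then show ?case by (simp only: zero_neq_one one_neq_zero if_False off curl_div_symbol_index One_nat_def nat.distinct)
  next
    case 3
    then show ?case by (simp only: zero_neq_one one_neq_zero if_False off curl_div_symbol_index One_nat_def nat.distinct)
  next
    case 4
    then show ?case by (simp only: simp_thms if_True if_False one_neq_zero diag' curl_div_symbol_index One_nat_def nat.distinct)
  qed
qed

lemma pow_curl_div_symbol:
  assumes p: "p \<ge> 1" and ab: "a < 2" "b < 2"
  shows "(curl_div_symbol p \<alpha> \<beta> \<nu>1 \<nu>2 \<theta> ^\<^sub>m k) $$ (a, b) = power_symbol 2 p (curl_div_fourier p \<alpha> \<beta> \<nu>1 \<nu>2) k a b \<theta>"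
  using ab
proof (induction k arbitrary: b)
  case 0
  then show ?case using curl_div_symbol_index(1)[of p \<alpha> \<beta> \<nu>1 \<nu>2 \<theta>] by simp
next
  case (Suc k)
  let ?f = "curl_div_symbol p \<alpha> \<beta> \<nu>1 \<nu>2 \<theta>"
  have c: "?f \<in> carrier_mat 2 2" "?f ^\<^sub>m k \<in> carrier_mat 2 2" using curl_div_symbol_index(1) by simp_all
  then have "(?f ^\<^sub>m Suc k) $$ (a, b) = (\<Sum>d<2. (?f ^\<^sub>m k) $$ (a, d) * ?f $$ (d, b))"
    using Suc.prems by (simp add: scalar_prod_def lessThan_atLeast0)
  also have "\<dots> = (\<Sum>d<2. power_symbol 2 p (curl_div_fourier p \<alpha> \<beta> \<nu>1 \<nu>2) k a d \<theta> *
      trig_symbol p (curl_div_fourier p \<alpha> \<beta> \<nu>1 \<nu>2) d b \<theta>)"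
    by (rule sum.cong[OF refl]) (simp only: Suc.IH[OF Suc.prems(1)] trig_symbol_curl_div[OF p _ Suc.prems(2)] lessThan_iff)
  finally show ?case by (simp only: power_symbol.simps)
qed

text \<open>The two eigenvalues are recovered from the traces of \<open>A\<close> and \<open>A\<^sup>2\<close>.\<close>
lemma eigenvalue_mset_symmetric_2x2:
  fixes a b d :: real
  assumes A: "A \<in> carrier_mat 2 2"
    and e: "A $$ (0, 0) = of_real a" "A $$ (0, Suc 0) = of_real b" "A $$ (Suc 0, 0) = of_real b" "A $$ (Suc 0, Suc 0) = of_real d"
  defines "r \<equiv> sqrt ((a - d)\<^sup>2 + 4 * b\<^sup>2)"
  shows "eigenvalue_mset A = {#of_real ((a + d + r) / 2), of_real ((a + d - r) / 2)#}"
proof -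
  obtain x M where M: "eigenvalue_mset A = add_mset x M"
    using size_eq_Suc_imp_eq_union[of "eigenvalue_mset A" "Suc 0"] size_eigenvalue_mset[OF A] by auto
  then have "size M = 1" using size_eigenvalue_mset[OF A] by simp
  then obtain y where xy: "eigenvalue_mset A = {#x, y#}" using M size_1_singleton_mset by blast
  define S T where "S = complex_of_real ((a + d + r) / 2)" "T = complex_of_real ((a + d - r) / 2)"
  have sum: "x + y = of_real a + of_real d"
    using sum_eigenvalue_mset_power[OF A, of 1] A by (simp add: xy e numeral_2_eq_2)
  have sum2: "x\<^sup>2 + y\<^sup>2 = (of_real a)\<^sup>2 + (of_real d)\<^sup>2 + 2 * (of_real b)\<^sup>2"
    using sum_eigenvalue_mset_power[OF A, of 2] A
    by (simp add: xy e numeral_2_eq_2 scalar_prod_def algebra_simps power2_eq_square)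
  have r2: "r\<^sup>2 = (a - d)\<^sup>2 + 4 * b\<^sup>2" unfolding r_def by simp
  have st: "S + T = of_real a + of_real d" "4 * (S * T) = of_real ((a + d)\<^sup>2 - ((a - d)\<^sup>2 + 4 * b\<^sup>2))"
  proof -
    have "(a + d + r) / 2 + (a + d - r) / 2 = a + d" by (simp add: field_simps)
    then show "S + T = of_real a + of_real d" unfolding S_T_def of_real_add[symmetric] by (rule arg_cong)
    have "4 * ((a + d + r) / 2 * ((a + d - r) / 2)) = (a + d)\<^sup>2 - r\<^sup>2" by (simp add: field_simps power2_eq_square)
    then have "4 * ((a + d + r) / 2 * ((a + d - r) / 2)) = (a + d)\<^sup>2 - ((a - d)\<^sup>2 + 4 * b\<^sup>2)"
      unfolding r2 .
    then have "complex_of_real (4 * ((a + d + r) / 2 * ((a + d - r) / 2))) = of_real ((a + d)\<^sup>2 - ((a - d)\<^sup>2 + 4 * b\<^sup>2))"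
      by (rule arg_cong)
    then show "4 * (S * T) = of_real ((a + d)\<^sup>2 - ((a - d)\<^sup>2 + 4 * b\<^sup>2))"
      unfolding S_T_def by (simp only: of_real_mult of_real_numeral)
  qed
  have "2 * (x * y) = (x + y)\<^sup>2 - (x\<^sup>2 + y\<^sup>2)" by (simp add: power2_eq_square algebra_simps)
  then have "2 * (2 * (x * y)) = 2 * ((of_real a + of_real d)\<^sup>2 - ((of_real a)\<^sup>2 + (of_real d)\<^sup>2 + 2 * (of_real b)\<^sup>2))"
    unfolding sum sum2 by (rule arg_cong)
  then have "4 * (x * y) = 4 * (S * T)"
    unfolding st(2) by (simp add: power2_eq_square algebra_simps)
  then have prod: "x * y = S * T" by simp
  have "(x - S) * (x - T) = x * x - (S + T) * x + S * T" by (simp add: algebra_simps)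
  also have "\<dots> = 0" unfolding st(1) sum[symmetric] prod[symmetric] by (simp add: algebra_simps)
  finally have "x = S \<or> x = T" by simp
  then have "{#x, y#} = {#S, T#}"
  proof
    assume "x = S"
    then have "y = T" using sum st(1) by (metis add_left_cancel)
    then show ?thesis using \<open>x = S\<close> by simp
  next
    assume "x = T"
    then have "y = S" using sum st(1) by (metis add.commute add_left_cancel)
    then show ?thesis using \<open>x = T\<close> by simp
  qed
  then show ?thesis unfolding xy S_T_def .
qed

lemma continuous_on_symbols:
  "continuous_on X (mass_symbol p)" "continuous_on X (advection_symbol p)" "continuous_on X (stiffness_symbol p)"
  unfolding mass_symbol_def advection_symbol_def stiffness_symbol_def by (intro continuous_intros)+

lemma continuous_on_symbols_pair [continuous_intros]:
  "continuous_on X (\<lambda>\<theta>. mass_symbol p (fst \<theta>))" "continuous_on X (\<lambda>\<theta>. mass_symbol p (snd \<theta>))"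
  "continuous_on X (\<lambda>\<theta>. advection_symbol p (fst \<theta>))" "continuous_on X (\<lambda>\<theta>. advection_symbol p (snd \<theta>))"
  "continuous_on X (\<lambda>\<theta>. stiffness_symbol p (fst \<theta>))" "continuous_on X (\<lambda>\<theta>. stiffness_symbol p (snd \<theta>))"
  by (rule continuous_on_compose2[OF continuous_on_symbols(1)[of UNIV]]
      continuous_on_compose2[OF continuous_on_symbols(2)[of UNIV]]
      continuous_on_compose2[OF continuous_on_symbols(3)[of UNIV]],
      intro continuous_intros, simp)+

text \<open>The larger and the smaller root of the quadratic formula are continuous on the whole
  plane, also where the eigenvalues coincide. So means over the spectrum of the symbol are integrals
  of continuous functions.\<close>

lemma curl_div_symbol_eigenvalues:
  obtains g h :: "real \<times> real \<Rightarrow> real" where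
    "continuous_on UNIV g" "continuous_on UNIV h"
    "\<And>\<theta>. eigenvalue_mset (curl_div_symbol p \<alpha> \<beta> \<nu>1 \<nu>2 \<theta>) = {#of_real (g \<theta>), of_real (h \<theta>)#}"
proof -
  define a where "a \<theta> = \<alpha> * (\<nu>2 / \<nu>1) * mass_symbol p (fst \<theta>) * stiffness_symbol p (snd \<theta>)
     + \<beta> * (\<nu>1 / \<nu>2) * stiffness_symbol p (fst \<theta>) * mass_symbol p (snd \<theta>)" for \<theta>
  define b where "b \<theta> = - (\<alpha> - \<beta>) * advection_symbol p (fst \<theta>) * advection_symbol p (snd \<theta>)" for \<theta>
  define d where "d \<theta> = \<alpha> * (\<nu>1 / \<nu>2) * stiffness_symbol p (fst \<theta>) * mass_symbol p (snd \<theta>)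
     + \<beta> * (\<nu>2 / \<nu>1) * mass_symbol p (fst \<theta>) * stiffness_symbol p (snd \<theta>)" for \<theta>
  have c: "continuous_on UNIV a" "continuous_on UNIV b" "continuous_on UNIV d"
    unfolding a_def b_def d_def by (intro continuous_intros)+
  have ev: "eigenvalue_mset (curl_div_symbol p \<alpha> \<beta> \<nu>1 \<nu>2 \<theta>) =
    {#of_real ((a \<theta> + d \<theta> + sqrt ((a \<theta> - d \<theta>)\<^sup>2 + 4 * (b \<theta>)\<^sup>2)) / 2),
      of_real ((a \<theta> + d \<theta> - sqrt ((a \<theta> - d \<theta>)\<^sup>2 + 4 * (b \<theta>)\<^sup>2)) / 2)#}" for \<theta>
    by (rule eigenvalue_mset_symmetric_2x2; simp only: curl_div_symbol_index a_def b_def d_def)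
  show ?thesis
    by (rule that[OF _ _ ev]) (intro continuous_intros c; simp)+
qed

section \<open>Spectral distribution\<close>

lemma block_index_surj:
  assumes "x < s * N1 * N2"
  obtains a i j where "a < s" "i < N1" "j < N2" "x = block_index N1 N2 a i j"
proof
  have N2: "0 < N2" and N1: "0 < N1" using assms by (auto intro: Nat.gr0I)
  show "x mod N2 < N2" "x div N2 mod N1 < N1" using N1 N2 by simp_all
  show "x div N2 div N1 < s"
    using assms N1 N2 by (simp add: less_mult_imp_div_less)
  show "x = block_index N1 N2 (x div N2 div N1) (x div N2 mod N1) (x mod N2)"
    by (simp add: block_index_def)
qed

lemma curl_div_mat_sym:
  defines "N p n \<equiv> n + p - (2 :: nat)"
  assumes "x < 2 * N p n1 * N p n2" "y < 2 * N p n1 * N p n2"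
  shows "curl_div_mat p \<alpha> \<beta> n1 n2 $$ (y, x) = curl_div_mat p \<alpha> \<beta> n1 n2 $$ (x, y)"
proof -
  obtain a i j where a: "a < 2" "i < N p n1" "j < N p n2" and x: "x = block_index (N p n1) (N p n2) a i j"
    using assms(2) by (rule block_index_surj)
  obtain b k l where b: "b < 2" "k < N p n1" "l < N p n2" and y: "y = block_index (N p n1) (N p n2) b k l"
    using assms(3) by (rule block_index_surj)
  show ?thesis unfolding x y N_def
    unfolding curl_div_mat_index[OF b(1) a(1) b(2)[unfolded N_def] a(2)[unfolded N_def] b(3)[unfolded N_def] a(3)[unfolded N_def]]
      curl_div_mat_index[OF a(1) b(1) a(2)[unfolded N_def] b(2)[unfolded N_def] a(3)[unfolded N_def] b(3)[unfolded N_def]]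
    by (rule curl_div_entry_sym)
qed

text \<open>The band structure was used to bound column sums; hermitian symmetry turns them into the
  row sums that bound the spectrum.\<close>

lemma (in near_block_toeplitz) hermitian_eigenvalue_le:
  assumes herm: "\<And>i j. i < s * N1 * N2 \<Longrightarrow> j < s * N1 * N2 \<Longrightarrow> A $$ (j, i) = cnj (A $$ (i, j))"
    and z: "z \<in># eigenvalue_mset A"
  shows "z \<in> \<real>" "norm z \<le> band_norm s p K"
proof -
  show "z \<in> \<real>" by (rule hermitian_eigenvalue_real[OF carrier z herm])
  show "norm z \<le> band_norm s p K"
  proof (rule eigenvalue_norm_le[OF carrier z])
    fix i assume i: "i < s * N1 * N2"
    then obtain b m q where b: "b < s" "m < N1" "q < N2" and y: "i = block_index N1 N2 b m q"
      by (rule block_index_surj)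
    have "(\<Sum>j<s * N1 * N2. norm (A $$ (i, j))) = (\<Sum>j<s * N1 * N2. norm (A $$ (j, i)))"
    proof (rule sum.cong[OF refl])
      fix j assume "j \<in> {..<s * N1 * N2}"
      then have "A $$ (j, i) = cnj (A $$ (i, j))" using i by (intro herm) simp_all
      then show "norm (A $$ (i, j)) = norm (A $$ (j, i))" by simp
    qed
    also have "\<dots> \<le> band_norm s p K"
      unfolding sum_block_index y by (rule column_sum_le[OF b])
    finally show "(\<Sum>j<s * N1 * N2. norm (A $$ (i, j))) \<le> band_norm s p K" .
  qed
qed

lemma measure_torus: "measure lebesgue torus = 4 * pi\<^sup>2"
proof -
  have "measure lebesgue torus = measure lborel torus" by simp
  also have "\<dots> = 4 * pi\<^sup>2" by (simp add: content_Pair power2_eq_square)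
  finally show ?thesis .
qed

text \<open>The error N1 + N2 divided by the size 2 N1 N2 tends to zero. The limit is halved because
  the size counts two blocks while \<open>c\<close> sums over them.\<close>

lemma tendsto_of_bound_inverse:
  fixes f :: "'i \<Rightarrow> complex"
  assumes N: "filterlim N1 at_top \<Phi>" "filterlim N2 at_top \<Phi>"
    and f: "\<forall>\<^sub>F n in \<Phi>. norm (f n - of_nat (N1 n * N2 n) * c) \<le> B * (real (N1 n) + real (N2 n))"
  shows "((\<lambda>n. f n / of_nat (2 * N1 n * N2 n)) \<longlongrightarrow> c / 2) \<Phi>"
proof -
  have inv: "((\<lambda>n. inverse (real (N n))) \<longlongrightarrow> 0) \<Phi>" if "filterlim N at_top \<Phi>" for N :: "'i \<Rightarrow> nat"
    by (rule tendsto_inverse_0_at_top[OF filterlim_compose[OF filterlim_real_sequentially that]])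
  have "((\<lambda>n. B / 2 * (inverse (real (N2 n)) + inverse (real (N1 n)))) \<longlongrightarrow> B / 2 * (0 + 0)) \<Phi>"
    by (intro tendsto_intros inv N)
  then have lim: "((\<lambda>n. B / 2 * (inverse (real (N2 n)) + inverse (real (N1 n)))) \<longlongrightarrow> 0) \<Phi>" by simp
  have "\<forall>\<^sub>F n in \<Phi>. N1 n > 0" "\<forall>\<^sub>F n in \<Phi>. N2 n > 0"
    by (rule eventually_compose_filterlim[OF eventually_gt_at_top N(1)])
       (rule eventually_compose_filterlim[OF eventually_gt_at_top N(2)])
  with f have "\<forall>\<^sub>F n in \<Phi>. norm (f n / of_nat (2 * N1 n * N2 n) - c / 2) \<le>
     B / 2 * (inverse (real (N2 n)) + inverse (real (N1 n)))"
  proof eventually_elim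
    case (elim n)
    let ?d = "real (2 * N1 n * N2 n)"
    have d: "?d > 0" using elim by simp
    have "f n / of_nat (2 * N1 n * N2 n) - c / 2 = (f n - of_nat (N1 n * N2 n) * c) / of_nat (2 * N1 n * N2 n)"
      using elim by (simp add: field_simps)
    then have "norm (f n / of_nat (2 * N1 n * N2 n) - c / 2) = norm (f n - of_nat (N1 n * N2 n) * c) / ?d"
      by (simp only: norm_divide norm_of_nat)
    also have "\<dots> \<le> B * (real (N1 n) + real (N2 n)) / ?d"
      using elim(1) d by (intro divide_right_mono) simp_all
    also have "\<dots> = B / 2 * (inverse (real (N2 n)) + inverse (real (N1 n)))"
      using elim by (simp add: field_simps)
    finally show ?case .
  qed
  from Lim_null_comparison[OF this lim] show ?thesis by (rule LIM_zero_cancel)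
qed

lemma power_coeff_eq_mean:
  "(\<Sum>a<s. power_coeff s p T k a a 0 0) / of_nat s =
    (1 / of_real (measure lebesgue torus)) *
      (LINT t:torus|lebesgue. (1 / of_nat s) * (\<Sum>a<s. power_symbol s p T k a a t))"
proof -
  have int: "power_symbol s p T k a a integrable_on torus" for a
    by (intro integrable_continuous continuous_intros)
  have "(LINT t:torus|lebesgue. (1 / of_nat s) * (\<Sum>a<s. power_symbol s p T k a a t)) =
      integral torus (\<lambda>t. (1 / of_nat s) * (\<Sum>a<s. power_symbol s p T k a a t))"
    by (intro set_integral_continuous_cbox continuous_intros)
  also have "\<dots> = (1 / of_nat s) * (\<Sum>a<s. integral torus (power_symbol s p T k a a))"
    using int by (simp only: Henstock_Kurzweil_Integration.integral_mult_right Henstock_Kurzweil_Integration.integral_sum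
        finite_lessThan)
  finally have lint: "(LINT t:torus|lebesgue. (1 / of_nat s) * (\<Sum>a<s. power_symbol s p T k a a t)) =
      (1 / of_nat s) * (\<Sum>a<s. integral torus (power_symbol s p T k a a))" .
  have "power_coeff s p T k a a 0 0 = integral torus (power_symbol s p T k a a) / of_real (measure lebesgue torus)" for a
    unfolding power_coeff_def measure_torus by (simp add: character_def)
  then show ?thesis unfolding lint by (simp add: sum_divide_distrib[symmetric])
qed

lemma nat_floor_mult_at_top:
  assumes "\<nu> > 0" shows "filterlim (\<lambda>n. nat \<lfloor>real n * \<nu>\<rfloor>) at_top at_top"
  unfolding filterlim_at_top
proof
  fix Z
  have "\<forall>\<^sub>F n in at_top. nat \<lceil>real Z / \<nu>\<rceil> \<le> n" by (rule eventually_ge_at_top)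
  then show "\<forall>\<^sub>F n in at_top. Z \<le> nat \<lfloor>real n * \<nu>\<rfloor>"
  proof eventually_elim
    case (elim n)
    then have "real Z / \<nu> \<le> real n" by linarith
    then have "real Z \<le> real n * \<nu>" using assms by (simp add: pos_divide_le_eq)
    then show ?case by (rule le_nat_floor)
  qed
qed

theorem theorem5p1:
  fixes p :: nat and \<alpha> \<beta> \<nu>\<^sub>1 \<nu>\<^sub>2 :: real
  assumes "p \<ge> 1"
    and "\<nu>\<^sub>1 \<in> \<rat>" and "\<nu>\<^sub>2 \<in> \<rat>"
    and "\<nu>\<^sub>1 > 0" and "\<nu>\<^sub>2 > 0"
  shows "spectral_distribution
    (inf at_top (principal {n :: nat. n > 0 \<and> real n * \<nu>\<^sub>1 \<in> \<nat> \<and> real n * \<nu>\<^sub>2 \<in> \<nat>}))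
    (\<lambda>n. map_mat complex_of_real
       (curl_div_mat p \<alpha> \<beta> (nat \<lfloor>real n * \<nu>\<^sub>1\<rfloor>) (nat \<lfloor>real n * \<nu>\<^sub>2\<rfloor>)))
    2 (curl_div_symbol p \<alpha> \<beta> \<nu>\<^sub>1 \<nu>\<^sub>2) ({-pi..pi} \<times> {-pi..pi})"
proof -
  define S where "S = {n :: nat. n > 0 \<and> real n * \<nu>\<^sub>1 \<in> \<nat> \<and> real n * \<nu>\<^sub>2 \<in> \<nat>}"
  define \<Phi> where "\<Phi> = inf at_top (principal S)"
  define n1 n2 where "n1 n = nat \<lfloor>real n * \<nu>\<^sub>1\<rfloor>" "n2 n = nat \<lfloor>real n * \<nu>\<^sub>2\<rfloor>" for n
  define N1 N2 where "N1 n = n1 n + p - 2" "N2 n = n2 n + p - 2" for n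
  define A where "A n = map_mat complex_of_real (curl_div_mat p \<alpha> \<beta> (n1 n) (n2 n))" for n
  define f where "f = curl_div_symbol p \<alpha> \<beta> \<nu>\<^sub>1 \<nu>\<^sub>2"
  define T where "T = curl_div_fourier p \<alpha> \<beta> \<nu>\<^sub>1 \<nu>\<^sub>2"
  have torus: "{-pi..pi} \<times> {-pi..pi} = torus" by (simp add: cbox_Pair_eq)

  have \<Phi>S: "\<forall>\<^sub>F n in \<Phi>. n \<in> S" unfolding \<Phi>_def eventually_inf_principal by simp
  have \<Phi>top: "filterlim g F \<Phi>" if "filterlim g F at_top" for g :: "nat \<Rightarrow> nat" and F
    using that unfolding \<Phi>_def by (rule filterlim_mono) simp_all
  have lim_n: "filterlim n1 at_top \<Phi>" "filterlim n2 at_top \<Phi>"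
    unfolding n1_n2_def by (intro \<Phi>top nat_floor_mult_at_top assms)+
  have shift: "filterlim (\<lambda>n. g n + p - 2) at_top \<Phi>" if "filterlim g at_top \<Phi>" for g :: "nat \<Rightarrow> nat"
    unfolding filterlim_at_top
  proof
    fix Z
    have "\<forall>\<^sub>F n in \<Phi>. Z + 2 \<le> g n" using that unfolding filterlim_at_top by blast
    then show "\<forall>\<^sub>F n in \<Phi>. Z \<le> g n + p - 2" by eventually_elim linarith
  qed
  have lim: "filterlim N1 at_top \<Phi>" "filterlim N2 at_top \<Phi>"
    unfolding N1_N2_def using shift lim_n by blast+
  have pos: "\<forall>\<^sub>F n in \<Phi>. N1 n > 0" "\<forall>\<^sub>F n in \<Phi>. N2 n > 0"
    by (rule eventually_compose_filterlim[OF eventually_gt_at_top lim(1)])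
       (rule eventually_compose_filterlim[OF eventually_gt_at_top lim(2)])
  have carrier: "A n \<in> carrier_mat (2 * N1 n * N2 n) (2 * N1 n * N2 n)" for n
    using curl_div_mat_carrier[of p \<alpha> \<beta> "n1 n" "n2 n"] unfolding A_def N1_N2_def by simp

  obtain K where K: "\<And>n1 n2. n1 \<ge> 1 \<Longrightarrow> n2 \<ge> 1 \<Longrightarrow> real n1 * \<nu>\<^sub>2 = real n2 * \<nu>\<^sub>1 \<Longrightarrow>
    near_block_toeplitz 2 p K T (n1 + p - 2) (n2 + p - 2) (map_mat complex_of_real (curl_div_mat p \<alpha> \<beta> n1 n2))"
    using curl_div_near_block_toeplitz[OF assms(1), of \<nu>\<^sub>2 \<nu>\<^sub>1 \<alpha> \<beta>] assms(4,5) unfolding T_def by blast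
  have NBT: "near_block_toeplitz 2 p K T (N1 n) (N2 n) (A n)" if n: "n \<in> S" for n
  proof -
    \<comment> \<open>On \<open>S\<close> the floor is exact. Hence \<open>real (n1 n)\<close> times
      \<nu>2 and \<open>real (n2 n)\<close> times \<nu>1 both equal n \<nu>1 \<nu>2, which is the
      fixed ratio that \<open>K\<close> requires.\<close>
    have "\<exists>m. real n * \<nu> = real m \<and> nat \<lfloor>real n * \<nu>\<rfloor> = m \<and> m \<ge> 1" if "real n * \<nu> \<in> \<nat>" "\<nu> > 0" for \<nu>
    proof -
      obtain m where m: "real n * \<nu> = real m" using \<open>real n * \<nu> \<in> \<nat>\<close> by (elim Nats_cases)
      moreover have "real n * \<nu> > 0" using n \<open>\<nu> > 0\<close> by (simp add: S_def)
      ultimately show ?thesis by simp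
    qed
    then have "real (n1 n) = real n * \<nu>\<^sub>1" "n1 n \<ge> 1" "real (n2 n) = real n * \<nu>\<^sub>2" "n2 n \<ge> 1"
      using n assms(4,5) unfolding n1_n2_def S_def by force+
    then show ?thesis unfolding N1_N2_def A_def by (intro K) simp_all
  qed
  have herm: "A n $$ (j, i) = cnj (A n $$ (i, j))" if "i < 2 * N1 n * N2 n" "j < 2 * N1 n * N2 n" for n i j
  proof -
    have "A n $$ (j, i) = of_real (curl_div_mat p \<alpha> \<beta> (n1 n) (n2 n) $$ (j, i))"
      "A n $$ (i, j) = of_real (curl_div_mat p \<alpha> \<beta> (n1 n) (n2 n) $$ (i, j))"
      using that curl_div_mat_carrier[of p \<alpha> \<beta> "n1 n" "n2 n"] unfolding A_def N1_N2_def by simp_all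
    moreover have "curl_div_mat p \<alpha> \<beta> (n1 n) (n2 n) $$ (j, i) = curl_div_mat p \<alpha> \<beta> (n1 n) (n2 n) $$ (i, j)"
      using that unfolding N1_N2_def by (rule curl_div_mat_sym)
    ultimately show ?thesis by (simp only: complex_cnj_complex_of_real)
  qed

  obtain g h :: "real \<times> real \<Rightarrow> real" where gh: "continuous_on UNIV g" "continuous_on UNIV h"
    and ev: "\<And>\<theta>. eigenvalue_mset (f \<theta>) = {#of_real (g \<theta>), of_real (h \<theta>)#}"
    using curl_div_symbol_eigenvalues[of p \<alpha> \<beta> \<nu>\<^sub>1 \<nu>\<^sub>2, folded f_def] by metis
  have "bounded ((\<lambda>t. (g t, h t)) ` torus)"
    by (intro compact_imp_bounded compact_continuous_image compact_cbox continuous_on_Pair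
        continuous_on_subset[OF gh(1)] continuous_on_subset[OF gh(2)] subset_UNIV)
  then obtain B where B: "\<And>t. t \<in> torus \<Longrightarrow> norm (g t, h t) \<le> B" unfolding bounded_iff by blast
  have B': "\<bar>g t\<bar> \<le> B" "\<bar>h t\<bar> \<le> B" if "t \<in> torus" for t
    using B[OF that] norm_fst_le[of "g t" "h t"] norm_snd_le[of "h t" "g t"] by auto
  \<comment> \<open>One segment must contain both the eigenvalues of all matrices and the values of
    the eigenvalue functions of the symbol.\<close>
  define C where "C = max B (band_norm 2 p K)"
  define E where "E n F = (1 / of_nat (2 * N1 n * N2 n)) * (\<Sum>z\<in>#eigenvalue_mset (A n). F z)" for n and F :: "complex \<Rightarrow> complex"
  define \<Lambda> where "\<Lambda> F = (1 / of_real (measure lebesgue torus)) *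
    (LINT t:torus|lebesgue. (1 / of_nat 2) * (\<Sum>z\<in>#eigenvalue_mset (f t). F z))" for F :: "complex \<Rightarrow> complex"

  have meanE: "\<forall>\<^sub>F n in \<Phi>. real_mean C (E n)"
    using \<Phi>S pos
  proof eventually_elim
    case (elim n)
    interpret near_block_toeplitz 2 p K T "N1 n" "N2 n" "A n" by (rule NBT[OF elim(1)])
    have "z \<in> \<real> \<and> norm z \<le> C" if z: "z \<in># eigenvalue_mset (A n)" for z
      using hermitian_eigenvalue_le[OF herm z] unfolding C_def by auto
    then show ?case
      unfolding E_def using elim by (intro real_mean_mset size_eigenvalue_mset carrier) simp_all
  qed
  have mean\<Lambda>: "real_mean C \<Lambda>"
    unfolding \<Lambda>_def
  proof (rule real_mean_integral)
    fix t z assume "t \<in> torus" "z \<in># eigenvalue_mset (f t)"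
    then show "z \<in> \<real> \<and> norm z \<le> C" using B'[of t] unfolding ev C_def by auto
  next
    fix F :: "complex \<Rightarrow> complex" assume F: "continuous_on UNIV F"
    have "continuous_on torus (\<lambda>t. F (of_real (g t)) + F (of_real (h t)))"
      by (intro continuous_on_add continuous_on_compose2[OF F] continuous_on_of_real
          continuous_on_subset[OF gh(1)] continuous_on_subset[OF gh(2)] subset_UNIV)
    then show "continuous_on torus (\<lambda>t. \<Sum>z\<in>#eigenvalue_mset (f t). F z)" unfolding ev by simp
  qed (simp_all only: measure_torus ev size_add_mset size_empty numeral_2_eq_2, simp_all)
  have moments: "((\<lambda>n. E n (\<lambda>z. z ^ k)) \<longlongrightarrow> \<Lambda> (\<lambda>z. z ^ k)) \<Phi>" for k
  proof -
    let ?c = "\<Sum>a<2. power_coeff 2 p T k a a 0 0"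
    \<comment> \<open>The error factor from \<open>trace_pow_mat\<close>, which depends on
      \<open>k\<close> but not on n.\<close>
    let ?B = "2 * real ((k + 2) * p) * (\<Sum>a<2. band_norm 2 p K ^ k + norm (power_coeff 2 p T k a a 0 0))"
    have E: "E n (\<lambda>z. z ^ k) = (\<Sum>x<2 * N1 n * N2 n. (A n ^\<^sub>m k) $$ (x, x)) / of_nat (2 * N1 n * N2 n)" for n
      unfolding E_def sum_eigenvalue_mset_power[OF carrier] by simp
    have "(f t ^\<^sub>m k) $$ (a, a) = power_symbol 2 p T k a a t" if "a < 2" for a t
      unfolding f_def T_def by (rule pow_curl_div_symbol[OF assms(1) that that])
    then have tr: "(\<Sum>z\<in>#eigenvalue_mset (f t). z ^ k) = (\<Sum>a<2. power_symbol 2 p T k a a t)" for t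
      unfolding sum_eigenvalue_mset_power[OF curl_div_symbol_index(1)[of p \<alpha> \<beta> \<nu>\<^sub>1 \<nu>\<^sub>2 t, folded f_def]]
      by (intro sum.cong refl) (simp only: lessThan_iff)
    have \<Lambda>: "\<Lambda> (\<lambda>z. z ^ k) = ?c / 2"
      unfolding \<Lambda>_def tr using power_coeff_eq_mean[of 2 p T k] by simp
    have "\<forall>\<^sub>F n in \<Phi>. norm ((\<Sum>x<2 * N1 n * N2 n. (A n ^\<^sub>m k) $$ (x, x)) - of_nat (N1 n * N2 n) * ?c)
        \<le> ?B * (real (N1 n) + real (N2 n))"
      using \<Phi>S
    proof eventually_elim
      case (elim n)
      show ?case using near_block_toeplitz.trace_pow_mat[OF NBT[OF elim], of k] by (simp only: mult_ac)
    qed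
    from tendsto_of_bound_inverse[OF lim this] show ?thesis unfolding E \<Lambda> .
  qed
  note main = real_mean_tendsto[OF meanE mean\<Lambda> moments]

  have entries: "(\<lambda>t. f t $$ (i, j)) \<in> borel_measurable (lebesgue_on torus)" if "i < 2" "j < 2" for i j
  proof -
    \<comment> \<open>Measurability of the entries is read off from their form as trigonometric
      polynomials.\<close>
    have "continuous_on torus (\<lambda>t. trig_symbol p T i j t)"
      unfolding trig_symbol_def by (intro continuous_intros)
    then have "continuous_on torus (\<lambda>t. f t $$ (i, j))"
      unfolding T_def f_def trig_symbol_curl_div[OF assms(1) that] .
    then show ?thesis by (rule continuous_imp_measurable_on_sets_lebesgue) simp
  qed
  have dim: "dim_row (A n) = 2 * N1 n * N2 n" for n using carrier by (rule carrier_matD)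
  have "filterlim (\<lambda>n. 2 * N1 n * N2 n) at_top \<Phi>"
    unfolding filterlim_at_top
  proof
    fix Z
    have "\<forall>\<^sub>F n in \<Phi>. Z \<le> N1 n" using lim(1) unfolding filterlim_at_top by blast
    with pos(2) show "\<forall>\<^sub>F n in \<Phi>. Z \<le> 2 * N1 n * N2 n"
    proof eventually_elim
      case (elim n)
      have "Z * 1 \<le> (2 * N1 n) * N2 n" using elim by (intro mult_le_mono) auto
      then show ?case by simp
    qed
  qed
  then have dims: "filterlim (\<lambda>n. dim_row (A n)) at_top \<Phi>" unfolding dim .
  have em: "emeasure lebesgue torus = ennreal (4 * pi\<^sup>2)"
    using emeasure_eq_measure2[of torus lebesgue] emeasure_lborel_cbox_finite[of "(- pi, - pi)" "(pi, pi)"]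
    by (simp add: measure_torus[symmetric] emeasure_eq_ennreal_measure)
  have "spectral_distribution \<Phi> A 2 f torus"
    unfolding spectral_distribution_def
  proof (intro conjI allI ballI impI)
    show "0 < emeasure lebesgue torus" "emeasure lebesgue torus < \<infinity>" unfolding em by simp_all
    show "f t \<in> carrier_mat 2 2" for t unfolding f_def by (rule curl_div_symbol_index)
    show "\<forall>\<^sub>F n in \<Phi>. square_mat (A n)" by (simp add: carrier_matD[OF carrier])
    show "((\<lambda>n. (1 / of_nat (dim_row (A n))) * (\<Sum>z\<in>#eigenvalue_mset (A n). F z)) \<longlongrightarrow>
        (1 / of_real (measure lebesgue torus)) *
          (LINT t:torus|lebesgue. (1 / of_nat 2) * (\<Sum>z\<in>#eigenvalue_mset (f t). F z))) \<Phi>"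
      if "continuous_on UNIV F \<and> compact (closure {z. F z \<noteq> 0})" for F :: "complex \<Rightarrow> complex"
      using main[OF conjunct1[OF that]] unfolding E_def \<Lambda>_def dim .
  qed (simp_all add: entries dims)
  then show ?thesis unfolding \<Phi>_def S_def A_def n1_n2_def f_def torus .
qed

end
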